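(* Let $\kappa>0$ and $\alpha\in[0,2\pi)$. Let $p$ and $q$ be polynomials in $z$ of degree $m$ and $n$ respectively, without common factor, and let $w=1/v$ be the magnetic skyrmion solution determined by $$v=-\frac i2\kappa e^{i\alpha}\bar z+\frac{p(z)}{q(z)}.$$ If $m\neq n+1$ (i.e. provided $p/q$ does not grow linearly for large $z$), the integral defining the total energy $E[w]$ is well-defined, and $$E[w]=4\pi\,\max(m,n+1).$$ If $m=n+1$, the integral defining the total energy is not well-defined, but the regularised total energy is $$E^\circ[w]=4\pi\,m .$$
   Context: $(x_1,x_2)$ are Cartesian coordinates on $\mathbb{R}^2$, $z=x_1+ix_2$, $\partial_i=\partial/\partial x_i$. A map $v$ from the plane to the Riemann sphere (with $v=\infty$ at the zeros of $q$), or equivalently $w=1/v$, determines the magnetisation field $\boldsymbol{n}=(n_1,n_2,n_3)^t:\mathbb{R}^2\to S^2\subset\mathbb{R}^3$ by $$n_1+in_2=\frac{2w}{1+|w|^2}=\frac{2\bar v}{1+|v|^2},\qquad n_3=\frac{1-|w|^2}{1+|w|^2}=\frac{|v|^2-1}{|v|^2+1},$$ so $\boldsymbol{n}=(0,0,1)^t$ where $v=\infty$. Functionals of $w$ below mean the corresponding functionals of this $\boldsymbol{n}$. For an angle $\beta$, $R(\beta)$ is the rotation of $\mathbb{R}^3$ about the 3-axis by $\beta$, $\boldsymbol{e}_i^\beta=R(\beta)\boldsymbol{e}_i$ with $\boldsymbol{e}_1,\boldsymbol{e}_2,\boldsymbol{e}_3$ the canonical basis of $\mathbb{R}^3$, $\boldsymbol{n}\cdot\nabla_{-\alpha}\times\boldsymbol{n}=\sum_{i=1}^2\boldsymbol{n}\cdot(\boldsymbol{e}_i^{-\alpha}\times\partial_i\boldsymbol{n})$,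 $(\nabla\boldsymbol{n})^2=|\partial_1\boldsymbol{n}|^2+|\partial_2\boldsymbol{n}|^2$, and $\boldsymbol{n}^\alpha=R(\alpha)\boldsymbol{n}=(n_1^\alpha,n_2^\alpha,n_3^\alpha)^t$. The total energy is $$E[w]=\int_{\mathbb{R}^2}\left(\tfrac12(\nabla\boldsymbol{n})^2+\kappa\,\boldsymbol{n}\cdot\nabla_{-\alpha}\times\boldsymbol{n}+\tfrac{\kappa^2}{2}(1-n_3)^2\right)\mathrm{d}x_1\,\mathrm{d}x_2 ,$$ and this integral is called well-defined if the integrand (the energy density) is Lebesgue (absolutely) integrable on $\mathbb{R}^2$. The degree is $$Q[w]=\frac1{4\pi}\int_{\mathbb{R}^2}\boldsymbol{n}\cdot(\partial_1\boldsymbol{n}\times\partial_2\boldsymbol{n})\,\mathrm{d}x_1\,\mathrm{d}x_2 .$$ With the one-form $\Theta=\kappa(n_1^\alpha\,\mathrm{d}x_1+n_2^\alpha\,\mathrm{d}x_2)$ and $C^R$ the positively oriented circle of radius $R$ centred at the origin, the regularised total vortex strength is $$\Omega^\circ[w]=\frac1{4\pi}\lim_{R\to\infty}\int_{C^R}\Theta ,$$ and the regularised total energy is $E^\circ[w]=4\pi\,(Q[w]+\Omega^\circ[w])$. *)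

theory Defs
  imports
    "HOL-Analysis.Analysis"
    "HOL-Computational_Algebra.Computational_Algebra"
begin

section \<open>Magnetisation field of a sphere-valued map\<close>

text \<open>\<^term>\<open>None\<close> is the point at infinity of the Riemann sphere.\<close>

type_synonym riemann_sphere = "complex option"

definition complex_coord :: "real^2 \<Rightarrow> complex" where
  "complex_coord x = Complex (x $ 1) (x $ 2)"

text \<open>The inverse stereographic projection in terms of v = 1/w:
  n1 + i n2 = 2 cnj v / (1 + |v|^2), n3 = (|v|^2 - 1) / (|v|^2 + 1).\<close>

definition magnetisation :: "(real^2 \<Rightarrow> riemann_sphere) \<Rightarrow> real^2 \<Rightarrow> real^3" where
  "magnetisation v x = (case v x of
      None \<Rightarrow> vector [0, 0, 1]
    | Some u \<Rightarrow> vector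
        [Re (2 * cnj u / complex_of_real (1 + (cmod u)\<^sup>2)),
         Im (2 * cnj u / complex_of_real (1 + (cmod u)\<^sup>2)),
         ((cmod u)\<^sup>2 - 1) / ((cmod u)\<^sup>2 + 1)])"

definition skyrmion_v ::
  "real \<Rightarrow> real \<Rightarrow> complex poly \<Rightarrow> complex poly \<Rightarrow> real^2 \<Rightarrow> riemann_sphere" where
  "skyrmion_v \<kappa> \<alpha> p q x =
    (let z = complex_coord x in
      if poly q z = 0 then None
      else Some (- (\<i> / 2) * complex_of_real \<kappa> * exp (\<i> * complex_of_real \<alpha>) * cnj z
                 + poly p z / poly q z))"

section \<open>Energy and degree\<close>

definition rot3 :: "real \<Rightarrow> real^3^3" where
  "rot3 \<beta> = vector [vector [cos \<beta>, - sin \<beta>, 0],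
                    vector [sin \<beta>, cos \<beta>, 0],
                    vector [0, 0, 1]]"

definition partial :: "2 \<Rightarrow> (real^2 \<Rightarrow> real^3) \<Rightarrow> real^2 \<Rightarrow> real^3" where
  "partial i f x = vector_derivative (\<lambda>s. f (x + s *\<^sub>R axis i 1)) (at 0)"

definition dmi_density :: "real \<Rightarrow> (real^2 \<Rightarrow> real^3) \<Rightarrow> real^2 \<Rightarrow> real" where
  "dmi_density \<alpha> n x =
     n x \<bullet> cross3 (rot3 (- \<alpha>) *v axis 1 1) (partial 1 n x) +
     n x \<bullet> cross3 (rot3 (- \<alpha>) *v axis 2 1) (partial 2 n x)"

definition energy_density :: "real \<Rightarrow> real \<Rightarrow> (real^2 \<Rightarrow> real^3) \<Rightarrow> real^2 \<Rightarrow> real" where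
  "energy_density \<kappa> \<alpha> n x =
     1/2 * ((norm (partial 1 n x))\<^sup>2 + (norm (partial 2 n x))\<^sup>2)
     + \<kappa> * dmi_density \<alpha> n x
     + \<kappa>\<^sup>2 / 2 * (1 - n x $ 3)\<^sup>2"

definition energy_well_defined :: "real \<Rightarrow> real \<Rightarrow> (real^2 \<Rightarrow> real^3) \<Rightarrow> bool" where
  "energy_well_defined \<kappa> \<alpha> n \<longleftrightarrow> integrable lebesgue (energy_density \<kappa> \<alpha> n)"

definition energy :: "real \<Rightarrow> real \<Rightarrow> (real^2 \<Rightarrow> real^3) \<Rightarrow> real" where
  "energy \<kappa> \<alpha> n = integral\<^sup>L lebesgue (energy_density \<kappa> \<alpha> n)"

definition degree_density :: "(real^2 \<Rightarrow> real^3) \<Rightarrow> real^2 \<Rightarrow> real" where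
  "degree_density n x = n x \<bullet> cross3 (partial 1 n x) (partial 2 n x)"

definition magnetic_degree :: "(real^2 \<Rightarrow> real^3) \<Rightarrow> real" where
  "magnetic_degree n = 1 / (4 * pi) * integral\<^sup>L lebesgue (degree_density n)"

section \<open>Regularised energy\<close>

text \<open>A one-form on the plane is a function of a base point and a tangent vector.\<close>

definition Theta :: "real \<Rightarrow> real \<Rightarrow> (real^2 \<Rightarrow> real^3) \<Rightarrow> real^2 \<Rightarrow> real^2 \<Rightarrow> real" where
  "Theta \<kappa> \<alpha> n x h =
     \<kappa> * ((rot3 \<alpha> *v n x) $ 1 * h $ 1 + (rot3 \<alpha> *v n x) $ 2 * h $ 2)"

definition circle_curve :: "real \<Rightarrow> real \<Rightarrow> real^2" where
  "circle_curve R t = vector [R * cos t, R * sin t]"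

definition circle_integral :: "(real^2 \<Rightarrow> real^2 \<Rightarrow> real) \<Rightarrow> real \<Rightarrow> real" where
  "circle_integral \<theta> R =
     integral {0..2 * pi}
       (\<lambda>t. \<theta> (circle_curve R t) (vector_derivative (circle_curve R) (at t)))"

text \<open>\<^const>\<open>Lim\<close> is meaningful only when the limit exists, and
  the Bochner integral is 0 on non-integrable functions, so the values below
  are to be used together with \<open>regularised_energy_well_defined\<close>.\<close>

definition vortex_strength :: "real \<Rightarrow> real \<Rightarrow> (real^2 \<Rightarrow> real^3) \<Rightarrow> real" where
  "vortex_strength \<kappa> \<alpha> n =
     1 / (4 * pi) * Lim at_top (\<lambda>R. circle_integral (Theta \<kappa> \<alpha> n) R)"

definition regularised_energy :: "real \<Rightarrow> real \<Rightarrow> (real^2 \<Rightarrow> real^3) \<Rightarrow> real" where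
  "regularised_energy \<kappa> \<alpha> n = 4 * pi * (magnetic_degree n + vortex_strength \<kappa> \<alpha> n)"

definition regularised_energy_well_defined ::
  "real \<Rightarrow> real \<Rightarrow> (real^2 \<Rightarrow> real^3) \<Rightarrow> bool" where
  "regularised_energy_well_defined \<kappa> \<alpha> n \<longleftrightarrow>
     integrable lebesgue (degree_density n) \<and>
     (\<exists>L. ((\<lambda>R. circle_integral (Theta \<kappa> \<alpha> n) R) \<longlongrightarrow> L) at_top)"

end

theory Submission
  imports Defs "HOL-Real_Asymp.Real_Asymp"
begin

text \<open>Write \<open>v = P/Q\<close> with \<open>Q = q\<close> and \<open>P = p + c * cnj z * q\<close>, where \<open>c = -(\<i>/2) * \<kappa> * exp (\<i> * \<alpha>)\<close>, and
  \<open>D = \<bar>P\<bar>\<^sup>2 + \<bar>Q\<bar>\<^sup>2\<close>. Since \<open>P\<close> and \<open>Q\<close> have no common zero, \<open>D > 0\<close>, and the energy density turns out to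
  be exactly the Laplacian of \<open>ln D\<close>. By Green's theorem the energy in a disc of radius \<open>R\<close> is the flux
  of the gradient of \<open>ln D\<close> through its boundary, and \<open>D\<close> grows like \<open>R\<close> to the power \<open>2 * max m (n + 1)\<close>
  in almost every direction, with uniformly bounded logarithmic derivative. So the flux tends to
  \<open>4 * pi * max m (n + 1)\<close>, whether or not the energy density is integrable. The energy density
  differs from the degree density by the curl of \<open>Theta\<close>, which gives the regularised energy from
  the same limit. For \<open>m = n + 1\<close> the energy density is asymptotically homogeneous of degree \<open>-2\<close>
  with a nonzero leading term, hence not integrable.\<close>

section \<open>Algebra of the stereographic projection\<close>

text \<open>The term \<open>c * cnj z\<close> alone grows like |z|, so it counts as a polynomial
  part of degree 1: with k the larger of 1 and the degree of the polynomial part of p / q, v has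
  size |z|^k in almost every direction, and n + k = max(m, n + 1). That the density is exactly a
  Laplacian reflects the critical coupling: the same kappa fixes the DM term, the potential and the
  modulus of c. The obstacle is k = 1 with |a| = |c|, where a is the coefficient of z in the
  polynomial part. Then c * cnj z + a * z vanishes along a line, near which v need not be large.
  Hence the flux is shown to converge only for almost every angle, it must be bounded without a
  lower bound on v, and integrability of the degree density needs an argument of its own. The degree
  is never evaluated: its integral cancels in the regularised energy.\<close>

definition stereo :: "complex \<Rightarrow> complex \<Rightarrow> real^3" where
  "stereo P Q = (let D = (cmod Q)\<^sup>2 + (cmod P)\<^sup>2 in vector
     [Re (2 * cnj P * Q / of_real D), Im (2 * cnj P * Q / of_real D), ((cmod P)\<^sup>2 - (cmod Q)\<^sup>2) / D])"

text \<open>The derivative of \<^term>\<open>stereo\<close> along a curve depends on the velocities of \<open>P\<close> and \<open>Q\<close> only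
  through \<open>w = Q * P' - P * Q'\<close>.\<close>

definition stereo_tangent :: "complex \<Rightarrow> complex \<Rightarrow> complex \<Rightarrow> real^3" where
  "stereo_tangent P Q w = (let D = (cmod Q)\<^sup>2 + (cmod P)\<^sup>2 in vector
     [Re (2 * (cnj w * Q\<^sup>2 - (cnj P)\<^sup>2 * w) / of_real (D\<^sup>2)),
      Im (2 * (cnj w * Q\<^sup>2 - (cnj P)\<^sup>2 * w) / of_real (D\<^sup>2)),
      4 * Re (cnj P * cnj Q * w) / D\<^sup>2])"

text \<open>The projection is conformal with factor 2 / (1 + |v|^2). For v = P / Q, whose derivative
  is w / Q^2, this gives speed 2 * |w| / D, an expression that stays meaningful at the poles of
  v.\<close>

lemma norm_stereo_tangent:
  assumes "Q \<noteq> 0 \<or> P \<noteq> 0"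
  shows "(norm (stereo_tangent P Q w))\<^sup>2 = 4 * (cmod w)\<^sup>2 / ((cmod Q)\<^sup>2 + (cmod P)\<^sup>2)\<^sup>2"
proof -
  define D where "D = (cmod Q)\<^sup>2 + (cmod P)\<^sup>2"
  have D: "D \<noteq> 0" using assms unfolding D_def by (simp add: sum_power2_eq_zero_iff)
  have *: "(Re (2 * (cnj w * Q\<^sup>2 - (cnj P)\<^sup>2 * w)))\<^sup>2 + (Im (2 * (cnj w * Q\<^sup>2 - (cnj P)\<^sup>2 * w)))\<^sup>2
     + (4 * Re (cnj P * cnj Q * w))\<^sup>2 = 4 * (cmod w)\<^sup>2 * D\<^sup>2"
    unfolding D_def cmod_power2
    apply (simp only: power2_eq_square times_complex.sel minus_complex.sel plus_complex.sel cnj.sel complex.sel complex_Re_numeral complex_Im_numeral)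
    by algebra
  have "(norm (stereo_tangent P Q w))\<^sup>2 = ((Re (2 * (cnj w * Q\<^sup>2 - (cnj P)\<^sup>2 * w)))\<^sup>2 + (Im (2 * (cnj w * Q\<^sup>2 - (cnj P)\<^sup>2 * w)))\<^sup>2
     + (4 * Re (cnj P * cnj Q * w))\<^sup>2) / (D\<^sup>2)\<^sup>2"
    unfolding stereo_tangent_def Let_def D_def[symmetric] Re_divide_of_real Im_divide_of_real
    by (simp only: power2_norm_eq_inner inner_vec_def sum_3 vector_3 inner_real_def)
       (simp add: power2_eq_square add_divide_distrib)
  also have "\<dots> = 4 * (cmod w)\<^sup>2 / D\<^sup>2" unfolding * using D by (simp add: power2_eq_square)
  finally show ?thesis unfolding D_def .
qed

text \<open>This is the area form of the sphere: the squared conformal factor times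
  \<open>Im (cnj w * u)\<close>, the determinant of the two velocities. The sign is positive because
  the projection preserves orientation. The numerator contains D^3, which reduces D^5 to
  D^2.\<close>

lemma stereo_triple:
  assumes "Q \<noteq> 0 \<or> P \<noteq> 0"
  shows "stereo P Q \<bullet> cross3 (stereo_tangent P Q w) (stereo_tangent P Q u) =
    4 * Im (cnj w * u) / ((cmod Q)\<^sup>2 + (cmod P)\<^sup>2)\<^sup>2"
proof -
  define D where "D = (cmod Q)\<^sup>2 + (cmod P)\<^sup>2"
  have D: "D \<noteq> 0" using assms unfolding D_def by (simp add: sum_power2_eq_zero_iff)
  define n1 n2 n3 where "n1 = Re (2 * cnj P * Q)" and "n2 = Im (2 * cnj P * Q)" and "n3 = (cmod P)\<^sup>2 - (cmod Q)\<^sup>2"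
  define t1 where "t1 w = Re (2 * (cnj w * Q\<^sup>2 - (cnj P)\<^sup>2 * w))" for w
  define t2 where "t2 w = Im (2 * (cnj w * Q\<^sup>2 - (cnj P)\<^sup>2 * w))" for w
  define t3 where "t3 w = 4 * Re (cnj P * cnj Q * w)" for w
  have *: "n1 * (t2 w * t3 u - t3 w * t2 u) + n2 * (t3 w * t1 u - t1 w * t3 u) + n3 * (t1 w * t2 u - t2 w * t1 u)
    = 4 * Im (cnj w * u) * D^3"
    unfolding n1_def n2_def n3_def t1_def t2_def t3_def D_def cmod_power2
    apply (simp only: power2_eq_square times_complex.sel minus_complex.sel plus_complex.sel cnj.sel complex.sel complex_Re_numeral complex_Im_numeral)
    by algebra
  have "stereo P Q \<bullet> cross3 (stereo_tangent P Q w) (stereo_tangent P Q u)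
    = (n1 * (t2 w * t3 u - t3 w * t2 u) + n2 * (t3 w * t1 u - t1 w * t3 u) + n3 * (t1 w * t2 u - t2 w * t1 u)) / D^5"
    unfolding stereo_def stereo_tangent_def Let_def D_def[symmetric] Re_divide_of_real Im_divide_of_real
      n1_def[symmetric] n2_def[symmetric] n3_def[symmetric] t1_def[symmetric] t2_def[symmetric] t3_def[symmetric]
    using D by (simp add: inner_vec_def sum_3 cross3_simps) (simp add: field_simps power2_eq_square numeral_eq_Suc)
  also have "\<dots> = 4 * Im (cnj w * u) / D^2" unfolding * using D by (simp add: numeral_eq_Suc)
  finally show ?thesis unfolding D_def .
qed

text \<open>The rotated frame vectors of the DM term are horizontal, so each is encoded by one
  complex number e1 + i * e2, which enters through its conjugate.\<close>

lemma stereo_cross: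
  fixes e1 e2 :: real
  assumes "Q \<noteq> 0 \<or> P \<noteq> 0"
  shows "stereo P Q \<bullet> cross3 (vector [e1, e2, 0]) (stereo_tangent P Q w) =
    - 2 * Im (Complex e1 (- e2) * (cnj w * Q\<^sup>2 + w * (cnj P)\<^sup>2)) / ((cmod Q)\<^sup>2 + (cmod P)\<^sup>2)\<^sup>2"
proof -
  define D where "D = (cmod Q)\<^sup>2 + (cmod P)\<^sup>2"
  have D: "D \<noteq> 0" using assms unfolding D_def by (simp add: sum_power2_eq_zero_iff)
  define n1 n2 n3 where "n1 = Re (2 * cnj P * Q)" and "n2 = Im (2 * cnj P * Q)" and "n3 = (cmod P)\<^sup>2 - (cmod Q)\<^sup>2"
  define t1 where "t1 w = Re (2 * (cnj w * Q\<^sup>2 - (cnj P)\<^sup>2 * w))" for w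
  define t2 where "t2 w = Im (2 * (cnj w * Q\<^sup>2 - (cnj P)\<^sup>2 * w))" for w
  define t3 where "t3 w = 4 * Re (cnj P * cnj Q * w)" for w
  have *: "n1 * (e2 * t3 w) - n2 * (e1 * t3 w) + n3 * (e1 * t2 w - e2 * t1 w)
    = - 2 * Im (Complex e1 (- e2) * (cnj w * Q\<^sup>2 + w * (cnj P)\<^sup>2)) * D"
    unfolding n1_def n2_def n3_def t1_def t2_def t3_def D_def cmod_power2
    apply (simp only: power2_eq_square times_complex.sel minus_complex.sel plus_complex.sel cnj.sel complex.sel complex_Re_numeral complex_Im_numeral)
    by algebra
  have "stereo P Q \<bullet> cross3 (vector [e1, e2, 0]) (stereo_tangent P Q w)
    = (n1 * (e2 * t3 w) - n2 * (e1 * t3 w) + n3 * (e1 * t2 w - e2 * t1 w)) / D^3"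
    unfolding stereo_def stereo_tangent_def Let_def D_def[symmetric] Re_divide_of_real Im_divide_of_real
      n1_def[symmetric] n2_def[symmetric] n3_def[symmetric] t1_def[symmetric] t2_def[symmetric] t3_def[symmetric]
    using D by (simp add: inner_vec_def sum_3 cross3_simps) (simp add: field_simps power2_eq_square numeral_eq_Suc)
  also have "\<dots> = - 2 * Im (Complex e1 (- e2) * (cnj w * Q\<^sup>2 + w * (cnj P)\<^sup>2)) / D^2" unfolding * using D by (simp add: numeral_eq_Suc)
  finally show ?thesis unfolding D_def .
qed

lemma has_vector_derivative_vector_3:
  assumes "(f has_vector_derivative f') (at x)" "(g has_vector_derivative g') (at x)" "(h has_vector_derivative h') (at x)"
  shows "((\<lambda>s. vector [f s, g s, h s] :: real^3) has_vector_derivative vector [f', g', h']) (at x)"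
proof -
  have eq: "(vector [a, b, c] :: real^3) = a *\<^sub>R axis 1 1 + b *\<^sub>R axis 2 1 + c *\<^sub>R axis 3 1" for a b c
    by (simp add: vec_eq_iff forall_3 axis_def)
  show ?thesis unfolding eq
    using assms by (auto intro!: derivative_eq_intros simp: has_real_derivative_iff_has_vector_derivative)
qed

lemma has_vector_derivative_stereo:
  assumes P: "(P has_vector_derivative P') (at s)" and Q: "(Q has_vector_derivative Q') (at s)"
    and nz: "Q s \<noteq> 0 \<or> P s \<noteq> 0"
  shows "((\<lambda>s. stereo (P s) (Q s)) has_vector_derivative stereo_tangent (P s) (Q s) (Q s * P' - P s * Q')) (at s)"
proof -
  define w where "w = Q s * P' - P s * Q'"
  \<comment> \<open>Writing the denominator with conjugates makes it a complex-valued product, so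
    that complex product and quotient rules apply; the first two components are then handled as one
    complex number.\<close>
  define D where "D s = Q s * cnj (Q s) + P s * cnj (P s)" for s
  define R where "R s = (cmod (Q s))\<^sup>2 + (cmod (P s))\<^sup>2" for s
  have DR: "D s = of_real (R s)" for s unfolding D_def R_def by (simp only: of_real_add complex_norm_square)
  have D0: "D s \<noteq> 0"
    unfolding DR R_def of_real_eq_0_iff using nz by (simp add: sum_power2_eq_zero_iff)
  have inv: "((\<lambda>s. f s / D s) has_vector_derivative (f' * D s - f s * (Q' * cnj (Q s) + Q s * cnj Q' + P' * cnj (P s) + P s * cnj P')) / (D s)\<^sup>2) (at s)"
    if "(f has_vector_derivative f') (at s)" for f f'
  proof -
    have "((\<lambda>s. inverse (D s)) has_vector_derivative (Q' * cnj (Q s) + Q s * cnj Q' + P' * cnj (P s) + P s * cnj P') * (- inverse (D s * D s))) (at s)"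
    proof (rule field_vector_diff_chain_at[of D _ s inverse, unfolded o_def])
      show "(D has_vector_derivative Q' * cnj (Q s) + Q s * cnj Q' + P' * cnj (P s) + P s * cnj P') (at s)"
        unfolding D_def by (auto intro!: derivative_eq_intros P Q simp: algebra_simps)
      show "(inverse has_field_derivative - inverse (D s * D s)) (at (D s))"
        using D0 by (auto intro!: derivative_eq_intros)
    qed
    note has_vector_derivative_mult[OF that this]
    then show ?thesis unfolding divide_inverse
      by (rule has_vector_derivative_eq_rhs) (use D0 in \<open>simp add: field_simps power2_eq_square\<close>)
  qed
  have c: "((\<lambda>s. 2 * cnj (P s) * Q s / of_real (R s)) has_vector_derivative
     2 * (cnj w * (Q s)\<^sup>2 - (cnj (P s))\<^sup>2 * w) / of_real ((R s)\<^sup>2)) (at s)"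
    unfolding of_real_power DR[symmetric]
    by (rule has_vector_derivative_eq_rhs[OF inv])
      (auto intro!: derivative_eq_intros P Q simp: D_def w_def algebra_simps power2_eq_square)
  have r: "((\<lambda>s. (P s * cnj (P s) - Q s * cnj (Q s)) / D s) has_vector_derivative
     of_real (4 * Re (cnj (P s) * cnj (Q s) * w) / (R s)\<^sup>2)) (at s)"
  proof (rule has_vector_derivative_eq_rhs[OF inv])
    have *: "complex_of_real (4 * Re z) = 2 * (z + cnj z)" for z by (simp add: complex_add_cnj)
    show "((P' * cnj (P s) + P s * cnj P' - (Q' * cnj (Q s) + Q s * cnj Q')) * D s - (P s * cnj (P s) - Q s * cnj (Q s)) * (Q' * cnj (Q s) + Q s * cnj Q' + P' * cnj (P s) + P s * cnj P')) / (D s)\<^sup>2 =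
      of_real (4 * Re (cnj (P s) * cnj (Q s) * w) / (R s)\<^sup>2)"
      unfolding of_real_divide * of_real_power DR[symmetric]
      by (rule arg_cong[of _ _ "\<lambda>x. x / _"]) (simp add: D_def w_def algebra_simps power2_eq_square)
  qed (auto intro!: derivative_eq_intros P Q)
  have eq: "(P s * cnj (P s) - Q s * cnj (Q s)) / D s = of_real (((cmod (P s))\<^sup>2 - (cmod (Q s))\<^sup>2) / R s)" for s
    unfolding DR by (simp only: of_real_add of_real_diff of_real_divide complex_norm_square)
  note r = r[unfolded eq]
  show ?thesis unfolding stereo_def stereo_tangent_def Let_def R_def[symmetric] w_def[symmetric]
    using c r by (intro has_vector_derivative_vector_3) (auto simp: has_vector_derivative_complex_iff has_real_derivative_iff_has_vector_derivative)
qed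

section \<open>Green's theorem on discs\<close>

lemma prod_Basis_complex: "(\<Prod>b\<in>Basis. (z::complex) \<bullet> b) = Re z * Im z"
  by (simp add: Basis_complex_def)

text \<open>Lebesgue measure is determined by the volumes of boxes, and a box in
  \<open>complex\<close> pulls back to a box with the same sides. This makes Fubini's theorem
  available on \<open>complex\<close>.\<close>

lemma lborel_complex_prod: "(lborel :: complex measure) = distr (lborel \<Otimes>\<^sub>M lborel) borel (\<lambda>(x, y). Complex x y)"
proof (rule lborel_eqI)
  fix l u :: complex assume lu: "\<And>b. b \<in> Basis \<Longrightarrow> l \<bullet> b \<le> u \<bullet> b"
  have le: "Re l \<le> Re u" "Im l \<le> Im u" using lu[of 1] lu[of \<i>] by (auto simp: Basis_complex_def)
  have [measurable]: "(\<lambda>(x, y). Complex x y) \<in> borel \<rightarrow>\<^sub>M borel"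
    by (intro borel_measurable_continuous_onI) (auto simp: split_beta Complex_eq intro!: continuous_intros)
  have "emeasure (distr (lborel \<Otimes>\<^sub>M lborel) borel (\<lambda>(x, y). Complex x y)) (box l u) =
    emeasure lborel ((\<lambda>(x, y). Complex x y) -` box l u)"
    by (subst emeasure_distr) (auto simp: lborel_prod)
  also have "(\<lambda>(x, y). Complex x y) -` box l u = box (Re l, Im l) (Re u, Im u)"
    by (auto simp: box_def Basis_complex_def Basis_prod_def)
  also have "emeasure lborel \<dots> = (\<Prod>b\<in>Basis. ((Re u, Im u) - (Re l, Im l)) \<bullet> b)"
    by (rule emeasure_lborel_box) (use le in \<open>auto simp: Basis_prod_def\<close>)
  also have "(\<Prod>b\<in>Basis. ((Re u, Im u) - (Re l, Im l)) \<bullet> b) = (\<Prod>b\<in>Basis. (u - l) \<bullet> b)"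
    unfolding prod_Basis_complex
    by (subst Basis_prod_def, subst prod.union_disjoint) auto
  finally show "emeasure (distr (lborel \<Otimes>\<^sub>M lborel) borel (\<lambda>(x, y). Complex x y)) (box l u) = (\<Prod>b\<in>Basis. (u - l) \<bullet> b)" .
qed simp

lemma continuous_complex_coord: "continuous_on S complex_coord"
  unfolding complex_coord_def Complex_eq by (intro continuous_intros)

lemma lborel_complex_coord: "(lborel :: complex measure) = distr lborel borel complex_coord"
proof (rule lborel_eqI)
  fix l u :: complex assume lu: "\<And>b. b \<in> Basis \<Longrightarrow> l \<bullet> b \<le> u \<bullet> b"
  have le: "Re l \<le> Re u" "Im l \<le> Im u" using lu[of 1] lu[of \<i>] by (auto simp: Basis_complex_def)
  have [measurable]: "complex_coord \<in> borel \<rightarrow>\<^sub>M borel"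
    by (intro borel_measurable_continuous_onI continuous_complex_coord)
  have "emeasure (distr lborel borel complex_coord) (box l u) = emeasure lborel (complex_coord -` box l u)"
    by (subst emeasure_distr) auto
  also have "complex_coord -` box l u = box (vector [Re l, Im l]) (vector [Re u, Im u])"
    by (auto simp: box_def Basis_complex_def mem_box_cart Basis_vec_def inner_axis forall_2 complex_coord_def)
  also have "emeasure lborel \<dots> = (\<Prod>b\<in>Basis. (vector [Re u, Im u] - vector [Re l, Im l] :: real^2) \<bullet> b)"
  proof (rule emeasure_lborel_box)
    fix b :: "real^2" assume "b \<in> Basis"
    then obtain i where "b = axis i 1" by (auto simp: Basis_vec_def)
    then show "vector [Re l, Im l] \<bullet> b \<le> vector [Re u, Im u] \<bullet> b"
      using exhaust_2[of i] le by (auto simp: inner_axis)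
  qed
  also have "(\<Prod>b\<in>Basis. (vector [Re u, Im u] - vector [Re l, Im l] :: real^2) \<bullet> b) = (\<Prod>b\<in>Basis. (u - l) \<bullet> b)"
  proof -
    have B: "(Basis :: (real^2) set) = (\<lambda>i. axis i 1) ` UNIV" by (auto simp: Basis_vec_def)
    show ?thesis unfolding prod_Basis_complex B
      by (subst prod.reindex) (auto simp: inj_on_def axis_eq_axis UNIV_2 inner_axis)
  qed
  finally show "emeasure (distr lborel borel complex_coord) (box l u) = (\<Prod>b\<in>Basis. (u - l) \<bullet> b)" .
qed simp

text \<open>This moves the problem from \<open>real^2\<close> to \<open>complex\<close>; for Borel
  functions the completed measure gives the same integrals.\<close>

lemma lebesgue_complex_coord:
  fixes g :: "complex \<Rightarrow> real"
  assumes [measurable]: "g \<in> borel_measurable borel"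
  shows "integrable lebesgue (\<lambda>x. g (complex_coord x)) \<longleftrightarrow> integrable lborel g"
    and "integral\<^sup>L lebesgue (\<lambda>x. g (complex_coord x)) = integral\<^sup>L lborel g"
proof -
  have [measurable]: "complex_coord \<in> borel \<rightarrow>\<^sub>M borel"
    by (intro borel_measurable_continuous_onI continuous_complex_coord)
  have 1: "(\<lambda>x. g (complex_coord x)) \<in> borel_measurable lborel" by measurable
  show "integrable lebesgue (\<lambda>x. g (complex_coord x)) \<longleftrightarrow> integrable lborel g"
    unfolding integrable_completion[OF 1] by (subst lborel_complex_coord, subst integrable_distr_eq) auto
  show "integral\<^sup>L lebesgue (\<lambda>x. g (complex_coord x)) = integral\<^sup>L lborel g"
    unfolding integral_completion[OF 1] by (subst lborel_complex_coord, subst integral_distr) auto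
qed

text \<open>Fubini cuts the disc into vertical chords, the fundamental theorem of calculus evaluates
  each chord at its two ends, and the substitution x = R * cos t turns the upper and lower ends into
  the two half circles.\<close>

lemma green_disc_y:
  fixes A A' :: "complex \<Rightarrow> real"
  assumes A: "continuous_on UNIV A" and A': "continuous_on UNIV A'"
    and deriv: "\<And>x y. ((\<lambda>y. A (Complex x y)) has_real_derivative A' (Complex x y)) (at y)"
    and R: "R > 0"
  shows "(LINT z:cball 0 R|lborel. A' z) = integral {0..2*pi} (\<lambda>t. A (R * cis t) * (R * sin t))"
proof -
  have CC: "continuous_on S (\<lambda>x. Complex (f x) (g x))" if "continuous_on S f" "continuous_on S g"
    for S :: "real set" and f g using that unfolding Complex_eq by (intro continuous_intros)
  have contA[continuous_intros]: "continuous_on S (\<lambda>x. A (Complex (f x) (g x)))" if "continuous_on S f" "continuous_on S g"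
    for S :: "real set" and f g by (rule continuous_on_compose2[OF A CC[OF that]]) auto
  have contA': "continuous_on S (\<lambda>x. A' (Complex (f x) (g x)))" if "continuous_on S f" "continuous_on S g"
    for S :: "real set" and f g by (rule continuous_on_compose2[OF A' CC[OF that]]) auto
  define h where "h x = sqrt (R\<^sup>2 - x\<^sup>2)" for x
  have h: "continuous_on S h" for S unfolding h_def by (intro continuous_intros)
  define G1 where "G1 x = A (Complex x (h x))" for x
  define G2 where "G2 x = A (Complex x (- h x))" for x
  have G: "continuous_on S G1" "continuous_on S G2" for S
    unfolding G1_def G2_def by (intro continuous_intros h)+
  have [measurable]: "A' \<in> borel_measurable borel" using A' by (rule borel_measurable_continuous_onI)
  have [measurable]: "(\<lambda>(x, y). Complex x y) \<in> borel \<Otimes>\<^sub>M borel \<rightarrow>\<^sub>M borel"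
    unfolding borel_prod
    by (intro borel_measurable_continuous_onI) (auto simp: split_beta Complex_eq intro!: continuous_intros)
  let ?F = "\<lambda>z::complex. indicator (cball 0 R) z *\<^sub>R A' z"
  have int: "integrable lborel ?F"
    using borel_integrable_compact[of "cball (0::complex) R" A'] A'
    by (simp add: continuous_on_subset)
  have [measurable]: "?F \<in> borel_measurable borel" using borel_measurable_integrable[OF int] by simp
  have int2: "integrable (lborel \<Otimes>\<^sub>M lborel) (\<lambda>(x, y). ?F (Complex x y))"
    using int by (subst (asm) lborel_complex_prod, subst (asm) integrable_distr_eq) (auto simp: split_beta')
  have inner: "(LINT y|lborel. ?F (Complex x y)) = indicator {-R..R} x *\<^sub>R (G1 x - G2 x)" for x
  proof (cases "x \<in> {-R..R}")
    case True
    then have x: "x\<^sup>2 \<le> R\<^sup>2" by (simp add: abs_le_square_iff[symmetric] abs_le_iff)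
    have hx: "h x \<ge> 0" "(h x)\<^sup>2 = R\<^sup>2 - x\<^sup>2" using x by (auto simp: h_def)
    have "Complex x y \<in> cball 0 R \<longleftrightarrow> y \<in> {- h x..h x}" for y
    proof -
      have "Complex x y \<in> cball 0 R \<longleftrightarrow> sqrt (x\<^sup>2 + y\<^sup>2) \<le> R" by (simp add: complex_norm)
      also have "\<dots> \<longleftrightarrow> x\<^sup>2 + y\<^sup>2 \<le> R\<^sup>2" using R
        by (metis less_imp_le real_sqrt_abs real_sqrt_le_iff abs_of_pos)
      also have "\<dots> \<longleftrightarrow> y\<^sup>2 \<le> (h x)\<^sup>2" using hx by auto
      also have "\<dots> \<longleftrightarrow> \<bar>y\<bar> \<le> h x" using abs_le_square_iff[of y "h x"] hx(1) by simp
      finally show ?thesis by (auto simp: abs_le_iff)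
    qed
    then have "(LINT y|lborel. ?F (Complex x y)) = (LINT y|lborel. A' (Complex x y) * indicator {- h x..h x} y)"
      by (intro Bochner_Integration.integral_cong) (auto simp: indicator_def)
    also have "\<dots> = A (Complex x (h x)) - A (Complex x (- h x))"
    proof (rule integral_FTC_Icc_real)
      show "isCont (\<lambda>y. A' (Complex x y)) y" for y
        using contA'[of UNIV "\<lambda>_. x" "\<lambda>y. y"] by (simp add: continuous_on_eq_continuous_at)
    qed (use hx deriv in auto)
    finally show ?thesis using True by (simp add: G1_def G2_def)
  next
    case False
    have "Complex x y \<notin> cball 0 R" for y
      using False abs_Re_le_cmod[of "Complex x y"] by auto
    then show ?thesis using False by simp
  qed
  have "(LINT z:cball 0 R|lborel. A' z) = (LINT z|lborel. ?F z)" by (simp add: set_lebesgue_integral_def)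
  also have "\<dots> = integral\<^sup>L (lborel \<Otimes>\<^sub>M lborel) (\<lambda>(x, y). ?F (Complex x y))"
    by (subst lborel_complex_prod, subst integral_distr, measurable) (simp add: split_beta')
  also have "\<dots> = (LINT x|lborel. LINT y|lborel. ?F (Complex x y))"
    using lborel_pair.integral_fst'[OF int2] by simp
  also have "\<dots> = (LINT x:{-R..R}|lborel. G1 x - G2 x)"
    unfolding inner by (simp add: set_lebesgue_integral_def)
  also have "\<dots> = integral {-R..R} (\<lambda>x. G1 x - G2 x)"
    by (rule set_borel_integral_eq_integral)
      (auto intro!: borel_integrable_atLeastAtMost' continuous_intros G)
  also have "\<dots> = integral {-R..R} G1 - integral {-R..R} G2"
    by (intro Henstock_Kurzweil_Integration.integral_diff integrable_continuous_real G)
  finally have lhs: "(LINT z:cball 0 R|lborel. A' z) = integral {-R..R} G1 - integral {-R..R} G2" .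
  have Rc: "(\<lambda>t. R * cos t) ` S \<subseteq> {-R..R}" for S
  proof -
    have "- R \<le> R * cos t" "R * cos t \<le> R" for t
      using R mult_left_mono[of "-1" "cos t" R] mult_left_mono[of "cos t" 1 R] by auto
    then show ?thesis by auto
  qed
  have hc: "h (R * cos t) = R * \<bar>sin t\<bar>" for t
  proof -
    have "R\<^sup>2 - (R * cos t)\<^sup>2 = (R * \<bar>sin t\<bar>)\<^sup>2"
      by (simp add: power_mult_distrib sin_squared_eq algebra_simps)
    then show ?thesis using R unfolding h_def by (simp only: real_sqrt_abs abs_mult abs_abs abs_of_pos)
  qed
  \<comment> \<open>The substitution rule returns a difference of integrals over the two
    orientations of the interval. On each half circle one of them runs over \<open>{R..-R}\<close>
    and vanishes by \<open>e\<close>.\<close>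
  have sub: "((\<lambda>t. (- R * sin t) *\<^sub>R G (R * cos t)) has_integral (integral {R * cos a..R * cos b} G - integral {R * cos b..R * cos a} G)) {a..b}"
    if "continuous_on {-R..R} G" "a \<le> b" for a b and G :: "real \<Rightarrow> real"
  proof (rule has_integral_substitution_general[of "{}" a b "\<lambda>t. R * cos t" "-R" R])
    show "continuous_on {a..b} (\<lambda>t. R * cos t)" by (intro continuous_intros)
    show "((\<lambda>t. R * cos t) has_real_derivative - R * sin t) (at t within {a..b})" for t
      by (auto intro!: derivative_eq_intros)
  qed (use that Rc in auto)
  have cis: "of_real R * cis t = Complex (R * cos t) (R * sin t)" for t by (simp add: complex_eq_iff)
  have e: "integral {R..-R} G = 0" for G :: "real \<Rightarrow> real" using R by simp
  \<comment> \<open>On the upper half sin t is nonnegative and x runs from R to -R, hence the change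
    of sign.\<close>
  have 1: "((\<lambda>t. A (R * cis t) * (R * sin t)) has_integral integral {-R..R} G1) {0..pi}"
  proof -
    have I: "((\<lambda>t. - ((- R * sin t) *\<^sub>R G1 (R * cos t))) has_integral - (0 - integral {-R..R} G1)) {0..pi}"
      using has_integral_neg[OF sub[of G1 0 pi]] G e[of G1] by simp
    have eq: "- ((- R * sin t) *\<^sub>R G1 (R * cos t)) = A (R * cis t) * (R * sin t)" if "t \<in> {0..pi}" for t
      using that sin_ge_zero[of t] unfolding cis G1_def hc by simp
    show ?thesis using has_integral_eq[OF eq I] by simp
  qed
  \<comment> \<open>On the lower half sin t is nonpositive, so -h(x) is again R * sin t, and x runs
    from -R to R.\<close>
  have 2: "((\<lambda>t. A (R * cis t) * (R * sin t)) has_integral - integral {-R..R} G2) {pi..2*pi}"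
  proof -
    have I: "((\<lambda>t. - ((- R * sin t) *\<^sub>R G2 (R * cos t))) has_integral - (integral {-R..R} G2 - 0)) {pi..2*pi}"
      using has_integral_neg[OF sub[of G2 pi "2*pi"]] G e[of G2] by simp
    have eq: "- ((- R * sin t) *\<^sub>R G2 (R * cos t)) = A (R * cis t) * (R * sin t)" if "t \<in> {pi..2*pi}" for t
    proof -
      have "sin t \<le> 0" using sin_le_zero[of t] that by (cases "t = 2*pi") auto
      then show ?thesis unfolding cis G2_def hc by simp
    qed
    show ?thesis using has_integral_eq[OF eq I] by simp
  qed
  show ?thesis unfolding lhs
    using has_integral_combine[OF _ _ 1 2] by (simp add: integral_unique)
qed

lemma lborel_complex_swap: "(lborel :: complex measure) = distr lborel borel (\<lambda>z. Complex (Im z) (Re z))"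
proof (rule lborel_eqI)
  fix l u :: complex assume lu: "\<And>b. b \<in> Basis \<Longrightarrow> l \<bullet> b \<le> u \<bullet> b"
  have le: "Re l \<le> Re u" "Im l \<le> Im u" using lu[of 1] lu[of \<i>] by (auto simp: Basis_complex_def)
  have [measurable]: "(\<lambda>z. Complex (Im z) (Re z)) \<in> borel \<rightarrow>\<^sub>M borel"
    by (intro borel_measurable_continuous_onI) (auto simp: Complex_eq intro!: continuous_intros)
  have "emeasure (distr lborel borel (\<lambda>z. Complex (Im z) (Re z))) (box l u) =
    emeasure lborel ((\<lambda>z. Complex (Im z) (Re z)) -` box l u)"
    by (subst emeasure_distr) auto
  also have "(\<lambda>z. Complex (Im z) (Re z)) -` box l u = box (Complex (Im l) (Re l)) (Complex (Im u) (Re u))"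
    by (auto simp: box_def Basis_complex_def)
  also have "emeasure lborel \<dots> = (\<Prod>b\<in>Basis. (Complex (Im u) (Re u) - Complex (Im l) (Re l)) \<bullet> b)"
    by (rule emeasure_lborel_box) (use le in \<open>auto simp: Basis_complex_def\<close>)
  also have "\<dots> = (\<Prod>b\<in>Basis. (u - l) \<bullet> b)"
    unfolding prod_Basis_complex by (simp add: mult.commute)
  finally show "emeasure (distr lborel borel (\<lambda>z. Complex (Im z) (Re z))) (box l u) = (\<Prod>b\<in>Basis. (u - l) \<bullet> b)" .
qed simp

text \<open>Exchanging the coordinates replaces the angle t by pi/2 - t and moves the interval of
  integration. Cutting the new interval at 0 and shifting its negative piece by 2 * pi restores the
  original one.\<close>

lemma integral_periodic_reflect:
  fixes g :: "real \<Rightarrow> real"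
  assumes g: "continuous_on UNIV g" and per: "\<And>t. g (t - 2*pi) = g t"
  shows "integral {0..2*pi} (\<lambda>t. g (pi/2 - t)) = integral {0..2*pi} g"
proof -
  have gS: "continuous_on S g" for S using g continuous_on_subset by blast
  have ig: "g integrable_on {a..b}" for a b by (intro integrable_continuous_real gS)
  have "((\<lambda>t. (-1) *\<^sub>R g (pi/2 - t)) has_integral (integral {pi/2 - 0..pi/2 - 2*pi} g - integral {pi/2-2*pi..pi/2-0} g)) {0..2*pi}"
    by (rule has_integral_substitution_general[of "{}" 0 "2*pi" "\<lambda>t. pi/2 - t" "pi/2-2*pi" "pi/2"])
      (auto intro!: derivative_eq_intros continuous_intros gS)
  moreover have "{pi/2 - 0..pi/2 - 2*pi} = {}" using pi_gt_zero by auto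
  ultimately have "((\<lambda>t. - g (pi/2 - t)) has_integral - integral {pi/2-2*pi..pi/2} g) {0..2*pi}" by simp
  from integral_unique[OF has_integral_neg[OF this]]
  have 1: "integral {0..2*pi} (\<lambda>t. g (pi/2 - t)) = integral {pi/2-2*pi..pi/2} g" by simp
  have "((\<lambda>t. 1 *\<^sub>R g (t - 2*pi)) has_integral (integral {pi/2 - 2*pi..2*pi-2*pi} g - integral {2*pi-2*pi..pi/2-2*pi} g)) {pi/2..2*pi}"
    by (rule has_integral_substitution_general[of "{}" _ _ "\<lambda>t. t - 2*pi" "pi/2-2*pi" "0"])
      (auto intro!: derivative_eq_intros continuous_intros gS)
  moreover have "{2*pi-2*pi..pi/2-2*pi} = {}" using pi_gt_zero by auto
  ultimately have 2: "integral {pi/2..2*pi} g = integral {pi/2-2*pi..0} g"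
    by (simp add: per integral_unique)
  have "integral {pi/2-2*pi..0} g + integral {0..pi/2} g = integral {pi/2-2*pi..pi/2} g"
    by (rule Henstock_Kurzweil_Integration.integral_combine[OF _ _ ig]) auto
  moreover have "integral {0..pi/2} g + integral {pi/2..2*pi} g = integral {0..2*pi} g"
    by (rule Henstock_Kurzweil_Integration.integral_combine[OF _ _ ig]) auto
  ultimately show ?thesis unfolding 1 using 2 by simp
qed

text \<open>Reflection in the diagonal preserves the disc and Lebesgue measure and exchanges the two
  partial derivatives, which reduces the claim to \<open>green_disc_y\<close>.\<close>

lemma green_disc_x:
  fixes B B' :: "complex \<Rightarrow> real"
  assumes B: "continuous_on UNIV B" and B': "continuous_on UNIV B'"
    and deriv: "\<And>x y. ((\<lambda>x. B (Complex x y)) has_real_derivative B' (Complex x y)) (at x)"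
    and R: "R > 0"
  shows "(LINT z:cball 0 R|lborel. B' z) = integral {0..2*pi} (\<lambda>t. B (R * cis t) * (R * cos t))"
proof -
  let ?s = "\<lambda>z. Complex (Im z) (Re z)"
  have s: "continuous_on UNIV ?s" unfolding Complex_eq by (intro continuous_intros)
  have [measurable]: "?s \<in> borel \<rightarrow>\<^sub>M borel" using s by (rule borel_measurable_continuous_onI)
  have norm: "?s z \<in> cball 0 R \<longleftrightarrow> z \<in> cball 0 R" for z by (simp add: cmod_def add.commute)
  let ?F = "\<lambda>z::complex. indicator (cball 0 R) z *\<^sub>R B' z"
  have "integrable lborel ?F"
    using borel_integrable_compact[of "cball (0::complex) R" B'] B'
    by (simp add: continuous_on_subset)
  then have [measurable]: "?F \<in> borel_measurable borel" using borel_measurable_integrable by force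
  have "(LINT z:cball 0 R|lborel. B' z) = (LINT z|distr lborel borel ?s. ?F z)"
    unfolding lborel_complex_swap[symmetric] by (simp add: set_lebesgue_integral_def)
  also have "\<dots> = (LINT z|lborel. ?F (?s z))" by (rule integral_distr) measurable
  also have "\<dots> = (LINT z:cball 0 R|lborel. B' (?s z))"
    unfolding set_lebesgue_integral_def indicator_def norm by simp
  also have "\<dots> = integral {0..2*pi} (\<lambda>t. B (?s (R * cis t)) * (R * sin t))"
    by (rule green_disc_y[of "\<lambda>z. B (?s z)" "\<lambda>z. B' (?s z)", OF _ _ _ R])
      (use deriv in \<open>auto intro: continuous_on_compose2[OF B s] continuous_on_compose2[OF B' s]\<close>)
  also have "\<dots> = integral {0..2*pi} (\<lambda>t. (\<lambda>t. B (R * cis t) * (R * cos t)) (pi/2 - t))"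
  proof -
    have "?s (R * cis t) = R * cis (pi/2 - t)" for t by (simp add: complex_eq_iff cos_diff sin_diff)
    moreover have "sin t = cos (pi/2 - t)" for t by (simp add: cos_diff)
    ultimately show ?thesis by simp
  qed
  also have "\<dots> = integral {0..2*pi} (\<lambda>t. B (R * cis t) * (R * cos t))"
  proof (rule integral_periodic_reflect)
    have "continuous_on UNIV (\<lambda>t. B (R * cis t))"
      by (rule continuous_on_compose2[OF B]) (auto simp: cis_conv_exp intro!: continuous_intros)
    then show "continuous_on UNIV (\<lambda>t. B (R * cis t) * (R * cos t))" by (intro continuous_intros)
    show "B (R * cis (t - 2 * pi)) * (R * cos (t - 2 * pi)) = B (R * cis t) * (R * cos t)" for t
      by (simp add: cis.ctr cos_diff sin_diff)
  qed
  finally show ?thesis .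
qed

text \<open>A complex function f encodes the one-form Re f dx + Im f dy = Re (f * cnj dz), whose
  curl is the integrand on the left. The tangent of the circle at z is i * z.\<close>

lemma green_disc:
  fixes f fx fy :: "complex \<Rightarrow> complex"
  assumes f: "continuous_on UNIV f" and fx: "continuous_on UNIV fx" and fy: "continuous_on UNIV fy"
    and dx: "\<And>z s. ((\<lambda>s. f (z + of_real s)) has_vector_derivative fx (z + of_real s)) (at s)"
    and dy: "\<And>z s. ((\<lambda>s. f (z + of_real s * \<i>)) has_vector_derivative fy (z + of_real s * \<i>)) (at s)"
    and R: "R > 0"
  shows "(LINT z:cball 0 R|lborel. Im (fx z) - Re (fy z)) =
    integral {0..2*pi} (\<lambda>t. Re (f (R * cis t) * cnj (\<i> * (R * cis t))))"
proof -
  have x: "Complex x y = Complex 0 y + of_real x" for x y by (simp add: complex_eq_iff)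
  have y: "Complex x y = Complex x 0 + of_real y * \<i>" for x y by (simp add: complex_eq_iff)
  have "(LINT z:cball 0 R|lborel. Im (fx z)) = integral {0..2*pi} (\<lambda>t. Im (f (R * cis t)) * (R * cos t))"
    by (rule green_disc_x[of "\<lambda>z. Im (f z)" "\<lambda>z. Im (fx z)", OF _ _ _ R], (intro continuous_intros f fx)+)
      (subst (1 2) x, use dx in \<open>auto simp: has_vector_derivative_complex_iff\<close>)
  moreover have "(LINT z:cball 0 R|lborel. Re (fy z)) = integral {0..2*pi} (\<lambda>t. Re (f (R * cis t)) * (R * sin t))"
    by (rule green_disc_y[of "\<lambda>z. Re (f z)" "\<lambda>z. Re (fy z)", OF _ _ _ R], (intro continuous_intros f fy)+)
      (subst (1 2) y, use dy in \<open>auto simp: has_vector_derivative_complex_iff\<close>)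
  moreover have "set_integrable lborel (cball 0 R) (\<lambda>z. Im (fx z))" "set_integrable lborel (cball 0 R) (\<lambda>z. Re (fy z))"
    unfolding set_integrable_def by (intro borel_integrable_compact continuous_intros continuous_on_subset[OF fx] continuous_on_subset[OF fy]; simp)+
  moreover have fc: "continuous_on S (\<lambda>t. f (R * cis t))" for S
    by (rule continuous_on_compose2[OF f]) (auto simp: cis_conv_exp intro!: continuous_intros)
  have "integral {0..2*pi} (\<lambda>t. Re (f (R * cis t) * cnj (\<i> * (R * cis t)))) =
    integral {0..2*pi} (\<lambda>t. Im (f (R * cis t)) * (R * cos t) - Re (f (R * cis t)) * (R * sin t))"
    by (rule integral_cong) simp
  then have "integral {0..2*pi} (\<lambda>t. Re (f (R * cis t) * cnj (\<i> * (R * cis t)))) =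
    integral {0..2*pi} (\<lambda>t. Im (f (R * cis t)) * (R * cos t)) - integral {0..2*pi} (\<lambda>t. Re (f (R * cis t)) * (R * sin t))"
    by (simp add: Henstock_Kurzweil_Integration.integral_diff integrable_continuous_real continuous_intros fc)
  ultimately show ?thesis by (simp add: set_integral_diff)
qed

section \<open>Rational functions at infinity\<close>

text \<open>Allowing j above the degree, where the coefficient is 0, spares later case distinctions
  between leading and lower order terms.\<close>

lemma poly_div_power_tendsto:
  fixes f :: "complex poly"
  assumes "degree f \<le> j"
  shows "((\<lambda>z. poly f z / z ^ j) \<longlongrightarrow> coeff f j) at_infinity"
  using assms
proof (induction j arbitrary: f)
  case 0
  then obtain b where "f = [:b:]" by (auto elim: degree_eq_zeroE)
  then show ?case by simp
next
  case (Suc j)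
  obtain b g where f: "f = pCons b g" by (cases f)
  have g: "degree g \<le> j" using Suc.prems by (auto simp: f split: if_splits)
  have "((\<lambda>z::complex. b * inverse z ^ Suc j + poly g z / z ^ j) \<longlongrightarrow> b * 0 ^ Suc j + coeff g j) at_infinity"
    by (intro tendsto_intros Suc.IH g tendsto_inverse_0)
  moreover have "\<forall>\<^sub>F z::complex in at_infinity. b * inverse z ^ Suc j + poly g z / z ^ j = poly f z / z ^ Suc j"
    using eventually_not_equal_at_infinity[of 0] by eventually_elim (simp add: f field_simps)
  ultimately show ?case by (simp add: f tendsto_cong)
qed

lemma eventually_poly_nonzero_at_infinity:
  fixes w :: "complex poly"
  assumes "w \<noteq> 0"
  shows "\<forall>\<^sub>F z in at_infinity. poly w z \<noteq> 0"
proof -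
  have "((\<lambda>z. poly w z / z ^ degree w) \<longlongrightarrow> lead_coeff w) at_infinity" by (rule poly_div_power_tendsto) simp
  then have "\<forall>\<^sub>F z in at_infinity. poly w z / z ^ degree w \<noteq> 0"
    by (rule tendsto_imp_eventually_ne) (use assms in auto)
  then show ?thesis by eventually_elim auto
qed

lemma poly_ratio_tendsto:
  fixes u w :: "complex poly"
  assumes "w \<noteq> 0" and "u = 0 \<or> degree u + j \<le> degree w"
  shows "\<exists>L. ((\<lambda>z. z ^ j * (poly u z / poly w z)) \<longlongrightarrow> L) at_infinity"
proof (cases "u = 0")
  case False
  then have d: "degree u \<le> degree w - j" "j \<le> degree w" using assms by auto
  have "((\<lambda>z. (poly u z / z ^ (degree w - j)) / (poly w z / z ^ degree w)) \<longlongrightarrow> coeff u (degree w - j) / lead_coeff w) at_infinity"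
    by (intro tendsto_divide poly_div_power_tendsto d) (use assms in auto)
  moreover have "\<forall>\<^sub>F z::complex in at_infinity. (poly u z / z ^ (degree w - j)) / (poly w z / z ^ degree w) = z ^ j * (poly u z / poly w z)"
    using eventually_not_equal_at_infinity[of 0]
  proof eventually_elim
    case (elim z)
    have "z ^ degree w = z ^ j * z ^ (degree w - j)" using d by (simp flip: power_add)
    then show ?case using elim by simp
  qed
  ultimately show ?thesis by (auto simp: tendsto_cong)
qed auto

lemma tendsto_imp_eventually_norm_le:
  fixes f :: "'a \<Rightarrow> 'b::real_normed_vector"
  assumes "(f \<longlongrightarrow> L) F"
  obtains B where "B > 0" "\<forall>\<^sub>F x in F. norm (f x) \<le> B"
proof
  show "norm L + 1 > 0" by (simp add: add_nonneg_pos)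
  have "\<forall>\<^sub>F x in F. norm (f x) < norm L + 1"
    using tendsto_norm[OF assms] by (rule order_tendstoD) simp
  then show "\<forall>\<^sub>F x in F. norm (f x) \<le> norm L + 1" by eventually_elim simp
qed

lemma eventually_norm_ge_at_infinity: "\<forall>\<^sub>F z::complex in at_infinity. cmod z \<ge> b"
  by (auto simp: eventually_at_infinity)

section \<open>Integrability criteria on the plane\<close>

text \<open>The exponent \<open>-3/2\<close> makes the product of two such factors comparable with \<open>\<bar>z\<bar>\<close> to the power \<open>-3\<close>,
  the slowest decay that occurs below.\<close>

definition decay :: "real \<Rightarrow> real" where "decay x = (1 + \<bar>x\<bar>) powr (- 3/2)"

lemma decay_measurable [measurable]: "decay \<in> borel_measurable borel"
  unfolding decay_def by measurable

lemma decay_nonneg [simp]: "decay x \<ge> 0" unfolding decay_def by simp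

lemma nn_integral_decay: "(\<integral>\<^sup>+x. decay x \<partial>lborel) < \<infinity>"
proof -
  have half: "(\<integral>\<^sup>+x. ennreal (decay x) * indicator {0..} x \<partial>lborel) = ennreal (0 - (- 2))"
  proof -
    have "(\<integral>\<^sup>+x. ennreal ((1 + x) powr (- 3/2)) * indicator {0..} x \<partial>lborel) = ennreal (0 - (- 2 * (1 + 0) powr (-1/2)))"
    proof (rule nn_integral_FTC_atLeast)
      show "((\<lambda>x::real. - 2 * (1 + x) powr (- 1 / 2)) \<longlongrightarrow> 0) at_top" by real_asymp
      show "((\<lambda>x. - 2 * (1 + x) powr (- 1 / 2)) has_real_derivative (1 + x) powr (- 3 / 2)) (at x)" if "0 \<le> x" for x :: real
        using that by (auto intro!: derivative_eq_intros)
    qed auto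
    also have "(\<integral>\<^sup>+x. ennreal ((1 + x) powr (- 3/2)) * indicator {0..} x \<partial>lborel) = (\<integral>\<^sup>+x. ennreal (decay x) * indicator {0..} x \<partial>lborel)"
      by (rule nn_integral_cong) (auto simp: decay_def indicator_def)
    finally show ?thesis by simp
  qed
  have "(\<integral>\<^sup>+x. decay x \<partial>lborel) \<le> (\<integral>\<^sup>+x. (ennreal (decay x) * indicator {0..} x + ennreal (decay (- x)) * indicator {0..} (- x)) \<partial>lborel)"
    by (rule nn_integral_mono) (auto simp: indicator_def decay_def)
  also have "\<dots> = (\<integral>\<^sup>+x. ennreal (decay x) * indicator {0..} x \<partial>lborel) + (\<integral>\<^sup>+x. ennreal (decay (- x)) * indicator {0..} (- x) \<partial>lborel)"
    by (rule nn_integral_add) auto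
  also have "(\<integral>\<^sup>+x. ennreal (decay (- x)) * indicator {0..} (- x) \<partial>lborel) = (\<integral>\<^sup>+x. ennreal (decay x) * indicator {0..} x \<partial>lborel)"
    by (subst (2) lborel_distr_uminus[symmetric], subst nn_integral_distr) auto
  finally show ?thesis unfolding half by (auto intro: le_less_trans)
qed

text \<open>For fixed Re z an affine substitution makes the inner integral a constant, so the double
  integral factorises. The shear allows decay across an arbitrary non-vertical line, which the
  degenerate linear case requires.\<close>

lemma integrable_decay_shear:
  assumes "b \<noteq> 0"
  shows "integrable lborel (\<lambda>z. decay (Re z) * decay (a * Re z + b * Im z))"
proof (rule integrableI_bounded)
  have [measurable]: "(\<lambda>(x, y). Complex x y) \<in> borel \<Otimes>\<^sub>M borel \<rightarrow>\<^sub>M borel"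
    unfolding borel_prod
    by (intro borel_measurable_continuous_onI) (auto simp: split_beta Complex_eq intro!: continuous_intros)
  have inner: "(\<integral>\<^sup>+y. decay (a * x + b * y) \<partial>lborel) = (1 / \<bar>b\<bar>) * (\<integral>\<^sup>+y. decay y \<partial>lborel)" for x
  proof -
    have "(\<integral>\<^sup>+y. decay y \<partial>lborel) = \<bar>b\<bar> * (\<integral>\<^sup>+y. decay (a * x + b * y) \<partial>lborel)"
      by (rule nn_integral_real_affine) (use assms in auto)
    then show ?thesis using assms by (simp add: mult.assoc[symmetric] ennreal_mult[symmetric])
  qed
  have "(\<integral>\<^sup>+z. ennreal (norm (decay (Re z) * decay (a * Re z + b * Im z))) \<partial>lborel)
    = (\<integral>\<^sup>+z. (\<lambda>(x, y). ennreal (decay x) * ennreal (decay (a * x + b * y))) z \<partial>(lborel \<Otimes>\<^sub>M lborel))"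
    by (subst lborel_complex_prod, subst nn_integral_distr, measurable)
      (auto intro!: nn_integral_cong simp: ennreal_mult abs_mult)
  also have "\<dots> = (\<integral>\<^sup>+x. \<integral>\<^sup>+y. ennreal (decay x) * ennreal (decay (a * x + b * y)) \<partial>lborel \<partial>lborel)"
    by (subst lborel.nn_integral_fst[symmetric]) auto
  also have "\<dots> = (\<integral>\<^sup>+x. decay x \<partial>lborel) * ((1 / \<bar>b\<bar>) * (\<integral>\<^sup>+y. decay y \<partial>lborel))"
    by (simp add: nn_integral_cmult inner nn_integral_multc)
  also have "\<dots> < \<infinity>" using nn_integral_decay by (simp add: ennreal_mult_less_top)
  finally show "(\<integral>\<^sup>+z. ennreal (norm (decay (Re z) * decay (a * Re z + b * Im z))) \<partial>lborel) < \<infinity>" .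
qed measurable

lemma integrable_complexI_bound_outside:
  fixes g h :: "complex \<Rightarrow> real"
  assumes g: "continuous_on UNIV g" and h: "integrable lborel h"
    and bound: "\<forall>\<^sub>F z in at_infinity. \<bar>g z\<bar> \<le> h z"
  shows "integrable lborel g"
proof -
  obtain b where b: "\<And>z. cmod z \<ge> b \<Longrightarrow> \<bar>g z\<bar> \<le> h z" using bound by (auto simp: eventually_at_infinity)
  have [measurable]: "g \<in> borel_measurable borel" using g by (rule borel_measurable_continuous_onI)
  have "integrable lborel (\<lambda>z. \<bar>indicator (cball 0 b) z *\<^sub>R g z\<bar> + \<bar>h z\<bar>)"
    using borel_integrable_compact[of "cball (0::complex) b" g] g h
    by (intro Bochner_Integration.integrable_add integrable_abs) (auto simp: continuous_on_subset)
  then show ?thesis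
    by (rule Bochner_Integration.integrable_bound) (use b in \<open>auto simp: indicator_def not_le intro!: AE_I2 order_trans[OF b]\<close>)
qed

text \<open>Both 1 + |Re z| and 1 + |Im z| are at most 2 * |z|. Raising their product to the power
  -3/2 gives |z|^(-3) up to the factor 2^3 = 8.\<close>

lemma inverse_cube_le_decay:
  assumes "cmod z \<ge> 1"
  shows "1 / (cmod z)^3 \<le> 8 * (decay (Re z) * decay (Im z))"
proof -
  have "(1 + \<bar>Re z\<bar>) * (1 + \<bar>Im z\<bar>) \<le> (2 * cmod z) * (2 * cmod z)"
    using assms abs_Re_le_cmod[of z] abs_Im_le_cmod[of z] by (intro mult_mono) auto
  then have "((2 * cmod z) * (2 * cmod z)) powr (-3/2) \<le> ((1 + \<bar>Re z\<bar>) * (1 + \<bar>Im z\<bar>)) powr (-3/2)"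
    by (intro powr_mono2') (auto intro!: mult_pos_pos)
  also have "\<dots> = decay (Re z) * decay (Im z)" by (simp add: decay_def powr_mult)
  also have "((2 * cmod z) * (2 * cmod z)) powr (-3/2) = 1 / (2 * cmod z) ^ 3"
  proof -
    define r where "r = 2 * cmod z"
    have r: "r > 0" unfolding r_def using assms by linarith
    have "(r * r) powr (-3/2) = (r powr 2) powr (-3/2)" using r by (simp add: powr_numeral power2_eq_square)
    also have "\<dots> = r powr (- 3)" by (simp add: powr_powr)
    also have "\<dots> = 1 / r ^ 3" using r by (simp add: powr_minus powr_numeral divide_inverse)
    finally show ?thesis by (simp only: r_def)
  qed
  finally show ?thesis by (simp add: power_mult_distrib)
qed

lemma inverse_square_le_decay: "1 / (1 + x\<^sup>2) \<le> 2 * decay x"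
proof -
  have "1 / (2 * (1 + x\<^sup>2)) \<le> 1 / (1 + \<bar>x\<bar>)\<^sup>2"
  proof (rule divide_left_mono)
    show "(1 + \<bar>x\<bar>)\<^sup>2 \<le> 2 * (1 + x\<^sup>2)" using sum_squares_bound[of 1 "\<bar>x\<bar>"] by (simp add: power2_sum)
  qed (auto intro!: mult_pos_pos add_pos_nonneg)
  also have "1 / (1 + \<bar>x\<bar>)\<^sup>2 = (1 + \<bar>x\<bar>) powr (-2)"
    by (simp add: powr_minus powr_numeral divide_inverse)
  also have "\<dots> \<le> decay x" unfolding decay_def by (intro powr_mono) auto
  also have "1 / (2 * (1 + x\<^sup>2)) = (1 / (1 + x\<^sup>2)) / 2" by (simp only: divide_divide_eq_left mult.commute)
  finally show ?thesis by (simp only: divide_le_eq_numeral1 mult.commute)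
qed

lemma integrable_complexI_inverse_cube:
  fixes g :: "complex \<Rightarrow> real"
  assumes g: "continuous_on UNIV g" and bound: "\<forall>\<^sub>F z in at_infinity. \<bar>g z\<bar> \<le> M / cmod z ^ 3" and M: "M \<ge> 0"
  shows "integrable lborel g"
proof (rule integrable_complexI_bound_outside[OF g])
  show "integrable lborel (\<lambda>z. 8 * M * (decay (Re z) * decay (0 * Re z + 1 * Im z)))"
    by (intro integrable_mult_right integrable_decay_shear) simp
  show "\<forall>\<^sub>F z in at_infinity. \<bar>g z\<bar> \<le> 8 * M * (decay (Re z) * decay (0 * Re z + 1 * Im z))"
    using bound eventually_norm_ge_at_infinity[of 1]
  proof eventually_elim
    case (elim z)
    have "M * (1 / cmod z ^ 3) \<le> M * (8 * (decay (Re z) * decay (Im z)))"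
      by (intro mult_left_mono inverse_cube_le_decay elim M)
    then show ?case using elim(1) by simp
  qed
qed

section \<open>Integrals over tails, discs and rescaled sets\<close>

lemma integrable_tail_tendsto_0:
  fixes g :: "complex \<Rightarrow> real"
  assumes g: "integrable lborel g"
  shows "((\<lambda>R. LINT z|lborel. indicator {z. R \<le> cmod z} z * g z) \<longlongrightarrow> 0) at_top"
proof -
  have [measurable]: "g \<in> borel_measurable borel" using g by auto
  have "((\<lambda>R. LINT z|lborel. indicator {z. R \<le> cmod z} z * g z) \<longlongrightarrow> (LINT z|(lborel :: complex measure). 0)) at_top"
  proof (rule integral_dominated_convergence_at_top[where w = "\<lambda>z. \<bar>g z\<bar>"])
    show "AE z in lborel. ((\<lambda>R. indicator {z. R \<le> cmod z} z * g z) \<longlongrightarrow> 0) at_top"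
    proof (rule AE_I2)
      fix z :: complex
      have "\<forall>\<^sub>F R in at_top. indicator {z. R \<le> cmod z} z * g z = 0"
        using eventually_gt_at_top[of "cmod z"] by eventually_elim (simp add: indicator_def)
      then show "((\<lambda>R. indicator {z. R \<le> cmod z} z * g z) \<longlongrightarrow> 0) at_top" by (simp add: tendsto_eventually)
    qed
    show "\<forall>\<^sub>F R in at_top. AE z in lborel. norm (indicator {z. R \<le> cmod z} z * g z) \<le> \<bar>g z\<bar>"
      by (intro always_eventually allI AE_I2) (simp add: indicator_def)
    show "integrable lborel (\<lambda>z. \<bar>g z\<bar>)" using g by simp
  qed auto
  then show ?thesis by simp
qed

lemma integral_cball_tendsto:
  fixes g :: "complex \<Rightarrow> real"
  assumes g: "integrable lborel g"
  shows "((\<lambda>R. LINT z:cball 0 R|lborel. g z) \<longlongrightarrow> integral\<^sup>L lborel g) at_top"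
  unfolding set_lebesgue_integral_def
proof (rule integral_dominated_convergence_at_top[where w = "\<lambda>z. \<bar>g z\<bar>"])
  have [measurable]: "g \<in> borel_measurable borel" using g by auto
  show "g \<in> borel_measurable lborel" using g by auto
  have [measurable]: "cball (0::complex) R \<in> sets borel" for R by simp
  show "(\<lambda>z. indicator (cball 0 R) z *\<^sub>R g z) \<in> borel_measurable lborel" for R by measurable
  show "AE z in lborel. ((\<lambda>R. indicator (cball 0 R) z *\<^sub>R g z) \<longlongrightarrow> g z) at_top"
  proof (rule AE_I2)
    fix z :: complex
    have "\<forall>\<^sub>F R in at_top. indicator (cball 0 R) z *\<^sub>R g z = g z"
      using eventually_gt_at_top[of "cmod z"] by eventually_elim (simp add: indicator_def)
    then show "((\<lambda>R. indicator (cball 0 R) z *\<^sub>R g z) \<longlongrightarrow> g z) at_top" by (simp add: tendsto_eventually)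
  qed
  show "\<forall>\<^sub>F R in at_top. AE z in lborel. norm (indicator (cball 0 R) z *\<^sub>R g z) \<le> \<bar>g z\<bar>"
    by (intro always_eventually allI AE_I2) (simp add: indicator_def)
  show "integrable lborel (\<lambda>z. \<bar>g z\<bar>)" using g by simp
qed

lemma nn_integral_complex_scale:
  fixes g :: "complex \<Rightarrow> ennreal"
  assumes [measurable]: "g \<in> borel_measurable borel" and r: "r \<noteq> 0"
  shows "(\<integral>\<^sup>+z. g z \<partial>lborel) = (\<integral>\<^sup>+z. ennreal (r\<^sup>2) * g (of_real r * z) \<partial>lborel)"
proof -
  have "(\<integral>\<^sup>+z. g z \<partial>lborel) = (\<integral>\<^sup>+z. g z \<partial>density (distr lborel borel (\<lambda>x. 0 + r *\<^sub>R x)) (\<lambda>_. ennreal (\<bar>r\<bar> ^ DIM(complex))))"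
    using lborel_affine[OF r, of "0::complex"] by simp
  also have "\<dots> = (\<integral>\<^sup>+z. ennreal (r\<^sup>2) * g (of_real r * z) \<partial>lborel)"
    by (subst nn_integral_density, simp_all, subst nn_integral_distr, simp_all add: scaleR_conv_of_real)
  finally show ?thesis .
qed

text \<open>Rescaling by \<open>n\<close> moves the mass of \<open>S\<close> into the tail of \<open>g\<close>, so Fatou's lemma forces the
  limit of \<open>n\<^sup>2 * g (n * z)\<close> to vanish almost everywhere.\<close>

lemma not_integrable_homogeneous_limit:
  fixes g h :: "complex \<Rightarrow> real"
  assumes g [measurable]: "g \<in> borel_measurable borel"
    and S: "open S" "S \<noteq> {}" and d: "d > 0" "\<And>z. z \<in> S \<Longrightarrow> cmod z \<ge> d"
    and lim: "\<And>z. z \<in> S \<Longrightarrow> ((\<lambda>r. r\<^sup>2 * g (of_real r * z)) \<longlongrightarrow> h z) at_top"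
    and h: "\<And>z. z \<in> S \<Longrightarrow> h z \<noteq> 0"
  shows "\<not> integrable lborel g"
proof
  assume int: "integrable lborel g"
  have [measurable]: "S \<in> sets borel" using S by simp
  define u where "u n z = ennreal (indicator S z * ((real (Suc n))\<^sup>2 * \<bar>g (of_real (real (Suc n)) * z)\<bar>))" for n z
  have u_meas [measurable]: "u n \<in> borel_measurable borel" for n unfolding u_def by measurable
  define T where "T R = (LINT z|lborel. indicator {z. R \<le> cmod z} z * \<bar>g z\<bar>)" for R
  have T: "(T \<longlongrightarrow> 0) at_top" unfolding T_def by (rule integrable_tail_tendsto_0) (use int in simp)
  \<comment> \<open>The factor r^2 in \<open>u\<close> is the Jacobian of z -> r * z, which carries
    S outside the disc of radius r * d.\<close>
  have uT: "(\<integral>\<^sup>+z. u n z \<partial>lborel) \<le> ennreal (T (real (Suc n) * d))" for n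
  proof -
    let ?r = "real (Suc n)"
    have "integrable lborel (\<lambda>z. \<bar>g z\<bar> * indicator {z. ?r * d \<le> cmod z} z)"
      by (rule integrable_real_mult_indicator) (use int in auto)
    then have i: "integrable lborel (\<lambda>z. indicator {z. ?r * d \<le> cmod z} z * \<bar>g z\<bar>)" by (simp add: mult.commute)
    have "u n z \<le> ennreal (?r\<^sup>2) * ennreal (indicator {z. ?r * d \<le> cmod z} (of_real ?r * z) * \<bar>g (of_real ?r * z)\<bar>)" for z
    proof (cases "z \<in> S")
      case True
      have "?r * d \<le> cmod (of_real ?r * z)" unfolding norm_mult norm_of_real using d(2)[OF True] by (simp add: mult_left_mono)
      then show ?thesis using True by (simp add: u_def indicator_def ennreal_mult'[symmetric])
    qed (simp add: u_def)
    then have "(\<integral>\<^sup>+z. u n z \<partial>lborel) \<le> (\<integral>\<^sup>+z. ennreal (?r\<^sup>2) * ennreal (indicator {z. ?r * d \<le> cmod z} (of_real ?r * z) * \<bar>g (of_real ?r * z)\<bar>) \<partial>lborel)"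
      by (intro nn_integral_mono)
    also have "\<dots> = (\<integral>\<^sup>+z. ennreal (indicator {z. ?r * d \<le> cmod z} z * \<bar>g z\<bar>) \<partial>lborel)"
      by (rule nn_integral_complex_scale[symmetric]) auto
    also have "\<dots> = ennreal (T (?r * d))" unfolding T_def
      by (rule nn_integral_eq_integral[OF i]) (auto simp: indicator_def)
    finally show ?thesis .
  qed
  have "(\<lambda>n. ennreal (T (real (Suc n) * d))) \<longlonglongrightarrow> ennreal 0"
    by (intro tendsto_ennrealI filterlim_compose[OF T]) (use d in real_asymp)
  then have "liminf (\<lambda>n. ennreal (T (real (Suc n) * d))) = 0"
    using lim_imp_Liminf trivial_limit_sequentially by fastforce
  moreover have "liminf (\<lambda>n. \<integral>\<^sup>+z. u n z \<partial>lborel) \<le> liminf (\<lambda>n. ennreal (T (real (Suc n) * d)))"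
    by (intro Liminf_mono always_eventually allI uT)
  moreover have "(\<integral>\<^sup>+z. liminf (\<lambda>n. u n z) \<partial>lborel) \<le> liminf (\<lambda>n. \<integral>\<^sup>+z. u n z \<partial>lborel)"
    by (rule nn_integral_liminf) simp
  ultimately have "(\<integral>\<^sup>+z. liminf (\<lambda>n. u n z) \<partial>lborel) = 0" by simp
  then have ae: "AE z in lborel. liminf (\<lambda>n. u n z) = 0"
    by (subst (asm) nn_integral_0_iff_AE) auto
  have lim_u: "liminf (\<lambda>n. u n z) = ennreal \<bar>h z\<bar>" if "z \<in> S" for z
  proof -
    have "(\<lambda>n. (real (Suc n))\<^sup>2 * g (of_real (real (Suc n)) * z)) \<longlonglongrightarrow> h z"
      by (rule filterlim_compose[OF lim[OF that]]) real_asymp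
    then have "(\<lambda>n. \<bar>(real (Suc n))\<^sup>2 * g (of_real (real (Suc n)) * z)\<bar>) \<longlonglongrightarrow> \<bar>h z\<bar>" by (rule tendsto_rabs)
    then have "(\<lambda>n. u n z) \<longlonglongrightarrow> ennreal \<bar>h z\<bar>"
      using that by (simp add: u_def abs_mult tendsto_ennrealI)
    then show ?thesis by (rule lim_imp_Liminf[OF trivial_limit_sequentially])
  qed
  have "AE z in lborel. z \<notin> S" using ae
  proof eventually_elim
    case (elim z)
    then show ?case using lim_u[of z] h[of z] by auto
  qed
  then have "S \<in> null_sets lborel" by (subst AE_iff_null_sets) auto
  then have "negligible S" by (simp add: negligible_iff_null_sets null_sets_completionI)
  then show False using open_not_negligible[OF S] by simp
qed

section \<open>Energy and degree densities of the skyrmion\<close>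

locale skyrmion =
  fixes \<kappa> \<alpha> :: real and p q :: "complex poly"
  assumes \<kappa>_pos: "\<kappa> > 0" and q_nz: "q \<noteq> 0" and coprime_pq: "coprime p q"
begin

definition c :: complex where "c = - (\<i> / 2) * of_real \<kappa> * exp (\<i> * of_real \<alpha>)"
text \<open>The map is \<open>v = P / Q\<close>. Working with \<open>P\<close> and \<open>Q\<close>, which have no common zero, makes the poles of
  \<open>v\<close> ordinary points. \<open>S\<close> and \<open>Q'\<close> are the Wirtinger derivatives of \<open>P\<close> and \<open>Q\<close> in \<open>z\<close>, and
  \<open>W / Q\<^sup>2\<close> is the derivative of \<open>p / q\<close>.\<close>

definition P :: "complex \<Rightarrow> complex" where "P z = poly p z + c * cnj z * poly q z"
definition Q :: "complex \<Rightarrow> complex" where "Q z = poly q z"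
definition S :: "complex \<Rightarrow> complex" where "S z = poly (pderiv p) z + c * cnj z * poly (pderiv q) z"
definition Q' :: "complex \<Rightarrow> complex" where "Q' z = poly (pderiv q) z"
definition W :: "complex \<Rightarrow> complex" where "W z = Q z * S z - P z * Q' z"
definition D :: "complex \<Rightarrow> real" where "D z = (cmod (Q z))\<^sup>2 + (cmod (P z))\<^sup>2"

definition field_N :: "real^2 \<Rightarrow> real^3" where
  "field_N = magnetisation (skyrmion_v \<kappa> \<alpha> p q)"

definition e_dens :: "complex \<Rightarrow> real" where
  "e_dens z = 4 * ((cmod (W z))\<^sup>2 + (cmod c)\<^sup>2 * (cmod (Q z))^4 - 2 * Re (c * W z * (cnj (P z))\<^sup>2)) / (D z)\<^sup>2"
text \<open>Away from the zeros of Q this is the Jacobian |v_z|^2 - |v_zbar|^2 of v times the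
  squared conformal factor, where v_z = W / Q^2 and v_zbar = c.\<close>

definition q_dens :: "complex \<Rightarrow> real" where
  "q_dens z = 4 * ((cmod (W z))\<^sup>2 - (cmod c)\<^sup>2 * (cmod (Q z))^4) / (D z)\<^sup>2"

lemma norm_c: "cmod c = \<kappa> / 2"
  unfolding c_def using \<kappa>_pos by (simp add: norm_mult)

lemma PQ_nz: "Q z \<noteq> 0 \<or> P z \<noteq> 0"
  using coprime_pq unfolding P_def Q_def by (auto dest: coprime_poly_0)

lemma D_pos: "D z > 0"
  using PQ_nz[of z] unfolding D_def
  by (metis add.commute add_nonneg_pos norm_eq_zero zero_le_power2 zero_less_power2)

text \<open>At a zero of q the numerator P is nonzero and \<open>stereo\<close> takes the value (0,
  0, 1) prescribed for \<open>None\<close>, so one formula covers poles and ordinary points.\<close>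

lemma field_N_eq: "field_N x = stereo (P (complex_coord x)) (Q (complex_coord x))"
proof (cases "poly q (complex_coord x) = 0")
  case True
  have "P (complex_coord x) \<noteq> 0" using PQ_nz[of "complex_coord x"] True by (simp add: Q_def)
  then show ?thesis using True
    unfolding field_N_def magnetisation_def skyrmion_v_def stereo_def Let_def by (simp add: Q_def)
next
  case False
  define z where "z = complex_coord x"
  define u where "u = P z / Q z"
  have Q: "Q z \<noteq> 0" using False by (simp add: Q_def z_def)
  have u: "skyrmion_v \<kappa> \<alpha> p q x = Some u"
    using Q unfolding skyrmion_v_def u_def Let_def z_def[symmetric]
    by (auto simp: c_def P_def Q_def field_simps)
  have D: "(cmod u)\<^sup>2 + 1 = D z / (cmod (Q z))\<^sup>2"
    using Q by (simp add: u_def D_def norm_divide power_divide field_simps)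
  have 1: "2 * cnj u / complex_of_real (1 + (cmod u)\<^sup>2) = 2 * cnj (P z) * Q z / of_real (D z)"
    unfolding add.commute[of 1] D of_real_divide complex_norm_square[of "Q z"] unfolding u_def using Q D_pos[of z]
    by (simp add: field_simps)
  have 2: "((cmod u)\<^sup>2 - 1) / ((cmod u)\<^sup>2 + 1) = ((cmod (P z))\<^sup>2 - (cmod (Q z))\<^sup>2) / D z"
  proof -
    have "(cmod u)\<^sup>2 = (cmod (P z))\<^sup>2 / (cmod (Q z))\<^sup>2" by (simp add: u_def norm_divide power_divide)
    then have "(cmod u)\<^sup>2 - 1 = ((cmod (P z))\<^sup>2 - (cmod (Q z))\<^sup>2) / (cmod (Q z))\<^sup>2"
      using Q by (simp add: field_simps)
    then show ?thesis unfolding D using Q by simp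
  qed
  show ?thesis
    unfolding field_N_def magnetisation_def u z_def[symmetric] option.case 1 2 stereo_def Let_def D_def ..
qed

lemma poly_line_deriv:
  fixes z d :: complex
  shows "((\<lambda>s. poly f (z + of_real s * d)) has_vector_derivative d * poly (pderiv f) (z + of_real s * d)) (at s)"
  by (rule field_vector_diff_chain_at[of "\<lambda>s. z + of_real s * d" _ _ "poly f", unfolded o_def])
    (auto intro!: derivative_eq_intros)

lemma Q_deriv: "((\<lambda>s. Q (z + of_real s * d)) has_vector_derivative d * Q' (z + of_real s * d)) (at s)"
  unfolding Q_def Q'_def by (rule poly_line_deriv)

lemma P_deriv: "((\<lambda>s. P (z + of_real s * d)) has_vector_derivative
    d * S (z + of_real s * d) + c * cnj d * Q (z + of_real s * d)) (at s)"
  unfolding P_def S_def Q_def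
  by (rule has_vector_derivative_eq_rhs, (rule derivative_intros poly_line_deriv)+) (simp add: algebra_simps)

lemma complex_coord_axis:
  "complex_coord (x + s *\<^sub>R axis 1 1) = complex_coord x + of_real s * 1"
  "complex_coord (x + s *\<^sub>R axis 2 1) = complex_coord x + of_real s * \<i>"
  by (simp_all add: complex_coord_def complex_eq_iff axis_def)

text \<open>In direction d the z-derivative contributes d * W and the dependence on cnj z
  contributes cnj d * c * Q^2. The directions 1 and i give the sum and i times the
  difference.\<close>

lemma partial_field_N:
  fixes x :: "real^2"
  defines "z \<equiv> complex_coord x"
  shows "partial 1 field_N x = stereo_tangent (P z) (Q z) (W z + c * (Q z)\<^sup>2)"
    and "partial 2 field_N x = stereo_tangent (P z) (Q z) (\<i> * (W z - c * (Q z)\<^sup>2))"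
proof -
  have *: "((\<lambda>s. stereo (P (z + of_real s * d)) (Q (z + of_real s * d))) has_vector_derivative
     stereo_tangent (P z) (Q z) (d * W z + cnj d * c * (Q z)\<^sup>2)) (at 0)" for d
    using has_vector_derivative_stereo[OF P_deriv[of z d 0] Q_deriv[of z d 0]] PQ_nz[of z]
    by (simp add: W_def algebra_simps power2_eq_square)
  show "partial 1 field_N x = stereo_tangent (P z) (Q z) (W z + c * (Q z)\<^sup>2)"
    unfolding partial_def field_N_eq complex_coord_axis z_def[symmetric]
    using vector_derivative_at[OF *[of 1]] by simp
  show "partial 2 field_N x = stereo_tangent (P z) (Q z) (\<i> * (W z - c * (Q z)\<^sup>2))"
    unfolding partial_def field_N_eq complex_coord_axis z_def[symmetric]
    using vector_derivative_at[OF *[of \<i>]] by (simp add: algebra_simps)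
qed

lemma degree_density_eq: "degree_density field_N x = q_dens (complex_coord x)"
proof -
  define z where "z = complex_coord x"
  have "degree_density field_N x = 4 * Im (cnj (W z + c * (Q z)\<^sup>2) * (\<i> * (W z - c * (Q z)\<^sup>2))) / (D z)\<^sup>2"
    unfolding degree_density_def partial_field_N z_def[symmetric] field_N_eq stereo_triple[OF PQ_nz] D_def ..
  also have "Im (cnj (W z + c * (Q z)\<^sup>2) * (\<i> * (W z - c * (Q z)\<^sup>2))) = (cmod (W z))\<^sup>2 - (cmod (c * (Q z)\<^sup>2))\<^sup>2"
    unfolding cmod_power2 by (simp add: algebra_simps power2_eq_square)
  finally show ?thesis
    by (simp add: q_dens_def z_def norm_mult norm_power power_mult_distrib flip: power_mult)
qed

text \<open>The potential has exactly the coefficient for which it cancels the |Q|^4 part of the DM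
  term; the remaining |Q|^4 term comes from the gradient energy.\<close>

lemma energy_density_eq: "energy_density \<kappa> \<alpha> field_N x = e_dens (complex_coord x)"
proof -
  define z where "z = complex_coord x"
  \<comment> \<open>This ties the coupling and angle of the DM term to the constant in v.\<close>
  have \<kappa>c: "complex_of_real \<kappa> * Complex (cos \<alpha>) (sin \<alpha>) = 2 * \<i> * c"
    unfolding c_def exp_Euler by (simp add: complex_eq_iff cos_of_real sin_of_real)
  have e1: "rot3 (- \<alpha>) *v axis 1 1 = vector [cos \<alpha>, - sin \<alpha>, 0]"
    by (simp add: rot3_def vec_eq_iff forall_3 matrix_vector_mult_def sum_3 axis_def)
  have e2: "rot3 (- \<alpha>) *v axis 2 1 = vector [sin \<alpha>, cos \<alpha>, 0]"
    by (simp add: rot3_def vec_eq_iff forall_3 matrix_vector_mult_def sum_3 axis_def)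
  have i: "Complex (sin \<alpha>) (- cos \<alpha>) = - \<i> * Complex (cos \<alpha>) (sin \<alpha>)" by (simp add: complex_eq_iff)
  have dmi: "\<kappa> * dmi_density \<alpha> field_N x = - 8 * ((cmod c)\<^sup>2 * (cmod (Q z))^4 + Re (c * W z * (cnj (P z))\<^sup>2)) / (D z)\<^sup>2"
  proof -
    let ?X = "\<lambda>w. cnj w * (Q z)\<^sup>2 + w * (cnj (P z))\<^sup>2"
    let ?w1 = "W z + c * (Q z)\<^sup>2" and ?w2 = "\<i> * (W z - c * (Q z)\<^sup>2)"
    have "\<kappa> * dmi_density \<alpha> field_N x = - 2 * (\<kappa> * (Im (Complex (cos \<alpha>) (sin \<alpha>) * ?X ?w1) + Im (Complex (sin \<alpha>) (- cos \<alpha>) * ?X ?w2))) / (D z)\<^sup>2"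
      unfolding dmi_density_def partial_field_N z_def[symmetric] field_N_eq e1 e2 stereo_cross[OF PQ_nz] D_def minus_minus
      by (simp only: distrib_left add_divide_distrib times_divide_eq_right mult.left_commute)
    also have "\<kappa> * (Im (Complex (cos \<alpha>) (sin \<alpha>) * ?X ?w1) + Im (Complex (sin \<alpha>) (- cos \<alpha>) * ?X ?w2)) =
      Im (of_real \<kappa> * Complex (cos \<alpha>) (sin \<alpha>) * (?X ?w1 - \<i> * ?X ?w2))"
      unfolding i by (simp add: algebra_simps)
    \<comment> \<open>Between the two directions the terms in cnj W * Q^2 and in c * Q^2 * (cnj P)^2
      cancel; the summand multiplied by 0 stands for the latter.\<close>
    also have "\<dots> = 4 * Re (c * (c * (Q z)\<^sup>2 * (cnj (P z))\<^sup>2 * 0 + cnj c * (cnj (Q z))\<^sup>2 * (Q z)\<^sup>2 + W z * (cnj (P z))\<^sup>2))"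
      unfolding \<kappa>c by (simp add: algebra_simps)
    also have "\<dots> = 4 * ((cmod c)\<^sup>2 * (cmod (Q z))^4 + Re (c * W z * (cnj (P z))\<^sup>2))"
    proof -
      have "Re (c * (cnj c * (cnj (Q z))\<^sup>2 * (Q z)\<^sup>2)) = Re (of_real ((cmod c)\<^sup>2 * ((cmod (Q z))\<^sup>2)\<^sup>2))"
        unfolding of_real_mult of_real_power[of "(cmod (Q z))\<^sup>2"] complex_norm_square
        by (rule arg_cong[of _ _ Re]) (simp only: power_mult_distrib ac_simps)
      then show ?thesis by (simp add: distrib_left mult.assoc flip: power_mult)
    qed
    finally show ?thesis by simp
  qed
  have n3: "\<kappa>\<^sup>2 / 2 * (1 - field_N x $ 3)\<^sup>2 = 8 * (cmod c)\<^sup>2 * (cmod (Q z))^4 / (D z)\<^sup>2"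
  proof -
    have "1 - field_N x $ 3 = 2 * (cmod (Q z))\<^sup>2 / D z"
      using D_pos[of z] unfolding field_N_eq z_def[symmetric] stereo_def Let_def D_def[symmetric]
      by (simp add: field_simps) (simp add: D_def)
    then show ?thesis by (simp add: norm_c power_divide power_mult_distrib flip: power_mult)
  qed
  have grad: "(norm (partial 1 field_N x))\<^sup>2 + (norm (partial 2 field_N x))\<^sup>2 = 8 * ((cmod (W z))\<^sup>2 + (cmod c)\<^sup>2 * (cmod (Q z))^4) / (D z)\<^sup>2"
  proof -
    have "(cmod (W z + c * (Q z)\<^sup>2))\<^sup>2 + (cmod (\<i> * (W z - c * (Q z)\<^sup>2)))\<^sup>2 = 2 * ((cmod (W z))\<^sup>2 + (cmod (c * (Q z)\<^sup>2))\<^sup>2)"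
      unfolding norm_mult cmod_power2 power_mult_distrib by (simp add: power2_eq_square algebra_simps)
    then show ?thesis unfolding partial_field_N z_def[symmetric] norm_stereo_tangent[OF PQ_nz] D_def
        add_divide_distrib[symmetric] distrib_left[symmetric]
      by (simp add: norm_mult norm_power power_mult_distrib flip: power_mult)
  qed
  show ?thesis unfolding energy_density_def grad dmi n3 e_dens_def z_def[symmetric]
    by (simp add: add_divide_distrib diff_divide_distrib distrib_left right_diff_distrib)
qed

section \<open>The densities as curls\<close>

text \<open>\<open>H\<close> is the Wirtinger derivative of \<open>D\<close> in \<open>z\<close>, so \<open>H / D\<close> is that of \<open>ln D\<close>; \<open>dP d\<close>, \<open>dS d\<close>, \<open>dH d\<close>
  and \<open>dHD d\<close> are the derivatives of \<open>P\<close>, \<open>S\<close>, \<open>H\<close> and \<open>H / D\<close> in the direction \<open>d\<close>.\<close>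

definition H :: "complex \<Rightarrow> complex" where
  "H z = cnj (P z) * S z + P z * cnj c * cnj (Q z) + cnj (Q z) * Q' z"

definition S2 :: "complex \<Rightarrow> complex" where "S2 z = poly (pderiv (pderiv p)) z + c * cnj z * poly (pderiv (pderiv q)) z"
definition Q2 :: "complex \<Rightarrow> complex" where "Q2 z = poly (pderiv (pderiv q)) z"

definition dP :: "complex \<Rightarrow> complex \<Rightarrow> complex" where "dP d z = d * S z + c * cnj d * Q z"
definition dS :: "complex \<Rightarrow> complex \<Rightarrow> complex" where "dS d z = d * S2 z + c * cnj d * Q' z"
definition dH :: "complex \<Rightarrow> complex \<Rightarrow> complex" where
  "dH d z = cnj (dP d z) * S z + cnj (P z) * dS d z + dP d z * cnj c * cnj (Q z) + P z * cnj c * cnj (d * Q' z)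
     + cnj (d * Q' z) * Q' z + cnj (Q z) * (d * Q2 z)"
definition dHD :: "complex \<Rightarrow> complex \<Rightarrow> complex" where
  "dHD d z = (dH d z * of_real (D z) - H z * of_real (2 * Re (d * H z))) / (of_real (D z))\<^sup>2"

lemma S_deriv: "((\<lambda>s. S (z + of_real s * d)) has_vector_derivative dS d (z + of_real s * d)) (at s)"
  unfolding S_def dS_def S2_def Q'_def
  by (rule has_vector_derivative_eq_rhs, (rule derivative_intros poly_line_deriv)+) (simp add: algebra_simps)

lemma Q'_deriv: "((\<lambda>s. Q' (z + of_real s * d)) has_vector_derivative d * Q2 (z + of_real s * d)) (at s)"
  unfolding Q'_def Q2_def by (rule poly_line_deriv)

lemma P_deriv': "((\<lambda>s. P (z + of_real s * d)) has_vector_derivative dP d (z + of_real s * d)) (at s)"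
  using P_deriv unfolding dP_def .

lemma D_complex: "complex_of_real (D z) = Q z * cnj (Q z) + P z * cnj (P z)"
  unfolding D_def of_real_add complex_norm_square ..

lemma HD_deriv: "((\<lambda>s. H (z + of_real s * d) / of_real (D (z + of_real s * d))) has_vector_derivative dHD d (z + of_real s * d)) (at s)"
proof -
  let ?z = "\<lambda>s. z + of_real s * d"
  have h: "((\<lambda>s. H (?z s)) has_vector_derivative dH d (?z s)) (at s)"
    unfolding H_def dH_def
    by (rule has_vector_derivative_eq_rhs, (rule derivative_intros P_deriv' Q_deriv S_deriv Q'_deriv)+)
      (simp add: algebra_simps)
  have *: "complex_of_real (2 * Re x) = x + cnj x" for x by (simp add: complex_add_cnj)
  have "((\<lambda>s. complex_of_real (D (?z s))) has_vector_derivative of_real (2 * Re (d * H (?z s)))) (at s)"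
    unfolding D_complex *
    by (rule has_vector_derivative_eq_rhs, (rule derivative_intros P_deriv' Q_deriv)+)
      (simp add: H_def dP_def algebra_simps)
  then have "((\<lambda>s. inverse (complex_of_real (D (?z s)))) has_vector_derivative
      of_real (2 * Re (d * H (?z s))) * (- inverse (of_real (D (?z s)) * of_real (D (?z s))))) (at s)"
    by (rule field_vector_diff_chain_at[of _ _ s inverse, unfolded o_def])
      (use D_pos[of "?z s"] in \<open>auto intro!: derivative_eq_intros\<close>)
  note has_vector_derivative_mult[OF h this]
  then show ?thesis unfolding divide_inverse dHD_def
    by (rule has_vector_derivative_eq_rhs) (use D_pos[of "?z s"] in \<open>simp add: field_simps power2_eq_square\<close>)
qed

text \<open>The left side is the Laplacian of ln D, namely the real part of four times the
  zbar-derivative of H / D.\<close>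

lemma e_dens_eq_curl: "2 * Re (dHD 1 z) - 2 * Im (dHD \<i> z) = e_dens z"
proof -
  have 1: "2 * Re (dHD 1 z) - 2 * Im (dHD \<i> z) =
    2 * ((Re (dH 1 z) - Im (dH \<i> z)) * D z - 2 * (cmod (H z))\<^sup>2) / (D z)\<^sup>2"
    unfolding dHD_def cmod_power2 of_real_power[symmetric] Re_divide_of_real Im_divide_of_real
    by (simp add: algebra_simps power2_eq_square diff_divide_distrib add_divide_distrib)
  have 2: "Re (dH 1 z) - Im (dH \<i> z) = 2 * ((cmod (S z))\<^sup>2 + 2 * Re (cnj (P z) * c * Q' z) + (cmod c)\<^sup>2 * (cmod (Q z))\<^sup>2 + (cmod (Q' z))\<^sup>2)"
    unfolding dH_def dP_def dS_def cmod_power2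
    by (simp add: algebra_simps power2_eq_square)
  \<comment> \<open>The bracket is the mixed Wirtinger derivative of D, so the left side is the
    numerator D * D_zzbar - |D_z|^2 in the mixed derivative of ln D.\<close>
  have 3: "((cmod (S z))\<^sup>2 + 2 * Re (cnj (P z) * c * Q' z) + (cmod c)\<^sup>2 * (cmod (Q z))\<^sup>2 + (cmod (Q' z))\<^sup>2) * D z - (cmod (H z))\<^sup>2
     = (cmod (W z))\<^sup>2 + (cmod c)\<^sup>2 * ((cmod (Q z))\<^sup>2)\<^sup>2 - 2 * Re (c * W z * (cnj (P z))\<^sup>2)"
    unfolding D_def H_def W_def cmod_power2
    apply (simp only: power2_eq_square times_complex.sel minus_complex.sel plus_complex.sel cnj.sel)
    by algebra
  have 4: "2 * ((Re (dH 1 z) - Im (dH \<i> z)) * D z - 2 * (cmod (H z))\<^sup>2) =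
    4 * ((cmod (W z))\<^sup>2 + (cmod c)\<^sup>2 * (cmod (Q z))^4 - 2 * Re (c * W z * (cnj (P z))\<^sup>2))"
    unfolding 2 using 3 by (simp add: algebra_simps flip: power_mult)
  show ?thesis unfolding 1 4 e_dens_def ..
qed

lemma continuous_P [continuous_intros]: "continuous_on A P" unfolding P_def by (intro continuous_intros)
lemma continuous_Q [continuous_intros]: "continuous_on A Q" unfolding Q_def by (intro continuous_intros)
lemma continuous_Q' [continuous_intros]: "continuous_on A Q'" unfolding Q'_def by (intro continuous_intros)
lemma continuous_S [continuous_intros]: "continuous_on A S" unfolding S_def by (intro continuous_intros)
lemma continuous_D [continuous_intros]: "continuous_on A D" unfolding D_def by (intro continuous_intros)
lemma continuous_H [continuous_intros]: "continuous_on A H" unfolding H_def by (intro continuous_intros)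
lemma continuous_W [continuous_intros]: "continuous_on A W" unfolding W_def by (intro continuous_intros)

lemma continuous_dHD: "continuous_on A (dHD d)"
  unfolding dHD_def dH_def dP_def dS_def S2_def Q2_def
  by (intro continuous_intros) (use D_pos in \<open>auto simp: less_le\<close>)

lemma continuous_e_dens: "continuous_on A e_dens"
  unfolding e_dens_def by (intro continuous_intros) (use D_pos in \<open>auto simp: less_le\<close>)

lemma continuous_q_dens: "continuous_on A q_dens"
  unfolding q_dens_def by (intro continuous_intros) (use D_pos in \<open>auto simp: less_le\<close>)

text \<open>This is the radial derivative r d/dr of ln D; integrating it over the angle gives the
  flux through the circle.\<close>

definition flux :: "complex \<Rightarrow> real" where "flux z = 2 * Re (z * H z) / D z"

lemma e_dens_disc:
  assumes "R > 0"
  shows "(LINT z:cball 0 R|lborel. e_dens z) = integral {0..2*pi} (\<lambda>t. flux (R * cis t))"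
proof -
  \<comment> \<open>The gradient of ln D is 2 * cnj (H / D) as a complex number. Multiplication by i
    turns it through a right angle, so its divergence becomes a curl.\<close>
  let ?f = "\<lambda>z. 2 * \<i> * cnj (H z / of_real (D z))"
  have d: "((\<lambda>s. ?f (z + of_real s * d)) has_vector_derivative 2 * \<i> * cnj (dHD d (z + of_real s * d))) (at s)" for z d s
    by (intro derivative_intros HD_deriv)
  have "(LINT z:cball 0 R|lborel. Im (2 * \<i> * cnj (dHD 1 z)) - Re (2 * \<i> * cnj (dHD \<i> z))) =
    integral {0..2*pi} (\<lambda>t. Re (?f (R * cis t) * cnj (\<i> * (R * cis t))))"
    by (rule green_disc)
      (use d[of _ 1] d[of _ \<i>] assms D_pos in \<open>auto intro!: continuous_intros continuous_dHD simp: less_le\<close>)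
  moreover have "Im (2 * \<i> * cnj (dHD 1 z)) - Re (2 * \<i> * cnj (dHD \<i> z)) = e_dens z" for z
    unfolding e_dens_eq_curl[symmetric] by simp
  moreover have "Re (?f z * cnj (\<i> * z)) = flux z" for z
  proof -
    have "?f z * cnj (\<i> * z) = 2 * cnj (z * H z) / of_real (D z)"
      by (simp add: algebra_simps)
    then show ?thesis unfolding flux_def by (simp only: Re_divide_of_real) simp
  qed
  ultimately show ?thesis by (simp only:)
qed

text \<open>\<open>Theta\<close> is \<open>Re (K * cnj dz)\<close>, because \<open>2 * \<i> * c = \<kappa> * exp (\<i> * \<alpha>)\<close>.\<close>

definition K :: "complex \<Rightarrow> complex" where
  "K z = 2 * \<i> * c * (2 * cnj (P z) * Q z / of_real (D z))"
definition dK :: "complex \<Rightarrow> complex \<Rightarrow> complex" where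
  "dK d z = (let w = d * W z + cnj d * c * (Q z)\<^sup>2 in
     2 * \<i> * c * (2 * (cnj w * (Q z)\<^sup>2 - (cnj (P z))\<^sup>2 * w) / of_real ((D z)\<^sup>2)))"

lemma K_deriv: "((\<lambda>s. K (z + of_real s * d)) has_vector_derivative dK d (z + of_real s * d)) (at s)"
proof -
  let ?z = "\<lambda>s. z + of_real s * d"
  let ?w = "d * W (?z s) + cnj d * c * (Q (?z s))\<^sup>2"
  have w: "Q (?z s) * (d * S (?z s) + c * cnj d * Q (?z s)) - P (?z s) * (d * Q' (?z s)) = ?w"
    by (simp add: W_def algebra_simps power2_eq_square)
  have st: "((\<lambda>s. stereo (P (?z s)) (Q (?z s))) has_vector_derivative stereo_tangent (P (?z s)) (Q (?z s)) ?w) (at s)"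
    using has_vector_derivative_stereo[OF P_deriv[of z d s] Q_deriv[of z d s] PQ_nz] unfolding w .
  have "((\<lambda>s. stereo (P (?z s)) (Q (?z s)) $ i) has_vector_derivative stereo_tangent (P (?z s)) (Q (?z s)) ?w $ i) (at s)" for i
    by (rule bounded_linear.has_vector_derivative[OF bounded_linear_vec_nth st])
  from this[of 1] this[of 2]
  have "((\<lambda>s. 2 * cnj (P (?z s)) * Q (?z s) / of_real (D (?z s))) has_vector_derivative
    2 * (cnj ?w * (Q (?z s))\<^sup>2 - (cnj (P (?z s)))\<^sup>2 * ?w) / of_real ((D (?z s))\<^sup>2)) (at s)"
    unfolding has_vector_derivative_complex_iff stereo_def stereo_tangent_def Let_def D_def[symmetric] vector_2 vector_3
    by (simp only: has_real_derivative_iff_has_vector_derivative)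
  then show ?thesis unfolding K_def dK_def Let_def by (intro derivative_intros)
qed

lemma curl_K: "Im (dK 1 z) - Re (dK \<i> z) = e_dens z - q_dens z"
proof -
  have "Im (dK 1 z) - Re (dK \<i> z) = 8 * ((cmod c)\<^sup>2 * ((cmod (Q z))\<^sup>2)\<^sup>2 - Re (c * W z * (cnj (P z))\<^sup>2)) / (D z)\<^sup>2"
  proof -
    let ?X = "\<lambda>d. let w = d * W z + cnj d * c * (Q z)\<^sup>2 in 2 * \<i> * c * (2 * (cnj w * (Q z)\<^sup>2 - (cnj (P z))\<^sup>2 * w))"
    have "dK d z = ?X d / of_real ((D z)\<^sup>2)" for d unfolding dK_def Let_def by simp
    then have "Im (dK 1 z) - Re (dK \<i> z) = (Im (?X 1) - Re (?X \<i>)) / (D z)\<^sup>2"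
      by (simp only: Re_divide_of_real Im_divide_of_real diff_divide_distrib)
    also have "Im (?X 1) - Re (?X \<i>) = 8 * ((cmod c)\<^sup>2 * ((cmod (Q z))\<^sup>2)\<^sup>2 - Re (c * W z * (cnj (P z))\<^sup>2))"
      unfolding cmod_power2 Let_def
      apply (simp only: power2_eq_square times_complex.sel minus_complex.sel plus_complex.sel cnj.sel
        complex_Re_numeral complex_Im_numeral one_complex.sel imaginary_unit.sel)
      by algebra
    finally show ?thesis .
  qed
  then show ?thesis unfolding e_dens_def q_dens_def
    by (simp add: diff_divide_distrib add_divide_distrib algebra_simps flip: power_mult)
qed

lemma continuous_dK: "continuous_on A (dK d)"
  unfolding dK_def Let_def by (intro continuous_intros) (use D_pos in \<open>auto simp: less_le\<close>)

lemma Theta_disc: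
  assumes "R > 0"
  shows "circle_integral (Theta \<kappa> \<alpha> field_N) R = (LINT z:cball 0 R|lborel. e_dens z - q_dens z)"
proof -
  have "(LINT z:cball 0 R|lborel. Im (dK 1 z) - Re (dK \<i> z)) =
    integral {0..2*pi} (\<lambda>t. Re (K (R * cis t) * cnj (\<i> * (R * cis t))))"
    by (rule green_disc)
      (use K_deriv[of _ 1] K_deriv[of _ \<i>] assms D_pos in \<open>auto intro!: continuous_intros continuous_dK simp: less_le K_def\<close>)
  moreover have "Theta \<kappa> \<alpha> field_N (circle_curve R t) (vector_derivative (circle_curve R) (at t)) =
    Re (K (R * cis t) * cnj (\<i> * (R * cis t)))" for t
  proof -
    have v: "vector_derivative (circle_curve R) (at t) = vector [- R * sin t, R * cos t]"
    proof (rule vector_derivative_at)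
      have eq: "(vector [a, b] :: real^2) = a *\<^sub>R axis 1 1 + b *\<^sub>R axis 2 1" for a b
        by (simp add: vec_eq_iff forall_2 axis_def)
      show "(circle_curve R has_vector_derivative vector [- R * sin t, R * cos t]) (at t)"
        unfolding circle_curve_def eq
        by (auto intro!: derivative_eq_intros simp: mult.commute simp flip: has_real_derivative_iff_has_vector_derivative)
    qed
    define z where "z = R * cis t"
    have z: "complex_coord (circle_curve R t) = z"
      by (simp add: complex_coord_def circle_curve_def z_def complex_eq_iff)
    define n where "n = 2 * cnj (P z) * Q z / of_real (D z)"
    have n: "field_N (circle_curve R t) $ 1 = Re n" "field_N (circle_curve R t) $ 2 = Im n"
      unfolding field_N_eq z stereo_def Let_def D_def[symmetric] n_def by simp_all
    have \<kappa>c: "2 * \<i> * c = complex_of_real \<kappa> * Complex (cos \<alpha>) (sin \<alpha>)"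
      unfolding c_def exp_Euler by (simp add: complex_eq_iff cos_of_real sin_of_real)
    \<comment> \<open>Rotation about the third axis by \<alpha> acts on n1 + i * n2 as
      multiplication by exp (i * \<alpha>).\<close>
    have K: "K z = complex_of_real \<kappa> * Complex (cos \<alpha>) (sin \<alpha>) * n"
      unfolding K_def n_def \<kappa>c ..
    show ?thesis unfolding Theta_def v z_def[symmetric] K
      by (simp add: matrix_vector_mult_def sum_3 rot3_def n z_def algebra_simps)
  qed
  ultimately show ?thesis unfolding circle_integral_def curl_K by (simp only:)
qed

section \<open>Asymptotics of the skyrmion\<close>

text \<open>Polynomial division gives \<open>p / q = s + rho\<close> with \<open>rho = O(1/\<bar>z\<bar>)\<close>; \<open>v\<close> grows like \<open>\<bar>z\<bar> ^ k\<close> in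
  almost every direction, and \<open>rd\<close> is the derivative of \<open>p / q\<close>.\<close>

definition s :: "complex poly" where "s = p div q"
definition t :: "complex poly" where "t = p mod q"
definition k :: nat where "k = max (degree s) 1"
definition a :: complex where "a = coeff s 1"
definition v :: "complex \<Rightarrow> complex" where "v z = P z / Q z"
definition rd :: "complex \<Rightarrow> complex" where "rd z = W z / (Q z)\<^sup>2"
definition rho :: "complex \<Rightarrow> complex" where "rho z = poly t z / poly q z"
definition rho' :: "complex \<Rightarrow> complex" where
  "rho' z = poly (pderiv t * q - t * pderiv q) z / poly (q * q) z"

lemma p_eq: "p = s * q + t" by (simp add: s_def t_def)

lemma t_degree: "t = 0 \<or> degree t < degree q"
  using degree_mod_less[OF q_nz, of p] by (simp add: t_def)

lemma poly_p: "poly p z = poly s z * poly q z + poly t z"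
  using arg_cong[OF p_eq, of "\<lambda>f. poly f z"] by simp

lemma poly_pderiv_p: "poly (pderiv p) z = poly (pderiv s) z * poly q z + poly s z * poly (pderiv q) z + poly (pderiv t) z"
  using arg_cong[OF p_eq, of "\<lambda>f. poly (pderiv f) z"] by (simp add: pderiv_add pderiv_mult algebra_simps)

text \<open>The bound for s = 0 has to admit p = 0 with q constant, where both degrees are 0; a
  strict inequality with \<open>degree q\<close> would fail there.\<close>

lemma degree_p: "if s = 0 then degree p < degree q + 1 else degree p = degree s + degree q"
proof (cases "s = 0")
  case True
  then have "p = t" using p_eq by simp
  then show ?thesis using t_degree True by auto
next
  case False
  then have d: "degree (s * q) = degree s + degree q" using q_nz by (simp add: degree_mult_eq)
  have "degree (s * q + t) = degree (s * q)"
    using t_degree d by (cases "t = 0") (simp_all, metis d degree_add_eq_left trans_less_add2)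
  then show ?thesis using False d arg_cong[OF p_eq, of degree] by simp
qed

lemma degree_s_eq_1_iff: "degree p = degree q + 1 \<longleftrightarrow> degree s = 1"
  using degree_p by (auto split: if_splits)

text \<open>This identifies the number in the theorem: \<open>degree q\<close> comes from the
  denominator and k from the growth of v.\<close>

lemma degree_max: "max (degree p) (degree q + 1) = degree q + k"
  using degree_p by (auto simp: k_def split: if_splits)

lemma k_ge: "k \<ge> 1" "degree s \<le> k" by (auto simp: k_def)

lemma v_expand: "Q z \<noteq> 0 \<Longrightarrow> v z = c * cnj z + poly s z + rho z"
  unfolding v_def P_def rho_def poly_p by (simp add: Q_def field_simps)

lemma rd_expand: "Q z \<noteq> 0 \<Longrightarrow> rd z = poly (pderiv s) z + rho' z"
proof -
  have W: "W z = Q z * poly (pderiv p) z - poly p z * poly (pderiv q) z"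
    unfolding W_def Q_def S_def P_def Q'_def by (simp add: algebra_simps)
  show "Q z \<noteq> 0 \<Longrightarrow> rd z = poly (pderiv s) z + rho' z"
    unfolding rd_def W rho'_def poly_p poly_pderiv_p
    by (simp add: Q_def field_simps power2_eq_square)
qed

lemma Q_nz: "\<forall>\<^sub>F z in at_infinity. Q z \<noteq> 0"
  unfolding Q_def by (rule eventually_poly_nonzero_at_infinity[OF q_nz])

lemma rho_bound: obtains B where "B > 0" "\<forall>\<^sub>F z in at_infinity. cmod (rho z) \<le> B / cmod z"
proof -
  have "t = 0 \<or> degree t + 1 \<le> degree q" using t_degree by auto
  from poly_ratio_tendsto[OF q_nz this]
  obtain L where "((\<lambda>z. z ^ 1 * rho z) \<longlongrightarrow> L) at_infinity" unfolding rho_def by auto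
  then obtain B where B: "B > 0" "\<forall>\<^sub>F z in at_infinity. cmod (z ^ 1 * rho z) \<le> B"
    by (rule tendsto_imp_eventually_norm_le)
  from B(2) eventually_norm_ge_at_infinity[of 1] have "\<forall>\<^sub>F z in at_infinity. cmod (rho z) \<le> B / cmod z"
  proof eventually_elim
    case (elim z)
    have "cmod z > 0" using elim(2) by linarith
    then show ?case using elim(1) by (simp add: norm_mult field_simps)
  qed
  then show ?thesis using B that by blast
qed

lemma rho'_bound: obtains B where "B > 0" "\<forall>\<^sub>F z in at_infinity. cmod (rho' z) \<le> B / (cmod z)\<^sup>2"
proof -
  have "pderiv t * q - t * pderiv q = 0 \<or> degree (pderiv t * q - t * pderiv q) + 2 \<le> degree (q * q)"
  proof (cases "t = 0")
    case False
    then have n: "degree t < degree q" using t_degree by auto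
    have qq: "degree (q * q) = degree q + degree q" using q_nz by (simp add: degree_mult_eq)
    have "degree (t * pderiv q) \<le> degree q + degree q - 2"
      using degree_mult_le[of t "pderiv q"] n by (simp add: degree_pderiv)
    moreover have "degree (pderiv t * q) \<le> degree q + degree q - 2"
    \<comment> \<open>For constant t the truncated difference \<open>degree t - 1\<close> is still
      0, so the product bound would be too weak when \<open>degree q\<close> is 1; instead the term
      vanishes.\<close>
    proof (cases "degree t = 0")
      case True
      then have "pderiv t = 0" by (simp add: pderiv_eq_0_iff)
      then show ?thesis by simp
    next
      case False
      then show ?thesis using degree_mult_le[of "pderiv t" q] n by (simp add: degree_pderiv)
    qed
    ultimately have "degree (pderiv t * q - t * pderiv q) \<le> degree q + degree q - 2"
      by (rule degree_diff_le[rotated])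
    then show ?thesis unfolding qq using n by linarith
  qed auto
  moreover have "q * q \<noteq> 0" using q_nz by simp
  ultimately obtain L where "((\<lambda>z. z ^ 2 * rho' z) \<longlongrightarrow> L) at_infinity"
    using poly_ratio_tendsto[of "q * q" _ 2] unfolding rho'_def by blast
  then obtain B where B: "B > 0" "\<forall>\<^sub>F z in at_infinity. cmod (z ^ 2 * rho' z) \<le> B"
    by (rule tendsto_imp_eventually_norm_le)
  from B(2) eventually_norm_ge_at_infinity[of 1] have "\<forall>\<^sub>F z in at_infinity. cmod (rho' z) \<le> B / (cmod z)\<^sup>2"
  proof eventually_elim
    case (elim z)
    have "cmod z > 0" using elim(2) by linarith
    then show ?case using elim(1) by (simp add: norm_mult norm_power field_simps)
  qed
  then show ?thesis using B that by blast
qed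

lemma rho_limits: "(rho \<longlongrightarrow> 0) at_infinity" "((\<lambda>z. z * rho' z) \<longlongrightarrow> 0) at_infinity"
proof -
  have lim: "((\<lambda>z. B / cmod z) \<longlongrightarrow> 0) at_infinity" for B
    unfolding divide_inverse norm_inverse[symmetric]
    by (rule tendsto_mult_right_zero) (rule tendsto_norm_zero[OF tendsto_inverse_0])
  obtain B where B: "\<forall>\<^sub>F z in at_infinity. cmod (rho z) \<le> B / cmod z" by (rule rho_bound)
  show "(rho \<longlongrightarrow> 0) at_infinity" by (rule Lim_null_comparison[OF B lim])
  obtain B' where B': "\<forall>\<^sub>F z in at_infinity. cmod (rho' z) \<le> B' / (cmod z)\<^sup>2" by (rule rho'_bound)
  have "\<forall>\<^sub>F z in at_infinity. cmod (z * rho' z) \<le> B' / cmod z"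
    using B' eventually_norm_ge_at_infinity[of 1]
  proof eventually_elim
    case (elim z)
    have "cmod z > 0" using elim(2) by linarith
    then show ?case using elim(1) by (simp add: norm_mult field_simps power2_eq_square)
  qed
  then show "((\<lambda>z. z * rho' z) \<longlongrightarrow> 0) at_infinity" by (rule Lim_null_comparison[OF _ lim])
qed

lemma log_deriv_q: "((\<lambda>z. z * Q' z / Q z) \<longlongrightarrow> of_nat (degree q)) at_infinity"
proof -
  let ?n = "degree q"
  have "((\<lambda>z. (poly (pCons 0 (pderiv q)) z / z ^ ?n) / (poly q z / z ^ ?n)) \<longlongrightarrow> coeff (pCons 0 (pderiv q)) ?n / lead_coeff q) at_infinity"
    by (intro tendsto_divide poly_div_power_tendsto) (use q_nz in \<open>auto simp: degree_pderiv pderiv_eq_0_iff\<close>)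
  moreover have "coeff (pCons 0 (pderiv q)) ?n / lead_coeff q = of_nat ?n"
    using q_nz leading_coeff_0_iff[of q] by (cases ?n) (auto simp: coeff_pderiv coeff_pCons simp del: leading_coeff_0_iff)
  moreover have "\<forall>\<^sub>F z::complex in at_infinity. (poly (pCons 0 (pderiv q)) z / z ^ ?n) / (poly q z / z ^ ?n) = z * Q' z / Q z"
    using eventually_not_equal_at_infinity[of 0] by eventually_elim (simp add: Q_def Q'_def)
  ultimately show ?thesis by (simp add: tendsto_cong)
qed

text \<open>The radial derivative \<open>z * rd z + c * cnj z\<close> of \<open>v\<close> equals \<open>k * v\<close> up to lower order terms.\<close>

definition eps :: "complex \<Rightarrow> complex" where "eps z = z * rd z + c * cnj z - of_nat k * v z"

text \<open>Euler's operator z d/dz multiplies z^k by k, so the top term of s drops out of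
  \<open>g\<close>, and the remainder terms from rho stay bounded.\<close>

lemma eps_bound: obtains B where "B > 0" "\<forall>\<^sub>F z in at_infinity. cmod (eps z) \<le> B * cmod z ^ (k - 1)"
proof -
  define g where "g = pCons 0 (pderiv s) - smult (of_nat k) s"
  have "degree g \<le> k - 1"
  proof (rule degree_le, intro allI impI)
    fix i assume i: "k - 1 < i"
    then obtain j where j: "i = Suc j" by (cases i) auto
    show "coeff g i = 0"
    proof (cases "i = k")
      case True then show ?thesis using j by (simp add: g_def coeff_pCons coeff_pderiv flip: True)
    next
      case False
      then have "i > degree s" using i k_ge by linarith
      then show ?thesis by (simp add: g_def j coeff_pderiv coeff_eq_0)
    qed
  qed
  then have "((\<lambda>z. poly g z / z ^ (k - 1)) \<longlongrightarrow> coeff g (k - 1)) at_infinity" by (rule poly_div_power_tendsto)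
  then obtain B1 where B1: "B1 > 0" "\<forall>\<^sub>F z in at_infinity. cmod (poly g z / z ^ (k - 1)) \<le> B1"
    by (rule tendsto_imp_eventually_norm_le)
  have "((\<lambda>z. z * rho' z - of_nat k * rho z) \<longlongrightarrow> 0 - of_nat k * 0) at_infinity"
    by (intro tendsto_intros rho_limits)
  then obtain B2 where B2: "B2 > 0" "\<forall>\<^sub>F z in at_infinity. cmod (z * rho' z - of_nat k * rho z) \<le> B2"
    by (rule tendsto_imp_eventually_norm_le)
  have "\<forall>\<^sub>F z in at_infinity. cmod (eps z) \<le> (B1 + real (k - 1) * cmod c + B2) * cmod z ^ (k - 1)"
    using B1(2) B2(2) Q_nz eventually_norm_ge_at_infinity[of 1]
  proof eventually_elim
    case (elim z)
    have z0: "cmod z > 0" using elim(4) by linarith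
    have e: "eps z = poly g z - of_nat (k - 1) * c * cnj z + (z * rho' z - of_nat k * rho z)"
      unfolding eps_def v_expand[OF elim(3)] rd_expand[OF elim(3)] g_def
      using k_ge(1) by (simp add: algebra_simps of_nat_diff)
    have 1: "cmod (poly g z) \<le> B1 * cmod z ^ (k - 1)"
      using elim(1) z0 by (simp add: norm_divide norm_power field_simps)
    \<comment> \<open>The conjugate-linear term has radial degree 1 instead of k. Its defect carries
      the factor k - 1, which vanishes for k = 1; for k at least 2 the power |z|^(k - 1) absorbs
      it.\<close>
    have 2: "real (k - 1) * cmod c * cmod z \<le> real (k - 1) * cmod c * cmod z ^ (k - 1)"
    proof (cases "k - 1 = 0")
      case False
      then have "cmod z ^ 1 \<le> cmod z ^ (k - 1)" using elim(4) by (intro power_increasing) auto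
      then show ?thesis by (auto intro!: mult_left_mono)
    qed auto
    have 3: "B2 \<le> B2 * cmod z ^ (k - 1)" using elim(4) B2(1) by (simp add: mult_le_cancel_left1)
    have "cmod (eps z) \<le> cmod (poly g z) + cmod (of_nat (k - 1) * c * cnj z) + cmod (z * rho' z - of_nat k * rho z)"
      unfolding e by (intro norm_triangle_mono norm_triangle_ineq4 order_refl)
    also have "\<dots> \<le> B1 * cmod z ^ (k - 1) + real (k - 1) * cmod c * cmod z ^ (k - 1) + B2 * cmod z ^ (k - 1)"
      using 1 2 3 elim(2) by (intro add_mono) (auto simp: norm_mult)
    finally show ?case by (simp add: distrib_right)
  qed
  moreover have "B1 + real (k - 1) * cmod c + B2 > 0" using B1 B2 by (intro add_pos_nonneg add_pos_pos add_nonneg_pos) auto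
  ultimately show ?thesis using that by blast
qed

text \<open>D = |Q|^2 * (1 + |v|^2), so ln D splits into two terms. The first has radial derivative
  2 * Re (z * Q' / Q); in the second, the radial derivative of v is k * v + eps.\<close>

lemma flux_eq:
  assumes "Q z \<noteq> 0"
  shows "flux z = 2 * (Re (z * Q' z / Q z) + real k - real k / (1 + (cmod (v z))\<^sup>2)
    + Re (cnj (v z) * eps z) / (1 + (cmod (v z))\<^sup>2))"
proof -
  have D: "D z = (cmod (Q z))\<^sup>2 * (1 + (cmod (v z))\<^sup>2)"
    using assms by (simp add: D_def v_def norm_divide power_divide field_simps)
  have pos: "1 + (cmod (v z))\<^sup>2 > 0" by (simp add: add_pos_nonneg)
  have Q2: "(cmod (Q z))\<^sup>2 > 0" using assms by simp
  have P: "P z = Q z * v z" using assms by (simp add: v_def)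
  have W: "Q z * rd z = S z - v z * Q' z" using assms
    by (simp add: rd_def W_def P field_simps power2_eq_square)
  have "Re (z * H z) = (cmod (Q z))\<^sup>2 * (Re (z * Q' z / Q z) * (1 + (cmod (v z))\<^sup>2) + Re (cnj (v z) * (z * rd z + c * cnj z)))"
  proof -
    have S: "S z = Q z * rd z + v z * Q' z" using W by simp
    define y where "y = Q' z / Q z"
    have y: "Q' z = Q z * y" using assms by (simp add: y_def)
    have 1: "z * H z = (Q z * cnj (Q z)) * (cnj (v z) * z * rd z + (v z * cnj (v z) + 1) * (z * y) + cnj (cnj (v z) * c * cnj z))"
      unfolding H_def S P y by (simp add: algebra_simps)
    have zy: "z * Q' z / Q z = z * y" by (simp add: y_def)
    have "Re (z * H z) = (cmod (Q z))\<^sup>2 * (Re (cnj (v z) * z * rd z + (v z * cnj (v z) + 1) * (z * y) + cnj (cnj (v z) * c * cnj z)))"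
      unfolding 1 complex_norm_square[symmetric] by simp
    moreover have "Re ((v z * cnj (v z) + 1) * (z * y)) = (1 + (cmod (v z))\<^sup>2) * Re (z * y)"
    proof -
      have "v z * cnj (v z) + 1 = of_real (1 + (cmod (v z))\<^sup>2)" by (simp only: of_real_add complex_norm_square of_real_1 add.commute)
      then show ?thesis by simp
    qed
    ultimately show ?thesis unfolding zy by (simp only: plus_complex.sel cnj.sel) (simp add: algebra_simps)
  qed
  then have "flux z = 2 * (Re (z * Q' z / Q z) + Re (cnj (v z) * (z * rd z + c * cnj z)) / (1 + (cmod (v z))\<^sup>2))"
  proof -
    have *: "2 * (X * (A * N + B)) / (X * N) = 2 * (A + B / N)" if "X > 0" "N > 0" for X N A B :: real
      using that by (simp add: field_simps)
    assume "Re (z * H z) = (cmod (Q z))\<^sup>2 * (Re (z * Q' z / Q z) * (1 + (cmod (v z))\<^sup>2) + Re (cnj (v z) * (z * rd z + c * cnj z)))"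
    then show ?thesis unfolding flux_def D by (simp only: *[OF Q2 pos])
  qed
  moreover have "Re (cnj (v z) * (z * rd z + c * cnj z)) = real k * (cmod (v z))\<^sup>2 + Re (cnj (v z) * eps z)"
  proof -
    have "cnj (v z) * (z * rd z + c * cnj z) = of_nat k * (v z * cnj (v z)) + cnj (v z) * eps z"
      unfolding eps_def by (simp add: algebra_simps)
    then show ?thesis unfolding complex_norm_square[symmetric] by simp
  qed
  moreover have "(real k * (cmod (v z))\<^sup>2 + Re (cnj (v z) * eps z)) / (1 + (cmod (v z))\<^sup>2) =
    real k - real k / (1 + (cmod (v z))\<^sup>2) + Re (cnj (v z) * eps z) / (1 + (cmod (v z))\<^sup>2)"
  proof -
    have "(r * V + x) / (1 + V) = r - r / (1 + V) + x / (1 + V)" if "1 + V > 0" for r V x :: real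
    proof -
      have "r - r / (1 + V) = r * V / (1 + V)" using that by (simp add: field_simps)
      then show ?thesis by (simp add: add_divide_distrib)
    qed
    then show ?thesis using pos by blast
  qed
  moreover have "x + (r - y + w) = x + r - y + w" for x r y w :: real by simp
  ultimately show ?thesis by (simp only:)
qed

section \<open>The flux of the gradient of ln D\<close>

lemma c_nz: "c \<noteq> 0"
  using norm_c \<kappa>_pos by auto

lemma g_limit: "((\<lambda>z. (poly s z + rho z) / z ^ k) \<longlongrightarrow> coeff s k) at_infinity"
proof -
  have "((\<lambda>z. poly s z / z ^ k + rho z * inverse z ^ k) \<longlongrightarrow> coeff s k + 0 * 0 ^ k) at_infinity"
    by (intro tendsto_intros poly_div_power_tendsto rho_limits tendsto_inverse_0 k_ge)
  then show ?thesis by (simp add: distrib_right divide_inverse power_inverse)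
qed

lemma coeff_s_k:
  assumes "k \<ge> 2"
  shows "coeff s k \<noteq> 0"
proof -
  have "degree s = k" using assms by (auto simp: k_def max_def split: if_splits)
  moreover have "s \<noteq> 0" using assms calculation by auto
  ultimately show ?thesis by (metis leading_coeff_0_iff)
qed

lemma power_ratio_at_infinity: "((\<lambda>z. cmod z / cmod z ^ k) \<longlongrightarrow> (if k = 1 then 1 else 0)) at_infinity"
proof -
  have "((\<lambda>z. cmod (inverse z ^ (k - 1))) \<longlongrightarrow> cmod (0 ^ (k - 1))) at_infinity"
    by (intro tendsto_intros tendsto_inverse_0)
  moreover have "\<forall>\<^sub>F z in at_infinity. cmod (inverse z ^ (k - 1)) = cmod z / cmod z ^ k"
    using eventually_not_equal_at_infinity[of 0]
  proof eventually_elim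
    case (elim z)
    have "cmod z ^ k = cmod z * cmod z ^ (k - 1)" using k_ge(1) by (cases k) auto
    then show ?case using elim by (simp add: norm_power norm_inverse norm_divide field_simps)
  qed
  ultimately have "((\<lambda>z. cmod z / cmod z ^ k) \<longlongrightarrow> cmod (0 ^ (k - 1))) at_infinity" by (rule Lim_transform_eventually)
  moreover have "cmod (0 ^ (k - 1)) = (if k = 1 then 1 else 0)" using k_ge(1) by (auto simp: power_0_left)
  ultimately show ?thesis by simp
qed

text \<open>By the reverse triangle inequality, the two leading terms cannot cancel unless they have
  the same order and equal moduli, which is the excluded case.\<close>

lemma v_lower:
  assumes "k \<ge> 2 \<or> cmod a \<noteq> cmod c"
  obtains b where "b > 0" "\<forall>\<^sub>F z in at_infinity. cmod (v z) \<ge> b * cmod z ^ k"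
proof -
  define L where "L = \<bar>cmod c * (if k = 1 then 1 else 0) - cmod (coeff s k)\<bar>"
  have L: "L > 0"
    using assms coeff_s_k k_ge(1) unfolding L_def a_def by (cases "k = 1") auto
  have "((\<lambda>z. \<bar>cmod c * (cmod z / cmod z ^ k) - cmod ((poly s z + rho z) / z ^ k)\<bar>) \<longlongrightarrow> L) at_infinity"
    unfolding L_def by (intro tendsto_intros power_ratio_at_infinity g_limit)
  then have "\<forall>\<^sub>F z in at_infinity. \<bar>cmod c * (cmod z / cmod z ^ k) - cmod ((poly s z + rho z) / z ^ k)\<bar> > L / 2"
    using L by (intro order_tendstoD) auto
  then have "\<forall>\<^sub>F z in at_infinity. cmod (v z) \<ge> L / 2 * cmod z ^ k"
    using Q_nz eventually_not_equal_at_infinity[of 0]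
  proof eventually_elim
    case (elim z)
    have z: "cmod z ^ k > 0" using elim by simp
    have "\<bar>cmod (c * cnj z) - cmod (- (poly s z + rho z))\<bar> \<le> cmod (v z)"
      using norm_triangle_ineq3[of "c * cnj z" "- (poly s z + rho z)"] by (simp add: v_expand[OF elim(2)] algebra_simps)
    moreover have "\<bar>cmod (c * cnj z) - cmod (- (poly s z + rho z))\<bar> =
        \<bar>cmod c * (cmod z / cmod z ^ k) - cmod ((poly s z + rho z) / z ^ k)\<bar> * cmod z ^ k"
    proof -
      have "\<bar>x\<bar> * cmod z ^ k = \<bar>x * cmod z ^ k\<bar>" for x using z by (simp add: abs_mult)
      then show ?thesis using elim(3) unfolding norm_minus_cancel by (simp add: norm_mult norm_divide norm_power left_diff_distrib)
    qed
    ultimately show ?case using elim(1) z by (smt (verit) mult_right_mono)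
  qed
  then show ?thesis using that[of "L / 2"] L by simp
qed

text \<open>\<open>v (R * cis \<theta>)\<close> is asymptotic to \<open>R ^ k * ray \<theta>\<close>. If \<open>k = 1\<close> and \<open>\<bar>a\<bar> = \<bar>c\<bar>\<close>, there are exceptional
  directions in which \<open>ray\<close> vanishes.\<close>

definition ray :: "real \<Rightarrow> complex" where
  "ray \<theta> = (if k = 1 then c * cis (- \<theta>) else 0) + coeff s k * cis \<theta> ^ k"

lemma ray_filterlim: "filterlim (\<lambda>R. complex_of_real R * cis \<theta>) at_infinity at_top"
  by (rule filterlim_norm_at_top_imp_at_infinity) (simp add: norm_mult filterlim_abs_real)

lemma ray_limit: "((\<lambda>R::real. v (R * cis \<theta>) / of_real R ^ k) \<longlongrightarrow> ray \<theta>) at_top"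
proof -
  have 1: "((\<lambda>R::real. R / R ^ k) \<longlongrightarrow> (if k = 1 then 1 else 0)) at_top"
  proof -
    have "((\<lambda>R. cmod (complex_of_real R * cis \<theta>) / cmod (complex_of_real R * cis \<theta>) ^ k) \<longlongrightarrow> (if k = 1 then 1 else 0)) at_top"
      by (rule filterlim_compose[OF power_ratio_at_infinity ray_filterlim])
    then show ?thesis
      by (rule Lim_transform_eventually) (auto simp: norm_mult intro!: eventually_mono[OF eventually_gt_at_top[of 0]])
  qed
  have "((\<lambda>R. c * cis (- \<theta>) * of_real (R / R ^ k) + (poly s (R * cis \<theta>) + rho (R * cis \<theta>)) / (R * cis \<theta>) ^ k * cis \<theta> ^ k)
    \<longlongrightarrow> c * cis (- \<theta>) * of_real (if k = 1 then 1 else 0) + coeff s k * cis \<theta> ^ k) at_top"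
    by (intro tendsto_intros 1 filterlim_compose[OF g_limit ray_filterlim])
  moreover have "\<forall>\<^sub>F R in at_top. c * cis (- \<theta>) * of_real (R / R ^ k) + (poly s (R * cis \<theta>) + rho (R * cis \<theta>)) / (R * cis \<theta>) ^ k * cis \<theta> ^ k
     = v (R * cis \<theta>) / of_real R ^ k"
    using eventually_compose_filterlim[OF Q_nz ray_filterlim[of \<theta>]] eventually_gt_at_top[of 0]
  proof eventually_elim
    case (elim R)
    have "cis \<theta> ^ k \<noteq> 0" by simp
    then show ?case unfolding v_expand[OF elim(1)] power_mult_distrib using elim(2)
      by (simp add: add_divide_distrib distrib_right cis_cnj)
  qed
  ultimately have "((\<lambda>R::real. v (R * cis \<theta>) / of_real R ^ k) \<longlongrightarrow> c * cis (- \<theta>) * of_real (if k = 1 then 1 else 0) + coeff s k * cis \<theta> ^ k) at_top"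
    by (rule Lim_transform_eventually)
  then show ?thesis unfolding ray_def by (cases "k = 1") simp_all
qed

text \<open>Along such a ray |v| is at least a constant times R^k. In \<open>flux_eq\<close> the
  last term is then at most |eps| / |v| = O(1/R), and k / (1 + |v|^2) tends to 0.\<close>

lemma flux_ray_limit:
  assumes "ray \<theta> \<noteq> 0"
  shows "((\<lambda>R::real. flux (R * cis \<theta>)) \<longlongrightarrow> 2 * (degree q + k)) at_top"
proof -
  define l where "l = cmod (ray \<theta>) / 2"
  have l: "l > 0" using assms by (simp add: l_def)
  have "((\<lambda>R::real. cmod (v (R * cis \<theta>) / of_real R ^ k)) \<longlongrightarrow> cmod (ray \<theta>)) at_top"
    by (intro tendsto_norm ray_limit)
  then have "\<forall>\<^sub>F R::real in at_top. l < cmod (v (R * cis \<theta>) / of_real R ^ k)"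
    using assms by (intro order_tendstoD) (auto simp: l_def)
  then have lower: "\<forall>\<^sub>F R::real in at_top. l * R ^ k \<le> cmod (v (R * cis \<theta>))"
    using eventually_gt_at_top[of 0]
    by eventually_elim (auto simp: norm_divide norm_power field_simps)
  obtain B where B: "B > 0" "\<forall>\<^sub>F z in at_infinity. cmod (eps z) \<le> B * cmod z ^ (k - 1)" by (rule eps_bound)
  have inv: "((\<lambda>R::real. C / R) \<longlongrightarrow> 0) at_top" for C :: real by real_asymp
  have e1: "((\<lambda>R::real. real k / (1 + (cmod (v (R * cis \<theta>)))\<^sup>2)) \<longlongrightarrow> 0) at_top"
  proof (rule Lim_null_comparison[OF _ inv[of "real k / l\<^sup>2"]])
    show "\<forall>\<^sub>F R::real in at_top. norm (real k / (1 + (cmod (v (R * cis \<theta>)))\<^sup>2)) \<le> real k / l\<^sup>2 / R"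
      using lower eventually_ge_at_top[of 1]
    proof eventually_elim
      case (elim R)
      let ?X = "cmod (v (R * cis \<theta>))"
      have "l * R ^ 1 \<le> l * R ^ k" using elim(2) l k_ge(1) by (intro mult_left_mono power_increasing) auto
      then have "l * R \<le> ?X" using elim(1) by simp
      then have "(l * R)\<^sup>2 \<le> ?X\<^sup>2" using l elim(2) by (intro power_mono) auto
      moreover have "l\<^sup>2 * R \<le> (l * R)\<^sup>2" using l elim(2) by (simp add: power_mult_distrib power2_eq_square)
      ultimately have "l\<^sup>2 * R \<le> 1 + ?X\<^sup>2" by linarith
      then have "real k / (1 + ?X\<^sup>2) \<le> real k / (l\<^sup>2 * R)"
        using l elim(2) by (intro divide_left_mono mult_pos_pos) (auto intro: add_pos_nonneg)
      then show ?case by simp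
    qed
  qed
  have e2: "((\<lambda>R::real. Re (cnj (v (R * cis \<theta>)) * eps (R * cis \<theta>)) / (1 + (cmod (v (R * cis \<theta>)))\<^sup>2)) \<longlongrightarrow> 0) at_top"
  proof (rule Lim_null_comparison[OF _ inv[of "B / l"]])
    show "\<forall>\<^sub>F R::real in at_top. norm (Re (cnj (v (R * cis \<theta>)) * eps (R * cis \<theta>)) / (1 + (cmod (v (R * cis \<theta>)))\<^sup>2)) \<le> B / l / R"
      using lower eventually_ge_at_top[of 1] eventually_compose_filterlim[OF B(2) ray_filterlim[of \<theta>]]
    proof eventually_elim
      case (elim R)
      let ?X = "cmod (v (R * cis \<theta>))"
      have Rk: "R ^ k = R * R ^ (k - 1)" using k_ge(1) by (cases k) auto
      have X: "?X > 0" using elim(1,2) l by (smt (verit) mult_pos_pos zero_less_power)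
      have "norm (Re (cnj (v (R * cis \<theta>)) * eps (R * cis \<theta>)) / (1 + ?X\<^sup>2)) \<le> ?X * cmod (eps (R * cis \<theta>)) / (1 + ?X\<^sup>2)"
        using abs_Re_le_cmod[of "cnj (v (R * cis \<theta>)) * eps (R * cis \<theta>)"]
        by (auto simp: norm_mult abs_divide intro!: divide_right_mono)
      also have "\<dots> \<le> ?X * cmod (eps (R * cis \<theta>)) / ?X\<^sup>2"
        using X by (intro divide_left_mono mult_nonneg_nonneg mult_pos_pos) (auto intro: add_pos_nonneg)
      also have "\<dots> = cmod (eps (R * cis \<theta>)) / ?X" using X by (simp add: power2_eq_square)
      also have "\<dots> \<le> (B * R ^ (k - 1)) / (l * R ^ k)"
        using elim l X B(1) by (intro frac_le) (auto simp: norm_mult)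
      also have "\<dots> = B / l / R" unfolding Rk using elim(2) by simp
      finally show ?case .
    qed
  qed
  have e3: "((\<lambda>R::real. Re ((R * cis \<theta>) * Q' (R * cis \<theta>) / Q (R * cis \<theta>))) \<longlongrightarrow> Re (of_nat (degree q))) at_top"
    by (intro tendsto_Re filterlim_compose[OF log_deriv_q ray_filterlim])
  have "((\<lambda>R::real. 2 * (Re ((R * cis \<theta>) * Q' (R * cis \<theta>) / Q (R * cis \<theta>)) + real k - real k / (1 + (cmod (v (R * cis \<theta>)))\<^sup>2)
    + Re (cnj (v (R * cis \<theta>)) * eps (R * cis \<theta>)) / (1 + (cmod (v (R * cis \<theta>)))\<^sup>2))) \<longlongrightarrow> 2 * (Re (of_nat (degree q)) + real k - 0 + 0)) at_top"
    by (intro tendsto_intros e1 e2 e3)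
  moreover have "\<forall>\<^sub>F R::real in at_top. 2 * (Re ((R * cis \<theta>) * Q' (R * cis \<theta>) / Q (R * cis \<theta>)) + real k - real k / (1 + (cmod (v (R * cis \<theta>)))\<^sup>2)
    + Re (cnj (v (R * cis \<theta>)) * eps (R * cis \<theta>)) / (1 + (cmod (v (R * cis \<theta>)))\<^sup>2)) = flux (R * cis \<theta>)"
    using eventually_compose_filterlim[OF Q_nz ray_filterlim[of \<theta>]] by eventually_elim (rule flux_eq[symmetric])
  ultimately have "((\<lambda>R::real. flux (R * cis \<theta>)) \<longlongrightarrow> 2 * (Re (of_nat (degree q)) + real k - 0 + 0)) at_top"
    by (rule Lim_transform_eventually)
  then show ?thesis by simp
qed

text \<open>Two mechanisms are needed. For k = 1 eps is bounded and |v| / (1 + |v|^2) is at most 1,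
  whatever v does; for larger k eps may grow, but then v has a uniform lower bound.\<close>

lemma flux_bound: obtains B where "\<forall>\<^sub>F z in at_infinity. \<bar>flux z\<bar> \<le> B"
proof -
  obtain B where B: "B > 0" "\<forall>\<^sub>F z in at_infinity. cmod (eps z) \<le> B * cmod z ^ (k - 1)" by (rule eps_bound)
  have "\<exists>C. \<forall>\<^sub>F z in at_infinity. cmod (v z) * cmod (eps z) / (1 + (cmod (v z))\<^sup>2) \<le> C"
  proof (cases "k = 1")
    case True
    have "\<forall>\<^sub>F z in at_infinity. cmod (v z) * cmod (eps z) / (1 + (cmod (v z))\<^sup>2) \<le> B" using B(2)
    proof eventually_elim
      case (elim z)
      have "cmod (v z) * cmod (eps z) \<le> cmod (v z) * B" using elim True by (intro mult_left_mono) auto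
      also have "\<dots> \<le> (1 + (cmod (v z))\<^sup>2) * B"
        using B(1) sum_squares_bound[of 1 "cmod (v z)"] by (intro mult_right_mono) (auto intro: order_trans[of _ "2 * cmod (v z)"])
      finally show ?case by (simp add: divide_le_eq add_pos_nonneg mult.commute)
    qed
    then show ?thesis by blast
  next
    case False
    then have k2: "k \<ge> 2" using k_ge(1) by linarith
    then obtain b where b: "b > 0" "\<forall>\<^sub>F z in at_infinity. cmod (v z) \<ge> b * cmod z ^ k" using v_lower by blast
    have "\<forall>\<^sub>F z in at_infinity. cmod (v z) * cmod (eps z) / (1 + (cmod (v z))\<^sup>2) \<le> B / b"
      using B(2) b(2) eventually_norm_ge_at_infinity[of 1]
    proof eventually_elim
      case (elim z)
      have z: "cmod z > 0" using elim(3) by linarith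
      have X: "cmod (v z) > 0" using elim(2) b(1) z by (smt (verit) mult_pos_pos zero_less_power)
      have "cmod (v z) * cmod (eps z) / (1 + (cmod (v z))\<^sup>2) \<le> cmod (v z) * cmod (eps z) / (cmod (v z))\<^sup>2"
        using X by (intro divide_left_mono mult_nonneg_nonneg mult_pos_pos) (auto intro: add_pos_nonneg)
      also have "\<dots> = cmod (eps z) / cmod (v z)" using X by (simp add: power2_eq_square)
      also have "\<dots> \<le> (B * cmod z ^ (k - 1)) / (b * cmod z ^ k)"
        using elim b X B(1) z by (intro frac_le) auto
      also have "\<dots> \<le> (B * cmod z ^ k) / (b * cmod z ^ k)"
        using elim(3) b B(1) z by (intro divide_right_mono mult_left_mono power_increasing) auto
      also have "\<dots> = B / b" using z by simp
      finally show ?case .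
    qed
    then show ?thesis by blast
  qed
  then obtain C where C: "\<forall>\<^sub>F z in at_infinity. cmod (v z) * cmod (eps z) / (1 + (cmod (v z))\<^sup>2) \<le> C" by blast
  obtain E where E: "E > 0" "\<forall>\<^sub>F z in at_infinity. cmod (z * Q' z / Q z) \<le> E"
    by (rule tendsto_imp_eventually_norm_le[OF log_deriv_q])
  have "\<forall>\<^sub>F z in at_infinity. \<bar>flux z\<bar> \<le> 2 * (E + 2 * real k + C)"
    using C E(2) Q_nz
  proof eventually_elim
    case (elim z)
    have "\<bar>Re (cnj (v z) * eps z) / (1 + (cmod (v z))\<^sup>2)\<bar> \<le> cmod (v z) * cmod (eps z) / (1 + (cmod (v z))\<^sup>2)"
      using abs_Re_le_cmod[of "cnj (v z) * eps z"]
      by (auto simp: norm_mult abs_divide intro!: divide_right_mono)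
    moreover have "\<bar>Re (z * Q' z / Q z)\<bar> \<le> E" using abs_Re_le_cmod elim(2) order_trans by blast
    moreover have "0 \<le> real k / (1 + (cmod (v z))\<^sup>2)" by simp
    moreover have "real k / (1 + (cmod (v z))\<^sup>2) \<le> real k / 1"
      by (intro divide_left_mono) (auto intro: add_pos_nonneg)
    moreover have "\<bar>2 * (x + r - y + w)\<bar> \<le> 2 * (e + 2 * r + C)"
      if "\<bar>w\<bar> \<le> u" "\<bar>x\<bar> \<le> e" "0 \<le> y" "y \<le> r / 1" "u \<le> C" for x r y w e u C :: real
      using that unfolding abs_le_iff by (auto simp: algebra_simps)
    ultimately show ?case unfolding flux_eq[OF elim(3)] using elim(1) by blast
  qed
  then show ?thesis by (rule that)
qed

text \<open>For k = 1 a zero satisfies coeff s 1 * exp (2 * i * \<theta>) = -c, which determines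
  \<theta> up to integer multiples of pi.\<close>

lemma ray_AE: "AE \<theta> in lborel. ray \<theta> \<noteq> 0"
proof (cases "k = 1")
  case False
  then have "coeff s k \<noteq> 0" using coeff_s_k k_ge(1) by auto
  then show ?thesis using False by (simp add: ray_def)
next
  case True
  have "countable {\<theta>. ray \<theta> = 0}"
  proof (cases "{\<theta>. ray \<theta> = 0} = {}")
    case False
    then obtain \<theta>0 where \<theta>0: "ray \<theta>0 = 0" by auto
    have *: "coeff s 1 * exp (2 * \<i> * of_real \<theta>) = - c" if "ray \<theta> = 0" for \<theta>
    proof -
      have "c * cis (- \<theta>) + coeff s 1 * cis \<theta> = 0" using that True by (simp add: ray_def)
      then have "(c * cis (- \<theta>) + coeff s 1 * cis \<theta>) * cis \<theta> = 0" by simp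
      then have "c * (cis (- \<theta>) * cis \<theta>) + coeff s 1 * (cis \<theta> * cis \<theta>) = 0" by (simp only: distrib_right mult.assoc)
      moreover have "exp (2 * \<i> * complex_of_real \<theta>) = cis \<theta> * cis \<theta>"
        by (simp add: cis_conv_exp exp_add[symmetric] mult.assoc)
      ultimately show ?thesis by (simp add: cis_mult eq_neg_iff_add_eq_0 add.commute)
    qed
    have "{\<theta>. ray \<theta> = 0} \<subseteq> range (\<lambda>i::int. \<theta>0 + of_int i * pi)"
    proof
      fix \<theta> assume "\<theta> \<in> {\<theta>. ray \<theta> = 0}"
      then have "coeff s 1 * exp (2 * \<i> * of_real \<theta>) = coeff s 1 * exp (2 * \<i> * of_real \<theta>0)" using * \<theta>0 by simp
      moreover have "coeff s 1 \<noteq> 0" using *[OF \<theta>0] c_nz by auto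
      ultimately have "exp (2 * \<i> * complex_of_real \<theta>) = exp (2 * \<i> * complex_of_real \<theta>0)" by simp
      then obtain i :: int where "2 * \<i> * complex_of_real \<theta> = 2 * \<i> * complex_of_real \<theta>0 + (of_int (2 * i) * pi) * \<i>"
        unfolding exp_eq by blast
      then have "Im (2 * \<i> * complex_of_real \<theta>) = Im (2 * \<i> * complex_of_real \<theta>0 + (of_int (2 * i) * pi) * \<i>)" by simp
      then have "\<theta> = \<theta>0 + of_int i * pi" by simp
      then show "\<theta> \<in> range (\<lambda>i::int. \<theta>0 + of_int i * pi)" by blast
    qed
    then show ?thesis by (rule countable_subset) auto
  qed simp
  then have "{\<theta>. ray \<theta> = 0} \<in> null_sets lborel" by (rule countable_imp_null_set_lborel)
  then show ?thesis by (rule AE_I') auto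
qed

text \<open>Dominated convergence is applied to the angular integral, where constants are
  integrable, and not to the area integral. The limit is 2 * pi times 2 * (n + k).\<close>

lemma e_dens_disc_limit: "((\<lambda>R::real. LINT z:cball 0 R|lborel. e_dens z) \<longlongrightarrow> 4 * pi * (degree q + k)) at_top"
proof -
  obtain B where "\<forall>\<^sub>F z in at_infinity. \<bar>flux z\<bar> \<le> B" by (rule flux_bound)
  then obtain b where b: "\<And>z. cmod z \<ge> b \<Longrightarrow> \<bar>flux z\<bar> \<le> B" by (auto simp: eventually_at_infinity)
  have cont: "continuous_on S (\<lambda>t. flux (R * cis t))" for S and R :: real
  proof -
    have "continuous_on UNIV flux" unfolding flux_def
      by (intro continuous_intros) (use D_pos in \<open>auto simp: less_le\<close>)
    then show ?thesis
      by (rule continuous_on_compose2) (auto simp: cis_conv_exp intro!: continuous_intros)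
  qed
  have [measurable]: "(\<lambda>t. flux (R * cis t)) \<in> borel_measurable borel" for R :: real
    using cont by (rule borel_measurable_continuous_onI)
  have "((\<lambda>R::real. LINT t|lborel. indicator {0..2*pi} t * flux (R * cis t)) \<longlongrightarrow> (LINT t|lborel. indicator {0..2*pi} t * real (2 * (degree q + k)))) at_top"
  proof (rule integral_dominated_convergence_at_top[where w = "\<lambda>t. indicator {0..2*pi} t * B"])
    show "AE t in lborel. ((\<lambda>R::real. indicator {0..2*pi} t * flux (R * cis t)) \<longlongrightarrow> indicator {0..2*pi} t * real (2 * (degree q + k))) at_top"
      using ray_AE
    proof eventually_elim
      case (elim t)
      show ?case using flux_ray_limit[OF elim] by (intro tendsto_intros) auto
    qed
    show "\<forall>\<^sub>F R::real in at_top. AE t in lborel. norm (indicator {0..2*pi} t * flux (R * cis t)) \<le> indicator {0..2*pi} t * B"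
      using eventually_ge_at_top[of "max b 0"]
      by eventually_elim (use b in \<open>auto simp: indicator_def norm_mult\<close>)
  qed auto
  moreover have "(LINT t|lborel. indicator {0..2*pi} t * real (2 * (degree q + k))) = 4 * pi * (degree q + k)"
    by simp
  moreover have "\<forall>\<^sub>F R::real in at_top. (LINT t|lborel. indicator {0..2*pi} t * flux (R * cis t)) = (LINT z:cball 0 R|lborel. e_dens z)"
    using eventually_gt_at_top[of 0]
  proof eventually_elim
    case (elim R)
    have "(LINT t|lborel. indicator {0..2*pi} t * flux (R * cis t)) = (LINT t:{0..2*pi}|lborel. flux (R * cis t))"
      by (simp add: set_lebesgue_integral_def)
    also have "\<dots> = integral {0..2*pi} (\<lambda>t. flux (R * cis t))"
      by (intro set_borel_integral_eq_integral borel_integrable_atLeastAtMost' cont)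
    finally show ?case using e_dens_disc[OF elim] by simp
  qed
  ultimately show ?thesis using Lim_transform_eventually by (simp only:)
qed

section \<open>Integrability of the densities\<close>

lemma dens_v:
  assumes "Q z \<noteq> 0"
  shows "e_dens z = 4 * ((cmod (rd z))\<^sup>2 + (cmod c)\<^sup>2 - 2 * Re (c * rd z * (cnj (v z))\<^sup>2)) / (1 + (cmod (v z))\<^sup>2)\<^sup>2"
    and "q_dens z = 4 * ((cmod (rd z))\<^sup>2 - (cmod c)\<^sup>2) / (1 + (cmod (v z))\<^sup>2)\<^sup>2"
proof -
  define X where "X = (cmod (Q z))^4"
  have X: "X > 0" using assms by (simp add: X_def)
  have D: "(D z)\<^sup>2 = X * (1 + (cmod (v z))\<^sup>2)\<^sup>2"
  proof -
    have "D z = (cmod (Q z))\<^sup>2 * (1 + (cmod (v z))\<^sup>2)"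
      using assms by (simp add: D_def v_def norm_divide power_divide field_simps)
    then show ?thesis by (simp add: X_def power_mult_distrib flip: power_mult)
  qed
  have W: "W z = rd z * (Q z)\<^sup>2" using assms by (simp add: rd_def)
  have P: "P z = Q z * v z" using assms by (simp add: v_def)
  have nW: "(cmod (W z))\<^sup>2 = X * (cmod (rd z))\<^sup>2" unfolding W X_def
    by (simp add: norm_mult norm_power power_mult_distrib flip: power_mult)
  have "c * W z * (cnj (P z))\<^sup>2 = (Q z * cnj (Q z))\<^sup>2 * (c * rd z * (cnj (v z))\<^sup>2)"
    unfolding W P by (simp add: power_mult_distrib)
  also have "(Q z * cnj (Q z))\<^sup>2 = of_real X"
    unfolding complex_norm_square[symmetric] of_real_power[symmetric] X_def by (simp flip: power_mult)
  finally have cW: "c * W z * (cnj (P z))\<^sup>2 = of_real X * (c * rd z * (cnj (v z))\<^sup>2)" .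
  have R: "Re (c * W z * (cnj (P z))\<^sup>2) = X * Re (c * rd z * (cnj (v z))\<^sup>2)"
    unfolding cW times_complex.sel(1)[of "of_real X"] by (simp only: Re_complex_of_real Im_complex_of_real mult_zero_left diff_0_right)
  have cancel: "4 * (X * x) / (X * y) = 4 * x / y" for x y :: real using X by simp
  have e: "(cmod (W z))\<^sup>2 + (cmod c)\<^sup>2 * cmod (Q z) ^ 4 - 2 * Re (c * W z * (cnj (P z))\<^sup>2) =
     X * ((cmod (rd z))\<^sup>2 + (cmod c)\<^sup>2 - 2 * Re (c * rd z * (cnj (v z))\<^sup>2))"
    unfolding nW R X_def[symmetric] by (simp add: algebra_simps)
  show "e_dens z = 4 * ((cmod (rd z))\<^sup>2 + (cmod c)\<^sup>2 - 2 * Re (c * rd z * (cnj (v z))\<^sup>2)) / (1 + (cmod (v z))\<^sup>2)\<^sup>2"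
    unfolding e_dens_def e D cancel ..
  have q: "(cmod (W z))\<^sup>2 - (cmod c)\<^sup>2 * cmod (Q z) ^ 4 = X * ((cmod (rd z))\<^sup>2 - (cmod c)\<^sup>2)"
    unfolding nW X_def[symmetric] by (simp add: algebra_simps)
  show "q_dens z = 4 * ((cmod (rd z))\<^sup>2 - (cmod c)\<^sup>2) / (1 + (cmod (v z))\<^sup>2)\<^sup>2"
    unfolding q_dens_def q D cancel ..
qed

text \<open>The claim says that rd / |z|^(2 * k) is O(|z|^(-3)). If s is constant, rd = rho' is
  O(|z|^(-2)) and k = 1; if k is at least 2, rd is O(|z|^(k - 1)) and k + 2 is at most 2 * k. For
  degree 1 it fails, since rd tends to a nonzero constant.\<close>

lemma rd_bound:
  assumes "degree s \<noteq> 1"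
  obtains B where "B > 0" "\<forall>\<^sub>F z in at_infinity. cmod (rd z) * cmod z ^ 3 \<le> B * (cmod z ^ k)\<^sup>2"
proof -
  obtain B where B: "B > 0" "\<forall>\<^sub>F z in at_infinity. cmod (rho' z) \<le> B / (cmod z)\<^sup>2" by (rule rho'_bound)
  have "degree (pderiv s) \<le> k - 1" using k_ge by (auto simp: degree_pderiv)
  from poly_div_power_tendsto[OF this]
  obtain B1 where B1: "B1 > 0" "\<forall>\<^sub>F z in at_infinity. cmod (poly (pderiv s) z / z ^ (k - 1)) \<le> B1"
    by (rule tendsto_imp_eventually_norm_le)
  have "\<forall>\<^sub>F z in at_infinity. cmod (rd z) * cmod z ^ 3 \<le> (B1 + B) * (cmod z ^ k)\<^sup>2"
    using B(2) B1(2) Q_nz eventually_norm_ge_at_infinity[of 1]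
  proof eventually_elim
    case (elim z)
    have z: "cmod z > 0" using elim(4) by linarith
    have 1: "cmod (poly (pderiv s) z) * cmod z ^ 3 \<le> B1 * (cmod z ^ k)\<^sup>2"
    proof (cases "degree s = 0")
      case True
      then have "pderiv s = 0" by (simp add: pderiv_eq_0_iff)
      then show ?thesis using B1(1) by simp
    next
      case False
      then have k2: "k \<ge> 2" using assms by (auto simp: k_def)
      have "cmod (poly (pderiv s) z) \<le> B1 * cmod z ^ (k - 1)"
        using elim(2) z by (simp add: norm_divide norm_power field_simps)
      then have "cmod (poly (pderiv s) z) * cmod z ^ 3 \<le> B1 * cmod z ^ (k - 1) * cmod z ^ 3"
        by (intro mult_right_mono) auto
      also have "\<dots> = B1 * cmod z ^ (k - 1 + 3)" by (simp add: power_add)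
      also have "\<dots> \<le> B1 * cmod z ^ (k * 2)" using k2 elim(4) B1(1) by (intro mult_left_mono power_increasing) auto
      finally show ?thesis by (simp flip: power_mult)
    qed
    have "cmod (rho' z) * cmod z ^ 3 \<le> B / (cmod z)\<^sup>2 * cmod z ^ 3"
      using elim(1) by (intro mult_right_mono) auto
    also have "\<dots> = B * cmod z ^ 1" using z by (simp add: power2_eq_square power3_eq_cube)
    also have "\<dots> \<le> B * cmod z ^ (k * 2)" using elim(4) B(1) k_ge(1) by (intro mult_left_mono power_increasing) auto
    finally have 2: "cmod (rho' z) * cmod z ^ 3 \<le> B * (cmod z ^ k)\<^sup>2" by (simp flip: power_mult)
    have "cmod (rd z) * cmod z ^ 3 \<le> (cmod (poly (pderiv s) z) + cmod (rho' z)) * cmod z ^ 3"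
      unfolding rd_expand[OF elim(3)] by (intro mult_right_mono norm_triangle_ineq) auto
    then show ?case using 1 2 by (simp add: distrib_right)
  qed
  then show ?thesis using that[of "B1 + B"] B(1) B1(1) by simp
qed

lemma integrable_e_dens:
  assumes "degree s \<noteq> 1"
  shows "integrable lborel e_dens"
proof -
  obtain B where B: "B > 0" "\<forall>\<^sub>F z in at_infinity. cmod (rd z) * cmod z ^ 3 \<le> B * (cmod z ^ k)\<^sup>2"
    using rd_bound[OF assms] .
  have "k \<ge> 2 \<or> cmod a \<noteq> cmod c"
  proof (cases "degree s = 0")
    case True
    then have "a = 0" by (simp add: a_def coeff_eq_0)
    then show ?thesis using c_nz by simp
  qed (use assms in \<open>auto simp: k_def\<close>)
  then obtain b where b: "b > 0" "\<forall>\<^sub>F z in at_infinity. cmod (v z) \<ge> b * cmod z ^ k" using v_lower by blast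
  \<comment> \<open>\<open>G\<close> bounds |z|^3 * |rd| / N, with N = 1 + |v|^2. The three summands
    of \<open>M\<close> belong to |rd|^2, |c|^2 and the mixed term; the mixed term is at most |c| *
    |rd| / N after division by N^2, and this is where the full bound by |z|^(-3) is used.\<close>
  define G where "G = B / b\<^sup>2"
  define M where "M = 4 * (G\<^sup>2 + (cmod c)\<^sup>2 / b^4 + 2 * cmod c * G)"
  have G: "G > 0" using B b by (simp add: G_def)
  show ?thesis
  proof (rule integrable_complexI_inverse_cube[OF continuous_e_dens])
    show "\<forall>\<^sub>F z in at_infinity. \<bar>e_dens z\<bar> \<le> M / cmod z ^ 3"
      using B(2) b(2) Q_nz eventually_norm_ge_at_infinity[of 1]
    proof eventually_elim
      case (elim z)
      define r N y where "r = cmod (rd z)" and "N = 1 + (cmod (v z))\<^sup>2" and "y = (cmod z ^ k)\<^sup>2"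
      have z: "cmod z > 0" using elim(4) by linarith
      have y: "y > 0" using z by (simp add: y_def)
      have "b\<^sup>2 * y \<le> (cmod (v z))\<^sup>2"
        using power_mono[OF elim(2), of 2] b(1) by (simp add: y_def power_mult_distrib)
      then have N: "N \<ge> b\<^sup>2 * y" "N \<ge> 1" "(cmod (v z))\<^sup>2 \<le> N" by (auto simp: N_def)
      have b2: "b\<^sup>2 * y > 0" using b y by simp
      have "r \<le> B * y / cmod z ^ 3" using elim(1) z by (simp add: r_def y_def field_simps)
      then have "r / N \<le> (B * y / cmod z ^ 3) / (b\<^sup>2 * y)"
        using N b2 B y z by (intro frac_le) (auto simp: r_def)
      also have "\<dots> = G / cmod z ^ 3" using y by (simp add: G_def)
      finally have A: "r / N \<le> G / cmod z ^ 3" .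
      have z3: "1 \<le> cmod z ^ 3" using elim(4) by (simp add: one_le_power)
      have 1: "r\<^sup>2 / N\<^sup>2 \<le> G\<^sup>2 / cmod z ^ 3"
      proof -
        have "(r / N)\<^sup>2 \<le> (G / cmod z ^ 3)\<^sup>2" using A N by (intro power_mono) (auto simp: r_def)
        also have "\<dots> = G\<^sup>2 / (cmod z ^ 3 * cmod z ^ 3)" by (simp add: power2_eq_square)
        also have "\<dots> \<le> G\<^sup>2 / (1 * cmod z ^ 3)" using z3 z by (intro divide_left_mono mult_right_mono) auto
        finally show ?thesis by (simp add: power_divide)
      qed
      have 2: "(cmod c)\<^sup>2 / N\<^sup>2 \<le> ((cmod c)\<^sup>2 / b^4) / cmod z ^ 3"
      proof -
        have "cmod z ^ 3 \<le> cmod z ^ (k * 2 * 2)" using elim(4) k_ge(1) by (intro power_increasing) auto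
        also have "\<dots> = y\<^sup>2" by (simp add: y_def mult.assoc flip: power_mult)
        finally have "b^4 * cmod z ^ 3 \<le> b^4 * y\<^sup>2" by (intro mult_left_mono) auto
        also have "\<dots> = (b\<^sup>2 * y)\<^sup>2" by (simp add: power_mult_distrib flip: power_mult)
        also have "\<dots> \<le> N\<^sup>2" using N b2 by (intro power_mono) auto
        finally have "(cmod c)\<^sup>2 / N\<^sup>2 \<le> (cmod c)\<^sup>2 / (b^4 * cmod z ^ 3)"
          using b z N by (intro divide_left_mono) auto
        then show ?thesis by simp
      qed
      have 3: "cmod c * r * (cmod (v z))\<^sup>2 / N\<^sup>2 \<le> cmod c * G / cmod z ^ 3"
      proof -
        have "cmod c * r * (cmod (v z))\<^sup>2 / N\<^sup>2 \<le> cmod c * r * N / N\<^sup>2"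
          using N by (intro divide_right_mono mult_left_mono) (auto simp: r_def)
        also have "\<dots> = cmod c * (r / N)" using N by (simp add: power2_eq_square)
        also have "\<dots> \<le> cmod c * (G / cmod z ^ 3)" using A by (intro mult_left_mono) auto
        finally show ?thesis by simp
      qed
      have "\<bar>Re (c * rd z * (cnj (v z))\<^sup>2)\<bar> \<le> cmod c * r * (cmod (v z))\<^sup>2"
        using abs_Re_le_cmod[of "c * rd z * (cnj (v z))\<^sup>2"] by (simp add: norm_mult norm_power r_def)
      moreover have "\<bar>4 * (x + y - 2 * w)\<bar> \<le> 4 * (x + y + 2 * u)"
        if "\<bar>w\<bar> \<le> u" "0 \<le> x" "0 \<le> y" for w u x y :: real
        by (rule abs_leI) (use that abs_le_D1[OF that(1)] abs_le_D2[OF that(1)] in argo)+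
      ultimately have "\<bar>4 * (r\<^sup>2 + (cmod c)\<^sup>2 - 2 * Re (c * rd z * (cnj (v z))\<^sup>2))\<bar> \<le> 4 * (r\<^sup>2 + (cmod c)\<^sup>2 + 2 * (cmod c * r * (cmod (v z))\<^sup>2))"
        by (meson zero_le_power2)
      then have "\<bar>e_dens z\<bar> \<le> 4 * (r\<^sup>2 + (cmod c)\<^sup>2 + 2 * (cmod c * r * (cmod (v z))\<^sup>2)) / N\<^sup>2"
        unfolding dens_v[OF elim(3)] abs_divide r_def[symmetric] N_def[symmetric] abs_power2
        by (rule divide_right_mono) simp
      also have "\<dots> = 4 * (r\<^sup>2 / N\<^sup>2 + (cmod c)\<^sup>2 / N\<^sup>2 + 2 * (cmod c * r * (cmod (v z))\<^sup>2 / N\<^sup>2))"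
        by (simp add: add_divide_distrib)
      also have "\<dots> \<le> 4 * (G\<^sup>2 / cmod z ^ 3 + ((cmod c)\<^sup>2 / b^4) / cmod z ^ 3 + 2 * (cmod c * G / cmod z ^ 3))"
        by (intro mult_left_mono add_mono 1 2 3) auto
      also have "\<dots> = M / cmod z ^ 3" by (simp add: M_def add_divide_distrib)
      finally show ?case .
    qed
    show "M \<ge> 0" using G by (simp add: M_def)
  qed
qed

section \<open>Linear growth of p / q\<close>

lemma linear_case:
  assumes "degree s = 1"
  shows "k = 1" "a \<noteq> 0" "poly s z = coeff s 0 + a * z" "poly (pderiv s) z = a"
proof -
  show "k = 1" using assms by (simp add: k_def)
  show "a \<noteq> 0" using assms leading_coeff_0_iff[of s] by (auto simp: a_def)
  obtain b0 b1 where "s = [:b0, b1:]" by (rule degree1_coeffs[OF assms])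
  then show "poly s z = coeff s 0 + a * z" "poly (pderiv s) z = a" by (simp_all add: a_def pderiv_pCons)
qed

text \<open>The degree density has no mixed term with (cnj v)^2. Its numerator is bounded and |v| is
  at least b * |z|, so it is even O(|z|^(-4)).\<close>

lemma integrable_q_dens_nondegenerate:
  assumes s: "degree s = 1" and ac: "cmod a \<noteq> cmod c"
  shows "integrable lborel q_dens"
proof -
  obtain b where b: "b > 0" "\<forall>\<^sub>F z in at_infinity. cmod (v z) \<ge> b * cmod z ^ k" using v_lower ac by blast
  obtain B where B: "B > 0" "\<forall>\<^sub>F z in at_infinity. cmod (rho' z) \<le> B / (cmod z)\<^sup>2" by (rule rho'_bound)
  define M where "M = 4 * ((cmod a + B)\<^sup>2 + (cmod c)\<^sup>2) / b^4"
  show ?thesis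
  proof (rule integrable_complexI_inverse_cube[OF continuous_q_dens])
    show "\<forall>\<^sub>F z in at_infinity. \<bar>q_dens z\<bar> \<le> M / cmod z ^ 3"
      using B(2) b(2) Q_nz eventually_norm_ge_at_infinity[of 1]
    proof eventually_elim
      case (elim z)
      have z: "cmod z > 0" using elim(4) by linarith
      have "B / (cmod z)\<^sup>2 \<le> B / 1" using B(1) elim(4) z by (intro divide_left_mono) (auto simp: one_le_power)
      then have r: "cmod (rd z) \<le> cmod a + B"
        unfolding rd_expand[OF elim(3)] linear_case[OF s] using elim(1) norm_triangle_ineq[of a "rho' z"] by linarith
      then have r2: "(cmod (rd z))\<^sup>2 \<le> (cmod a + B)\<^sup>2" by (intro power_mono) auto
      have "b * cmod z \<le> cmod (v z)" using elim(2) linear_case(1)[OF s] by simp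
      then have "(b * cmod z)\<^sup>2 \<le> (cmod (v z))\<^sup>2" using b z by (intro power_mono) auto
      then have "(b * cmod z)\<^sup>2 \<le> 1 + (cmod (v z))\<^sup>2" by simp
      then have "((b * cmod z)\<^sup>2)\<^sup>2 \<le> (1 + (cmod (v z))\<^sup>2)\<^sup>2" by (rule power_mono) auto
      then have v: "b^4 * cmod z ^ 4 \<le> (1 + (cmod (v z))\<^sup>2)\<^sup>2" by (simp add: power_mult_distrib flip: power_mult)
      have "cmod z ^ 3 \<le> cmod z ^ 4" using elim(4) by (intro power_increasing) auto
      then have v: "b^4 * cmod z ^ 3 \<le> (1 + (cmod (v z))\<^sup>2)\<^sup>2"
        by (intro order_trans[OF mult_left_mono v]) auto
      have "\<bar>4 * ((cmod (rd z))\<^sup>2 - (cmod c)\<^sup>2)\<bar> \<le> 4 * ((cmod a + B)\<^sup>2 + (cmod c)\<^sup>2)"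
        using r2 zero_le_power2[of "cmod (rd z)"] zero_le_power2[of "cmod c"] zero_le_power2[of "cmod a + B"]
        by (simp add: abs_le_iff, linarith)
      then have "\<bar>q_dens z\<bar> \<le> 4 * ((cmod a + B)\<^sup>2 + (cmod c)\<^sup>2) / (b^4 * cmod z ^ 3)"
        unfolding dens_v[OF elim(3)] abs_divide using v b z by (intro frac_le) auto
      then show ?case by (simp add: M_def)
    qed
    show "M \<ge> 0" by (simp add: M_def)
  qed
qed

text \<open>When \<open>\<bar>a\<bar> = \<bar>c\<bar>\<close> the leading part \<open>c * cnj z + a * z\<close> of \<open>v\<close> is \<open>2 * c * \<sigma> * Re (\<sigma> * z)\<close> with
  \<open>\<sigma>\<^sup>2 = a / c\<close>, so \<open>v\<close> stays bounded along a strip around a line; there integrability comes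
  from \<open>\<bar>rd\<bar>\<^sup>2 - \<bar>c\<bar>\<^sup>2\<close>, which is \<open>O(1/\<bar>z\<bar>\<^sup>2)\<close>.\<close>

lemma integrable_q_dens_degenerate:
  assumes s: "degree s = 1" and ac: "cmod a = cmod c"
  shows "integrable lborel q_dens"
proof -
  obtain B where B: "B > 0" "\<forall>\<^sub>F z in at_infinity. cmod (rho' z) \<le> B / (cmod z)\<^sup>2" by (rule rho'_bound)
  obtain B0 where B0: "B0 > 0" "\<forall>\<^sub>F z in at_infinity. cmod (coeff s 0 + rho z) \<le> B0"
    by (rule tendsto_imp_eventually_norm_le[OF tendsto_add[OF tendsto_const rho_limits(1)]])
  define \<sigma> where "\<sigma> = csqrt (a / c)"
  have \<sigma>2: "\<sigma>\<^sup>2 = a / c" by (simp add: \<sigma>_def)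
  have "(cmod \<sigma>)\<^sup>2 = 1" unfolding norm_power[symmetric] \<sigma>2 using ac c_nz by (simp add: norm_divide)
  then have \<sigma>1: "cmod \<sigma> = 1" by (simp add: power2_eq_1_iff) (smt (verit) norm_ge_zero)
  have lin: "c * cnj z + a * z = c * \<sigma> * (2 * of_real (Re (\<sigma> * z)))" for z
  proof -
    have "a = c * \<sigma>\<^sup>2" using c_nz by (simp add: \<sigma>2)
    moreover have "\<sigma> * cnj \<sigma> = 1" using \<sigma>1 by (simp add: complex_norm_square[symmetric])
    moreover have "2 * of_real (Re (\<sigma> * z)) = \<sigma> * z + cnj \<sigma> * cnj z" using complex_add_cnj[of "\<sigma> * z"] by simp
    ultimately show ?thesis by (simp only:) algebra
  qed
  \<comment> \<open>\<open>C1\<close> comes from factoring |rd|^2 - |a|^2 with rd = a + rho';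
    \<open>C2\<close> is chosen so that 1 + X^2 is at most C2 * (1 + |v|^2), where X = Re (\<sigma>
    * z).\<close>
  define C1 where "C1 = 4 * (2 * cmod a * B + B\<^sup>2)"
  define C2 where "C2 = 1 + (1 + B0\<^sup>2) / (2 * (cmod c)\<^sup>2)"
  have C1: "C1 \<ge> 0" using B by (simp add: C1_def)
  have C2: "C2 > 0" by (simp add: C2_def add_pos_nonneg)
  have bound: "\<forall>\<^sub>F z in at_infinity. \<bar>q_dens z\<bar> \<le> C1 * C2 * (1 / (cmod z)\<^sup>2) * (1 / (1 + (Re (\<sigma> * z))\<^sup>2))"
    using B(2) B0(2) Q_nz eventually_norm_ge_at_infinity[of 1]
  proof eventually_elim
    case (elim z)
    have z: "cmod z > 0" using elim(4) by linarith
    define X where "X = Re (\<sigma> * z)"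
    define V where "V = (cmod (v z))\<^sup>2"
    have v: "v z = c * \<sigma> * (2 * of_real X) + (coeff s 0 + rho z)"
      unfolding v_expand[OF elim(3)] linear_case(3)[OF s] X_def lin[symmetric] by simp
    have "2 * cmod c * \<bar>X\<bar> \<le> cmod (v z) + B0"
    proof -
      have "2 * cmod c * \<bar>X\<bar> = cmod (c * \<sigma> * (2 * of_real X))" using \<sigma>1 by (simp add: norm_mult)
      also have "\<dots> = cmod (v z - (coeff s 0 + rho z))" unfolding v by simp
      also have "\<dots> \<le> cmod (v z) + B0" using norm_triangle_ineq4[of "v z" "coeff s 0 + rho z"] elim(2) by linarith
      finally show ?thesis .
    qed
    then have "(2 * cmod c * \<bar>X\<bar>)\<^sup>2 \<le> (cmod (v z) + B0)\<^sup>2" by (intro power_mono) auto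
    also have "\<dots> \<le> 2 * V + 2 * B0\<^sup>2" using sum_squares_bound[of "cmod (v z)" B0] by (simp add: power2_sum V_def)
    finally have "X\<^sup>2 \<le> (V + B0\<^sup>2) / (2 * (cmod c)\<^sup>2)" using c_nz by (simp add: power_mult_distrib field_simps)
    also have "\<dots> \<le> (1 + B0\<^sup>2) * (1 + V) / (2 * (cmod c)\<^sup>2)"
      by (intro divide_right_mono) (auto simp: V_def algebra_simps)
    finally have "X\<^sup>2 \<le> (1 + B0\<^sup>2) * (1 + V) / (2 * (cmod c)\<^sup>2)" .
    moreover have "V \<ge> 0" by (simp add: V_def)
    moreover have "C2 * (1 + V) = 1 + V + (1 + B0\<^sup>2) * (1 + V) / (2 * (cmod c)\<^sup>2)"
      by (simp only: C2_def distrib_right[of 1 "_ / _"] mult_1_left times_divide_eq_left)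
    ultimately have X: "1 + X\<^sup>2 \<le> C2 * (1 + V)" by argo
    have r: "\<bar>4 * ((cmod (rd z))\<^sup>2 - (cmod c)\<^sup>2)\<bar> \<le> C1 / (cmod z)\<^sup>2"
    proof -
      have rd: "rd z = a + rho' z" unfolding rd_expand[OF elim(3)] linear_case(4)[OF s] ..
      have "\<bar>(cmod (rd z))\<^sup>2 - (cmod c)\<^sup>2\<bar> = \<bar>cmod (rd z) - cmod a\<bar> * (cmod (rd z) + cmod a)"
        unfolding ac[symmetric] power2_eq_square square_diff_square_factored abs_mult by (simp add: mult.commute)
      also have "\<dots> \<le> cmod (rho' z) * (2 * cmod a + cmod (rho' z))"
        unfolding rd using norm_triangle_ineq3[of "a + rho' z" a] norm_triangle_ineq[of a "rho' z"]
        by (intro mult_mono) auto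
      also have "\<dots> \<le> B / (cmod z)\<^sup>2 * (2 * cmod a + B)"
      proof (intro mult_mono add_mono)
        have "B / (cmod z)\<^sup>2 \<le> B / 1" using B(1) elim(4) z by (intro divide_left_mono) (auto simp: one_le_power)
        then show "cmod (rho' z) \<le> B" using elim(1) by linarith
      qed (use elim B in auto)
      also have "\<dots> = (C1 / 4) / (cmod z)\<^sup>2" by (simp add: C1_def algebra_simps power2_eq_square add_divide_distrib)
      finally show ?thesis by (simp add: abs_mult)
    qed
    have "1 + X\<^sup>2 \<le> C2 * (1 + V)\<^sup>2"
    proof -
      have "C2 * (1 + V) * 1 \<le> C2 * (1 + V) * (1 + V)" using C2 by (intro mult_left_mono) (auto simp: V_def)
      then show ?thesis using X by (simp add: power2_eq_square mult.assoc)
    qed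
    then have "(1 + X\<^sup>2) / C2 \<le> (1 + V)\<^sup>2" using C2 by (simp add: field_simps)
    then have "\<bar>q_dens z\<bar> \<le> (C1 / (cmod z)\<^sup>2) / ((1 + X\<^sup>2) / C2)"
      unfolding dens_v[OF elim(3)] abs_divide V_def[symmetric] using r C2
      by (intro frac_le) (auto intro!: divide_pos_pos add_pos_nonneg divide_nonneg_nonneg C1)
    then show ?case by (simp add: X_def mult_ac)
  qed
  \<comment> \<open>The radial factor is spent on decay along one chosen coordinate; decay in Re
    (\<sigma> * z) is already available from the other factor.\<close>
  have half: "1 / (cmod z)\<^sup>2 \<le> 4 * decay x" if z: "cmod z \<ge> 1" and x: "\<bar>x\<bar> \<le> cmod z" for z x
  proof -
    have "x\<^sup>2 \<le> (cmod z)\<^sup>2" using x by (metis abs_le_square_iff abs_norm_cancel)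
    moreover have "1 \<le> (cmod z)\<^sup>2" using z by (simp add: one_le_power)
    ultimately have "1 / (cmod z)\<^sup>2 \<le> 1 / ((1 + x\<^sup>2) / 2)"
      by (intro divide_left_mono mult_pos_pos) (auto intro!: add_pos_nonneg)
    also have "\<dots> = 2 * (1 / (1 + x\<^sup>2))" by simp
    also have "\<dots> \<le> 2 * (2 * decay x)" by (intro mult_left_mono inverse_square_le_decay) auto
    finally show ?thesis by simp
  qed
  have final: "\<bar>q_dens z\<bar> \<le> 8 * C1 * C2 * (decay x * decay X)"
    if "cmod z \<ge> 1" "\<bar>x\<bar> \<le> cmod z" "\<bar>X\<bar> = \<bar>Re (\<sigma> * z)\<bar>"
      "\<bar>q_dens z\<bar> \<le> C1 * C2 * (1 / (cmod z)\<^sup>2) * (1 / (1 + (Re (\<sigma> * z))\<^sup>2))" for z x X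
  proof -
    have "(Re (\<sigma> * z))\<^sup>2 = X\<^sup>2" using that(3) by (metis power2_abs)
    then have "\<bar>q_dens z\<bar> \<le> C1 * C2 * (1 / (cmod z)\<^sup>2) * (1 / (1 + X\<^sup>2))" using that(4) by simp
    also have "\<dots> \<le> C1 * C2 * (4 * decay x) * (2 * decay X)"
      using C1 C2 by (intro mult_mono mult_left_mono half that inverse_square_le_decay) (auto intro!: mult_nonneg_nonneg)
    finally show ?thesis by (simp add: mult_ac)
  qed
  show ?thesis
  \<comment> \<open>The second coordinate must be independent of Re (\<sigma> * z): Re z serves
    unless \<sigma> is real, in which case \<sigma> is 1 or -1 and Im z serves.\<close>
  proof (cases "Im \<sigma> = 0")
    case False
    show ?thesis
    proof (rule integrable_complexI_bound_outside[OF continuous_q_dens])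
      show "integrable lborel (\<lambda>z. 8 * C1 * C2 * (decay (Re z) * decay (Re \<sigma> * Re z + (- Im \<sigma>) * Im z)))"
        by (intro integrable_mult_right integrable_decay_shear) (use False in simp)
      show "\<forall>\<^sub>F z in at_infinity. \<bar>q_dens z\<bar> \<le> 8 * C1 * C2 * (decay (Re z) * decay (Re \<sigma> * Re z + (- Im \<sigma>) * Im z))"
        using bound eventually_norm_ge_at_infinity[of 1]
        by eventually_elim (intro final abs_Re_le_cmod, auto)
    qed
  next
    case True
    then have "\<bar>Re \<sigma>\<bar> = 1" using \<sigma>1 by (simp add: cmod_def)
    then have "\<bar>Re z\<bar> = \<bar>Re (\<sigma> * z)\<bar>" for z using True by (simp add: abs_mult)
    note * = this
    show ?thesis
    proof (rule integrable_complexI_bound_outside[OF continuous_q_dens])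
      show "integrable lborel (\<lambda>z. 8 * C1 * C2 * (decay (Re z) * decay (0 * Re z + 1 * Im z)))"
        by (intro integrable_mult_right integrable_decay_shear) simp
      show "\<forall>\<^sub>F z in at_infinity. \<bar>q_dens z\<bar> \<le> 8 * C1 * C2 * (decay (Re z) * decay (0 * Re z + 1 * Im z))"
        using bound eventually_norm_ge_at_infinity[of 1]
      proof eventually_elim
        case (elim z)
        from final[OF elim(2) abs_Im_le_cmod * elim(1)] show ?case by (simp add: mult.commute)
      qed
    qed
  qed
qed

lemma not_integrable_e_dens:
  assumes s: "degree s = 1"
  shows "\<not> integrable lborel e_dens"
proof -
  define L where "L z = c * cnj z + a * z" for z
  define f where "f z = Re (c * a * (cnj (L z))\<^sup>2)" for z
  have L: "continuous_on A L" for A unfolding L_def by (intro continuous_intros)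
  have f: "continuous_on A f" for A unfolding f_def by (intro continuous_intros L)
  \<comment> \<open>The squares of cnj (L 1) and cnj (L i) add up to 4 * cnj (c * a). The sum is
    therefore positive, and f is nonzero at 1 or at i.\<close>
  have "f 1 + f \<i> = 4 * (cmod (c * a))\<^sup>2"
  proof -
    have "c * a * (cnj (L 1))\<^sup>2 + c * a * (cnj (L \<i>))\<^sup>2 = 4 * ((c * a) * cnj (c * a))"
      unfolding L_def by (simp add: power2_eq_square algebra_simps)
    then have "Re (c * a * (cnj (L 1))\<^sup>2 + c * a * (cnj (L \<i>))\<^sup>2) = Re (4 * ((c * a) * cnj (c * a)))" by (rule arg_cong)
    then show ?thesis unfolding f_def plus_complex.sel complex_norm_square[symmetric] by simp
  qed
  moreover have "4 * (cmod (c * a))\<^sup>2 > 0" using c_nz linear_case(2)[OF s] by simp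
  ultimately obtain z0 where z0: "f z0 \<noteq> 0" "cmod z0 = 1"
    by (metis add_0 less_irrefl norm_ii norm_one)
  \<comment> \<open>The radius 1/2 keeps the set away from the origin, and f z nonzero forces L z
    nonzero, so that the limit below is finite.\<close>
  define S' where "S' = {z \<in> ball z0 (1/2). f z \<noteq> 0}"
  have "open S'"
  proof -
    have "open (ball z0 (1/2) \<inter> f -` (- {0}))"
      by (rule continuous_open_preimage[OF f]) auto
    then show ?thesis by (simp add: S'_def Int_def vimage_def)
  qed
  moreover have "S' \<noteq> {}" using z0 by (auto simp: S'_def intro!: exI[of _ z0])
  moreover have "cmod z \<ge> 1/2" if "z \<in> S'" for z
    using that z0 norm_triangle_ineq2[of z0 "z0 - z"] by (auto simp: S'_def dist_norm)
  \<comment> \<open>Under scaling v behaves like r * L z and rd tends to a, so only the mixed term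
    survives in the numerator.\<close>
  moreover have "((\<lambda>r. r\<^sup>2 * e_dens (of_real r * z)) \<longlongrightarrow> - 8 * f z / (cmod (L z))^4) at_top" if z: "z \<noteq> 0" and Lz: "L z \<noteq> 0" for z
  proof -
    have inf: "filterlim (\<lambda>r. complex_of_real r * z) at_infinity at_top"
      by (rule filterlim_norm_at_top_imp_at_infinity)
        (use z in \<open>auto simp: norm_mult intro!: filterlim_at_top_mult_tendsto_pos filterlim_abs_real\<close>)
    let ?z = "\<lambda>r. complex_of_real r * z"
    have k1: "k = 1" by (rule linear_case(1)[OF s])
    have rd: "((\<lambda>r. rd (?z r)) \<longlongrightarrow> a) at_top"
    proof -
      have "(rho' \<longlongrightarrow> 0) at_infinity"
      proof -
        have "((\<lambda>z. inverse z * (z * rho' z)) \<longlongrightarrow> 0 * 0) at_infinity"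
          by (intro tendsto_intros rho_limits tendsto_inverse_0)
        moreover have "\<forall>\<^sub>F z in at_infinity. inverse z * (z * rho' z) = rho' z"
          using eventually_not_equal_at_infinity[of 0] by eventually_elim simp
        ultimately show ?thesis by (simp add: tendsto_cong)
      qed
      then have "((\<lambda>r. a + rho' (?z r)) \<longlongrightarrow> a + 0) at_top"
        by (intro tendsto_intros filterlim_compose[OF _ inf])
      moreover have "\<forall>\<^sub>F r in at_top. a + rho' (?z r) = rd (?z r)"
        using eventually_compose_filterlim[OF Q_nz inf] by eventually_elim (simp add: rd_expand linear_case[OF s])
      ultimately have "((\<lambda>r. rd (?z r)) \<longlongrightarrow> a + 0) at_top" by (rule Lim_transform_eventually)
      then show ?thesis by simp
    qed
    have vr: "((\<lambda>r. v (?z r) / of_real r) \<longlongrightarrow> L z) at_top"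
    proof -
      have "((\<lambda>r. c * cnj z + (poly s (?z r) + rho (?z r)) / (?z r) ^ k * z) \<longlongrightarrow> c * cnj z + coeff s k * z) at_top"
        by (intro tendsto_intros filterlim_compose[OF g_limit inf])
      moreover have "\<forall>\<^sub>F r in at_top. c * cnj z + (poly s (?z r) + rho (?z r)) / (?z r) ^ k * z = v (?z r) / of_real r"
        using eventually_compose_filterlim[OF Q_nz inf] eventually_gt_at_top[of 0]
        by eventually_elim (use z in \<open>simp add: v_expand k1 field_simps\<close>)
      ultimately have "((\<lambda>r. v (?z r) / of_real r) \<longlongrightarrow> c * cnj z + coeff s k * z) at_top" by (rule Lim_transform_eventually)
      then show ?thesis by (simp add: L_def a_def k1)
    qed
    have i: "((\<lambda>r::real. 1 / r\<^sup>2) \<longlongrightarrow> 0) at_top" by real_asymp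
    have "((\<lambda>r. 4 * (((cmod (rd (?z r)))\<^sup>2 + (cmod c)\<^sup>2) * (1 / r\<^sup>2) - 2 * Re (c * rd (?z r) * (cnj (v (?z r) / of_real r))\<^sup>2))
        / (1 / r\<^sup>2 + (cmod (v (?z r) / of_real r))\<^sup>2)\<^sup>2) \<longlongrightarrow>
      4 * (((cmod a)\<^sup>2 + (cmod c)\<^sup>2) * 0 - 2 * Re (c * a * (cnj (L z))\<^sup>2)) / (0 + (cmod (L z))\<^sup>2)\<^sup>2) at_top"
      by (intro tendsto_intros rd vr i) (use Lz in auto)
    moreover have "\<forall>\<^sub>F r in at_top. 4 * (((cmod (rd (?z r)))\<^sup>2 + (cmod c)\<^sup>2) * (1 / r\<^sup>2) - 2 * Re (c * rd (?z r) * (cnj (v (?z r) / of_real r))\<^sup>2))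
        / (1 / r\<^sup>2 + (cmod (v (?z r) / of_real r))\<^sup>2)\<^sup>2 = r\<^sup>2 * e_dens (?z r)"
      using eventually_compose_filterlim[OF Q_nz inf] eventually_gt_at_top[of 0]
    proof eventually_elim
      case (elim r)
      have 1: "1 / r\<^sup>2 + (cmod (v (?z r) / of_real r))\<^sup>2 = (1 + (cmod (v (?z r)))\<^sup>2) / r\<^sup>2"
        by (simp add: norm_divide power_divide add_divide_distrib)
      have 2: "Re (c * rd (?z r) * (cnj (v (?z r) / of_real r))\<^sup>2) = Re (c * rd (?z r) * (cnj (v (?z r)))\<^sup>2) / r\<^sup>2"
      proof -
        have "c * rd (?z r) * (cnj (v (?z r) / of_real r))\<^sup>2 = (c * rd (?z r) * (cnj (v (?z r)))\<^sup>2) / of_real (r\<^sup>2)"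
          by (simp add: power_divide)
        then show ?thesis by (simp only: Re_divide_of_real)
      qed
      have 3: "4 * (x * (1 / R) - 2 * (y / R)) / (N / R)\<^sup>2 = R * (4 * (x - 2 * y) / N\<^sup>2)" if "R > 0" "N > 0" for x y R N :: real
        using that by (simp add: field_simps power2_eq_square)
      show ?case unfolding 1 2 dens_v(1)[OF elim(1)] by (rule 3) (use elim(2) in \<open>auto intro: add_pos_nonneg\<close>)
    qed
    ultimately have "((\<lambda>r. r\<^sup>2 * e_dens (?z r)) \<longlongrightarrow>
      4 * (((cmod a)\<^sup>2 + (cmod c)\<^sup>2) * 0 - 2 * Re (c * a * (cnj (L z))\<^sup>2)) / (0 + (cmod (L z))\<^sup>2)\<^sup>2) at_top"
      by (rule Lim_transform_eventually)
    then show ?thesis by (simp add: f_def flip: power_mult)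
  qed
  moreover have "z \<noteq> 0 \<and> L z \<noteq> 0" if "z \<in> S'" for z
  proof -
    have "L z \<noteq> 0" using that by (auto simp: S'_def f_def)
    then show ?thesis by (auto simp: L_def)
  qed
  moreover have "e_dens \<in> borel_measurable borel" by (rule borel_measurable_continuous_onI[OF continuous_e_dens])
  ultimately show ?thesis
    by (intro not_integrable_homogeneous_limit[of e_dens S' "1/2" "\<lambda>z. - 8 * f z / (cmod (L z))^4"]) (auto simp: S'_def)
qed

section \<open>Energies and degree as integrals over \<open>complex\<close>\<close>

lemma energy_field_N:
  "energy_well_defined \<kappa> \<alpha> field_N \<longleftrightarrow> integrable lborel e_dens"
  "energy \<kappa> \<alpha> field_N = integral\<^sup>L lborel e_dens"
  "integrable lebesgue (degree_density field_N) \<longleftrightarrow> integrable lborel q_dens"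
  "magnetic_degree field_N = 1 / (4 * pi) * integral\<^sup>L lborel q_dens"
proof -
  have [measurable]: "e_dens \<in> borel_measurable borel" "q_dens \<in> borel_measurable borel"
    by (intro borel_measurable_continuous_onI continuous_e_dens continuous_q_dens)+
  have "energy_density \<kappa> \<alpha> field_N = (\<lambda>x. e_dens (complex_coord x))" "degree_density field_N = (\<lambda>x. q_dens (complex_coord x))"
    by (auto simp: energy_density_eq degree_density_eq)
  then show "energy_well_defined \<kappa> \<alpha> field_N \<longleftrightarrow> integrable lborel e_dens"
    "energy \<kappa> \<alpha> field_N = integral\<^sup>L lborel e_dens"
    "integrable lebesgue (degree_density field_N) \<longleftrightarrow> integrable lborel q_dens"
    "magnetic_degree field_N = 1 / (4 * pi) * integral\<^sup>L lborel q_dens"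
    unfolding energy_well_defined_def energy_def magnetic_degree_def by (simp_all add: lebesgue_complex_coord)
qed

lemma energy_nonlinear:
  assumes "degree p \<noteq> degree q + 1"
  shows "energy_well_defined \<kappa> \<alpha> field_N" "energy \<kappa> \<alpha> field_N = 4 * pi * real (max (degree p) (degree q + 1))"
proof -
  have int: "integrable lborel e_dens"
    using assms degree_s_eq_1_iff by (intro integrable_e_dens) auto
  then show "energy_well_defined \<kappa> \<alpha> field_N" by (simp add: energy_field_N)
  have "integral\<^sup>L lborel e_dens = 4 * pi * (degree q + k)"
    using tendsto_unique[OF _ integral_cball_tendsto[OF int] e_dens_disc_limit] by simp
  then show "energy \<kappa> \<alpha> field_N = 4 * pi * real (max (degree p) (degree q + 1))"
    unfolding energy_field_N degree_max by simp
qed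

text \<open>The circle integral of \<open>Theta\<close> tends to 4 * pi * (n + k) minus the integral
  of \<open>q_dens\<close>. Adding the degree removes that integral, and k = 1 makes n + k equal to
  m.\<close>

lemma energy_linear:
  assumes "degree p = degree q + 1"
  shows "\<not> energy_well_defined \<kappa> \<alpha> field_N" "regularised_energy_well_defined \<kappa> \<alpha> field_N"
    "regularised_energy \<kappa> \<alpha> field_N = 4 * pi * real (degree p)"
proof -
  have s: "degree s = 1" using assms degree_s_eq_1_iff by simp
  show "\<not> energy_well_defined \<kappa> \<alpha> field_N" unfolding energy_field_N by (rule not_integrable_e_dens[OF s])
  have q: "integrable lborel q_dens"
    using integrable_q_dens_nondegenerate[OF s] integrable_q_dens_degenerate[OF s] by blast
  have set: "set_integrable lborel (cball 0 R) g" if "continuous_on UNIV g" for R and g :: "complex \<Rightarrow> real"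
    unfolding set_integrable_def by (intro borel_integrable_compact continuous_on_subset[OF that]) auto
  have "((\<lambda>R. (LINT z:cball 0 R|lborel. e_dens z) - (LINT z:cball 0 R|lborel. q_dens z))
     \<longlongrightarrow> 4 * pi * (degree q + k) - integral\<^sup>L lborel q_dens) at_top"
    by (intro tendsto_diff e_dens_disc_limit integral_cball_tendsto q)
  moreover have "\<forall>\<^sub>F R in at_top. (LINT z:cball 0 R|lborel. e_dens z) - (LINT z:cball 0 R|lborel. q_dens z) = circle_integral (Theta \<kappa> \<alpha> field_N) R"
    using eventually_gt_at_top[of 0]
    by eventually_elim (simp add: Theta_disc set_integral_diff set continuous_e_dens continuous_q_dens)
  ultimately have lim: "((\<lambda>R. circle_integral (Theta \<kappa> \<alpha> field_N) R) \<longlongrightarrow> 4 * pi * (degree q + k) - integral\<^sup>L lborel q_dens) at_top"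
    by (rule Lim_transform_eventually)
  then show "regularised_energy_well_defined \<kappa> \<alpha> field_N"
    using q unfolding regularised_energy_well_defined_def energy_field_N by blast
  have "Lim at_top (\<lambda>R. circle_integral (Theta \<kappa> \<alpha> field_N) R) = 4 * pi * (degree q + k) - integral\<^sup>L lborel q_dens"
    by (rule tendsto_Lim[OF _ lim]) simp
  then show "regularised_energy \<kappa> \<alpha> field_N = 4 * pi * real (degree p)"
    unfolding regularised_energy_def vortex_strength_def energy_field_N
    using assms linear_case(1)[OF s] by (simp add: field_simps)
qed

end

theorem lemma4p2:
  fixes \<kappa> \<alpha> :: real and p q :: "complex poly" and m n :: nat
    and v :: "real^2 \<Rightarrow> riemann_sphere" and N :: "real^2 \<Rightarrow> real^3"
  assumes "\<kappa> > 0" and "0 \<le> \<alpha>" and "\<alpha> < 2 * pi"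
    and "q \<noteq> 0" and "coprime p q"
    and "degree p = m" and "degree q = n"
    and "v = skyrmion_v \<kappa> \<alpha> p q"
    and "N = magnetisation v"
  shows "(m \<noteq> n + 1 \<longrightarrow>
            energy_well_defined \<kappa> \<alpha> N \<and>
            energy \<kappa> \<alpha> N = 4 * pi * real (max m (n + 1))) \<and>
         (m = n + 1 \<longrightarrow>
            \<not> energy_well_defined \<kappa> \<alpha> N \<and>
            regularised_energy_well_defined \<kappa> \<alpha> N \<and>
            regularised_energy \<kappa> \<alpha> N = 4 * pi * real m)"
proof -
  interpret skyrmion \<kappa> \<alpha> p q by unfold_locales (use assms in auto)
  have N: "N = field_N" using assms by (simp add: field_N_def)
  show ?thesis unfolding N assms(6,7)[symmetric] using energy_nonlinear energy_linear by blast
qed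

end
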